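(* Let $r$ be any set of rank conditions with dimension vector $(e_0,\dots,e_n)$. Then, as rational functions in the indeterminates $a^i_j$, \[ \frac{\mathfrak G_{\widehat z(r)}(\breve a;a)}{\mathfrak G_{\widehat z(e)}(\breve a;a)}=\sum_{(w_1,\dots,w_n)}(-1)^{\ell(w_1)+\dots+\ell(w_n)-d(r)}\,\mathfrak G_{w_1}(a^1;a^0)\,\mathfrak G_{w_2}(a^2;a^1)\cdots\mathfrak G_{w_n}(a^n;a^{n-1}), \] where the sum is over all KMS-factorizations $(w_1,\dots,w_n)$ for $r$, and $\mathfrak G_{w_i}(a^i;a^{i-1})$ denotes $\mathfrak G_{w_i}(a^i_1,\dots,a^i_{e_i},1,\dots,1\,;\,a^{i-1}_1,\dots,a^{i-1}_{e_{i-1}},1,\dots,1)$ (with $e_{i-1}$ resp. $e_i$ trailing ones, so that both argument lists have length $e_{i-1}+e_i$).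
   Context: Rank conditions: fix $n\ge1$. A set of rank conditions is a family $r=\{r_{ij}\}_{0\le i\le j\le n}$ of non-negative integers with $r_{ij}\le\min(r_{i,j-1},r_{i+1,j})$ for $0\le i<j\le n$ and $r_{ij}+r_{i-1,j+1}\ge r_{i-1,j}+r_{i,j+1}$ for $0<i\le j<n$. Dimension vector $e_i=r_{ii}$. Extend by $r_{ij}=e_j+\dots+e_i$ for $j\le i$, and $r_{ij}=0$ if $i<0$ or $j>n$. $N=e_0+\dots+e_n$, $d(r)=\sum_{0\le i<j\le n}(r_{i,j-1}-r_{ij})(r_{i+1,j}-r_{ij})$. Permutations: $S_k$ on $\{1,\dots,k\}$, embedded in $S_{k+1}$ by fixing larger integers; $(uv)(p)=u(v(p))$; $s_i=(i,i+1)$; $\ell$ = length; $w_0^{(k)}$ the longest element of $S_k$. Absolute Hecke product: in the degenerate Hecke algebra (free algebra on $s_1,s_2,\dots$ modulo $s_is_j=s_js_i$ for $|i-j|\ge2$, braid relations, $s_i^2=-s_i$, with basis of permutations via reduced words), a product of permutations $u_1\cdots u_k$ equals $\pm w$ for a unique permutation $w$, denoted $u_1\cdot u_2\cdots u_k$. For $0\le i<n$, $0<j\le n$, $W_{ij}\in S_{r_{i+1,j-1}}$: $W_{ij}(p)=p+r_{i,j-1}-r_{ij}$ if $r_{ij}<p\le r_{i+1,j}$; $=p-r_{i+1,j}+r_{ij}$ if $r_{i+1,j}<p\le r_{i+1,j}+r_{i,j-1}-r_{ij}$; $=p$ otherwise. $z(r)=\prod_{j=1}^n\prod_{i=0}^{n-1}W_{ij}=(W_{01}\cdots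 W_{n-1,1})\cdots(W_{0n}\cdots W_{n-1,n})$ and $\widehat z(r)=w_0^{(N)}z(r)^{-1}w_0^{(N)}$. With $r^e_{ij}=\min(e_i,\dots,e_j)$, $\widehat z(e)=\widehat z(r^e)$. For $1\le j\le n-1$, $\delta_j\in S_{r_{n,j-1}}$: $\delta_j(p)=p$ for $p\le e_j$, $p+e_{j-1}$ for $e_j<p\le r_{nj}$, $p-r_{n,j+1}$ for $r_{nj}<p\le r_{n,j-1}$. A KMS-factorization for $r$ is $(w_1,\dots,w_n)$ with $w_i\in S_{e_{i-1}+e_i}$ and $w_1\cdot\delta_1\cdot w_2\cdots\delta_{n-1}\cdot w_n=z(r)$. Grothendieck polynomials: for $w\in S_M$, $\mathfrak G_w(a_1..a_M;b_1..b_M)$ is determined by $\mathfrak G_{w_0^{(M)}}=\prod_{p+q\le M}(1-b_p/a_q)$ and, when $w(i)<w(i+1)$, $(a_i-a_{i+1})\mathfrak G_w(a;b)=a_i\mathfrak G_{ws_i}(a;b)-a_{i+1}\mathfrak G_{ws_i}(a_{s_i};b)$ ($a_{s_i}$: $a_i,a_{i+1}$ swapped). Variables: $a^i=(a^i_1,\dots,a^i_{e_i})$ for $0\le i\le n$; $a=(a^0,\dots,a^n)$, $\breve a=(a^n,\dots,a^0)$ are the concatenated length-$N$ sequences (each block in its own order); $\mathfrak G_w(\breve a;a)$ is $\mathfrak G_w$ with first argument list $\breve a$ and second $a$. *)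

theory Defs
  imports
    "HOL-Library.Poly_Mapping"
    "HOL-Library.FuncSet"
    "HOL-Library.Nat_Bijection"
    "HOL-Computational_Algebra.Fraction_Field"
    "HOL-Combinatorics.Permutations"
begin

section \<open>Rank conditions\<close>

text \<open>A family of rank conditions is a function on pairs of naturals of which only the values
  at \<open>i \<le> j \<le> n\<close> are meaningful; the dimension vector is \<open>e i = r i i\<close>.\<close>

definition rank_conditions :: "nat \<Rightarrow> (nat \<Rightarrow> nat \<Rightarrow> nat) \<Rightarrow> bool" where
  "rank_conditions n r \<longleftrightarrow>
     (\<forall>i j. i < j \<and> j \<le> n \<longrightarrow> r i j \<le> min (r i (j - 1)) (r (i + 1) j)) \<and>
     (\<forall>i j. 0 < i \<and> i \<le> j \<and> j < n \<longrightarrow>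
        r (i - 1) j + r i (j + 1) \<le> r i j + r (i - 1) (j + 1))"

text \<open>The extension by \<open>r i j = e j + \<dots> + e i\<close> for \<open>j \<le> i\<close>. The further convention
  \<open>r i j = 0\<close> for \<open>i < 0\<close> or \<open>j > n\<close> is not encoded: every index occurring below lies in
  \<open>{0..n}\<close>.\<close>

definition rk :: "(nat \<Rightarrow> nat \<Rightarrow> nat) \<Rightarrow> nat \<Rightarrow> nat \<Rightarrow> nat" where
  "rk r i j = (if j \<le> i then \<Sum>k=j..i. r k k else r i j)"

definition total_dim :: "nat \<Rightarrow> (nat \<Rightarrow> nat \<Rightarrow> nat) \<Rightarrow> nat" where
  "total_dim n r = (\<Sum>i=0..n. r i i)"

definition expected_codim :: "nat \<Rightarrow> (nat \<Rightarrow> nat \<Rightarrow> nat) \<Rightarrow> int" where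
  "expected_codim n r =
     (\<Sum>(i, j) \<in> {(i, j). i < j \<and> j \<le> n}.
        (int (r i (j - 1)) - int (r i j)) * (int (r (i + 1) j) - int (r i j)))"

definition max_rank :: "(nat \<Rightarrow> nat \<Rightarrow> nat) \<Rightarrow> nat \<Rightarrow> nat \<Rightarrow> nat" where
  "max_rank r i j = Min ((\<lambda>k. r k k) ` {i..j})"


section \<open>Permutations\<close>

text \<open>\<open>S\<^sub>k\<close> is \<open>{w. w permutes {1..k}}\<close>, so that \<open>S\<^sub>k \<subseteq> S\<^sub>k\<^sub>+\<^sub>1\<close> as functions on \<open>nat\<close>.\<close>

definition adj :: "nat \<Rightarrow> nat \<Rightarrow> nat" where
  "adj i = transpose i (i + 1)"

definition perm_length :: "(nat \<Rightarrow> nat) \<Rightarrow> nat" where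
  "perm_length w = card {(p, q). p < q \<and> w q < w p}"

definition longest :: "nat \<Rightarrow> nat \<Rightarrow> nat" where
  "longest k p = (if 1 \<le> p \<and> p \<le> k then k + 1 - p else p)"

definition word_perm :: "nat list \<Rightarrow> nat \<Rightarrow> nat" where
  "word_perm is = foldr (\<lambda>i u. adj i \<circ> u) is id"

definition reduced_word :: "nat list \<Rightarrow> (nat \<Rightarrow> nat) \<Rightarrow> bool" where
  "reduced_word is w \<longleftrightarrow> (\<forall>i \<in> set is. 1 \<le> i) \<and> word_perm is = w \<and> length is = perm_length w"


section \<open>The degenerate Hecke algebra and the absolute Hecke product\<close>

text \<open>The free algebra over the integers on \<open>s\<^sub>1, s\<^sub>2, \<dots>\<close> consists of the finitely supported
  integer combinations of words. The following is its two-sided ideal of relations, i.e. the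
  additive subgroup generated by the elements \<open>xs \<cdot> relation \<cdot> ys\<close>; the degenerate Hecke algebra is
  the quotient by it.\<close>

inductive_set hecke_ideal :: "(nat list \<Rightarrow>\<^sub>0 int) set" where
  commute: "1 \<le> i \<Longrightarrow> i + 2 \<le> j \<Longrightarrow>
    Poly_Mapping.single (xs @ [i, j] @ ys) 1 - Poly_Mapping.single (xs @ [j, i] @ ys) 1
      \<in> hecke_ideal"
| braid: "1 \<le> i \<Longrightarrow>
    Poly_Mapping.single (xs @ [i, i + 1, i] @ ys) 1
      - Poly_Mapping.single (xs @ [i + 1, i, i + 1] @ ys) 1 \<in> hecke_ideal"
| square: "1 \<le> i \<Longrightarrow>
    Poly_Mapping.single (xs @ [i, i] @ ys) 1 + Poly_Mapping.single (xs @ [i] @ ys) 1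
      \<in> hecke_ideal"
| diff: "f \<in> hecke_ideal \<Longrightarrow> g \<in> hecke_ideal \<Longrightarrow> f - g \<in> hecke_ideal"

definition hecke_prod :: "(nat \<Rightarrow> nat) list \<Rightarrow> nat \<Rightarrow> nat" where
  "hecke_prod us = (THE w. (\<exists>k. w permutes {1..k}) \<and>
     (\<exists>xss ys c. list_all2 reduced_word xss us \<and> reduced_word ys w \<and> (c = 1 \<or> c = -1) \<and>
        Poly_Mapping.single (concat xss) 1 - Poly_Mapping.single ys c \<in> hecke_ideal))"


section \<open>Zelevinsky permutations and KMS-factorizations\<close>

definition W_perm :: "(nat \<Rightarrow> nat \<Rightarrow> nat) \<Rightarrow> nat \<Rightarrow> nat \<Rightarrow> nat \<Rightarrow> nat" where
  "W_perm r i j p =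
     (if rk r i j < p \<and> p \<le> rk r (i + 1) j
        then p + rk r i (j - 1) - rk r i j
      else if rk r (i + 1) j < p \<and> p \<le> rk r (i + 1) j + rk r i (j - 1) - rk r i j
        then p - rk r (i + 1) j + rk r i j
      else p)"

definition zel :: "nat \<Rightarrow> (nat \<Rightarrow> nat \<Rightarrow> nat) \<Rightarrow> nat \<Rightarrow> nat" where
  "zel n r = foldr (\<circ>) (concat (map (\<lambda>j. map (\<lambda>i. W_perm r i j) [0..<n]) [1..<n + 1])) id"

definition zel_hat :: "nat \<Rightarrow> (nat \<Rightarrow> nat \<Rightarrow> nat) \<Rightarrow> nat \<Rightarrow> nat" where
  "zel_hat n r = longest (total_dim n r) \<circ> inv (zel n r) \<circ> longest (total_dim n r)"

definition delta_perm :: "nat \<Rightarrow> (nat \<Rightarrow> nat \<Rightarrow> nat) \<Rightarrow> nat \<Rightarrow> nat \<Rightarrow> nat" where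
  "delta_perm n r j p =
     (if p \<le> r j j then p
      else if p \<le> rk r n j then p + r (j - 1) (j - 1)
      else if p \<le> rk r n (j - 1) then p - rk r n (j + 1)
      else p)"

text \<open>The tuple \<open>(w\<^sub>1, \<dots>, w\<^sub>n)\<close> is an extensional function on \<open>{1..n}\<close>.\<close>

definition kms_factorizations ::
    "nat \<Rightarrow> (nat \<Rightarrow> nat \<Rightarrow> nat) \<Rightarrow> (nat \<Rightarrow> nat \<Rightarrow> nat) set" where
  "kms_factorizations n r =
     {w \<in> (\<Pi>\<^sub>E i \<in> {1..n}. {u. u permutes {1..r (i - 1) (i - 1) + r i i}}).
        hecke_prod (w 1 # concat (map (\<lambda>j. [delta_perm n r j, w (j + 1)]) [1..<n])) = zel n r}"


section \<open>Grothendieck polynomials\<close>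

text \<open>Since arguments are later specialised to coinciding values, where the recursion would
  divide by zero, \<open>\<GG>\<^sub>w\<close> is first determined as a Laurent polynomial in indeterminates
  \<open>a\<^sub>q\<close> and \<open>b\<^sub>p\<close>, and then evaluated. Laurent polynomials are the group ring of the
  finitely supported integer exponent vectors.\<close>

datatype gvar = A nat | B nat

type_synonym laurent = "(gvar \<Rightarrow>\<^sub>0 int) \<Rightarrow>\<^sub>0 int"

definition lvar_pow :: "gvar \<Rightarrow> int \<Rightarrow> laurent" where
  "lvar_pow x k = Poly_Mapping.single (Poly_Mapping.single x k) 1"

abbreviation lvar :: "gvar \<Rightarrow> laurent" where
  "lvar x \<equiv> lvar_pow x 1"

text \<open>\<open>f(a\<^sub>s\<^sub>i; b)\<close>: exchange \<open>a\<^sub>i\<close> and \<open>a\<^sub>i\<^sub>+\<^sub>1\<close>.\<close>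

definition swap_a :: "nat \<Rightarrow> laurent \<Rightarrow> laurent" where
  "swap_a i = Poly_Mapping.map_key (Poly_Mapping.map_key (transpose (A i) (A (i + 1))))"

definition grothendieck_family :: "nat \<Rightarrow> ((nat \<Rightarrow> nat) \<Rightarrow> laurent) \<Rightarrow> bool" where
  "grothendieck_family M G \<longleftrightarrow>
     G (longest M) =
       (\<Prod>(p, q) \<in> {(p, q). 1 \<le> p \<and> 1 \<le> q \<and> p + q \<le> M}. 1 - lvar (B p) * lvar_pow (A q) (-1)) \<and>
     (\<forall>w i. w permutes {1..M} \<and> 1 \<le> i \<and> i < M \<and> w i < w (i + 1) \<longrightarrow>
        (lvar (A i) - lvar (A (i + 1))) * G w =
          lvar (A i) * G (w \<circ> adj i) - lvar (A (i + 1)) * swap_a i (G (w \<circ> adj i)))"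

definition grothendieck_laurent :: "nat \<Rightarrow> (nat \<Rightarrow> nat) \<Rightarrow> laurent" where
  "grothendieck_laurent M w = (THE g. \<exists>G. grothendieck_family M G \<and> G w = g)"

definition laurent_eval :: "(gvar \<Rightarrow> 'a::field) \<Rightarrow> laurent \<Rightarrow> 'a" where
  "laurent_eval v f =
     (\<Sum>m \<in> Poly_Mapping.keys f. of_int (Poly_Mapping.lookup f m) *
        (\<Prod>x \<in> Poly_Mapping.keys m. v x powi Poly_Mapping.lookup m x))"

text \<open>\<open>grothendieck w as bs\<close> is \<open>\<GG>\<^sub>w(as; bs)\<close> for \<open>w \<in> S\<^sub>M\<close>, where \<open>M\<close> is the common
  length of the two argument lists.\<close>

definition grothendieck :: "(nat \<Rightarrow> nat) \<Rightarrow> 'a::field list \<Rightarrow> 'a list \<Rightarrow> 'a" where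
  "grothendieck w as bs =
     laurent_eval (\<lambda>x. case x of A q \<Rightarrow> as ! (q - 1) | B p \<Rightarrow> bs ! (p - 1))
       (grothendieck_laurent (length as) w)"


section \<open>The variables\<close>

text \<open>The field of rational functions in countably many indeterminates; the injection
  \<open>prod_encode\<close> makes \<open>X i j\<close>, which stands for \<open>a\<^sup>i\<^sub>j\<close>, distinct indeterminates.\<close>

type_synonym ratfun = "((nat \<Rightarrow>\<^sub>0 nat) \<Rightarrow>\<^sub>0 int) fract"

definition X :: "nat \<Rightarrow> nat \<Rightarrow> ratfun" where
  "X i j = Fraction_Field.Fract
     (Poly_Mapping.single (Poly_Mapping.single (prod_encode (i, j)) 1) 1) 1"

definition block :: "(nat \<Rightarrow> nat \<Rightarrow> nat) \<Rightarrow> nat \<Rightarrow> ratfun list" where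
  "block r i = map (X i) [1..<r i i + 1]"

definition all_vars :: "nat \<Rightarrow> (nat \<Rightarrow> nat \<Rightarrow> nat) \<Rightarrow> ratfun list" where
  "all_vars n r = concat (map (block r) [0..<n + 1])"

definition all_vars_breve :: "nat \<Rightarrow> (nat \<Rightarrow> nat \<Rightarrow> nat) \<Rightarrow> ratfun list" where
  "all_vars_breve n r = concat (map (block r) (rev [0..<n + 1]))"

definition grothendieck_block :: "(nat \<Rightarrow> nat \<Rightarrow> nat) \<Rightarrow> nat \<Rightarrow> (nat \<Rightarrow> nat) \<Rightarrow> ratfun" where
  "grothendieck_block r i w =
     grothendieck w
       (block r i @ replicate (r (i - 1) (i - 1)) 1)
       (block r (i - 1) @ replicate (r i i) 1)"

end

theory Submission
  imports Defs
begin

text \<open>The degenerate Hecke algebra is, up to signs, the monoid algebra of the 0-Hecke monoid of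
  permutations under the Demazure product. With \<open>h\<^sub>i(t) = 1 - (1 - t) s\<^sub>i\<close> for the idempotent
  generators \<open>s\<^sub>i\<close> there is a product \<open>\<Phi>(a)\<close> of such factors with
  \<open>\<Phi>(\<dots> a\<^sub>i\<^sub>+\<^sub>1 a\<^sub>i \<dots>) = \<Phi>(a) h\<^sub>i(a\<^sub>i / a\<^sub>i\<^sub>+\<^sub>1)\<close>, and the double Grothendieck polynomials are,
  up to sign, the coefficients of \<open>\<Phi>(b)\<^sup>-\<^sup>1 \<Phi>(a)\<close>.

  If \<open>a\<close> is a rearrangement of \<open>b\<close>, then \<open>\<Phi>(b)\<^sup>-\<^sup>1 \<Phi>(a)\<close> is a product of one factor \<open>h\<^sub>i\<close> for each
  adjacent swap leading from \<open>b\<close> to \<open>a\<close>. The blocks \<open>a\<^sup>0 \<dots> a\<^sup>n\<close> are turned into \<open>a\<^sup>n \<dots> a\<^sup>0\<close> by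
  moving, for \<open>j = 1, \<dots>, n\<close>, the block \<open>a\<^sup>j\<^sup>-\<^sup>1\<close> past \<open>a\<^sup>j\<close> (a rectangle \<open>R\<^sub>j\<close> of factors) and then past
  \<open>a\<^sup>j\<^sup>+\<^sup>1 \<dots> a\<^sup>n\<close> (a reduced word of \<open>\<delta>\<^sub>j\<close>). Every subword whose Demazure product is \<open>z(r)\<close> contains all
  letters of the latter kind, so their parameters split off as a common factor, which is
  \<open>\<plusminus>\<GG>\<close> for \<open>z(e)\<close>, and what remains is the coefficient of \<open>z(r)\<close> in
  \<open>R\<^sub>1 \<delta>\<^sub>1 R\<^sub>2 \<dots> \<delta>\<^sub>n\<^sub>-\<^sub>1 R\<^sub>n\<close>. Replacing \<open>R\<^sub>j\<close> by \<open>\<Phi>(a\<^sup>j\<^sup>-\<^sup>1, 1)\<^sup>-\<^sup>1 \<Phi>(a\<^sup>j, 1)\<close> multiplies this product on both sides by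
  factors that do not affect the coefficient, because \<open>z(r)\<close> has no descents inside the blocks.\<close>


section \<open>Finite permutations and the 0-Hecke monoid\<close>

text \<open>The statement concerns the conjugated inverse of \<open>z(r)\<close>, while the
  factorization argument treats \<open>z(r)\<close> itself. The anti-automorphism joining the two
  reverses words and lists: it restores the order of the blocks but leaves each block reversed
  inside. These internal reversals consist of swaps within blocks, and the absence of descents
  absorbs them.

  Idempotent generators keep signs out of the algebra. Only parities of lengths matter in the end,
  and the exponent splits into \<open>d(r)\<close> and a part depending on the dimension vector
  alone, which cancels in the quotient. The denominator then needs only that for maximal ranks the
  remaining coefficient is 1.

  The absolute Hecke product is a definite description modulo an ideal. Its existence needs a
  rewriting of words to reduced ones up to sign; its uniqueness needs a linear map that kills the
  ideal and still separates permutations, which the monoid algebra supplies. The Grothendieck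
  polynomials are descriptions as well, resolved by checking their recursion in the Laurent ring and
  transporting the coefficients along evaluation.\<close>

lemma adj_apply: "adj i x = (if x = i then Suc i else if x = Suc i then i else x)"
  by (simp add: adj_def transpose_def)

lemma adj_adj [simp]: "adj i (adj i x) = x"
  by (simp add: adj_apply)

lemma adj_comp_adj [simp]: "adj i \<circ> adj i = id" "adj i \<circ> (adj i \<circ> w) = w" "w \<circ> adj i \<circ> adj i = w"
  by (auto simp: fun_eq_iff)

lemma bij_adj: "bij (adj i)"
  by (simp add: adj_def)

lemma inv_adj [simp]: "inv (adj i) = adj i"
  by (simp add: adj_def)

lemma adj_less_iff:
  assumes "x \<noteq> y" "\<not> (x = j \<and> y = Suc j)" "\<not> (x = Suc j \<and> y = j)"
  shows "adj j x < adj j y \<longleftrightarrow> x < y"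
  using assms by (auto simp: adj_apply)

lemma adj_permutes: "a \<le> i \<Longrightarrow> Suc i < b \<Longrightarrow> adj i permutes {a..<b}"
  by (simp add: adj_def permutes_swap_id)

section \<open>Inversions, length and descents\<close>

definition inversions :: "(nat \<Rightarrow> nat) \<Rightarrow> (nat \<times> nat) set" where
  "inversions w = {(p, q). p < q \<and> w q < w p}"

lemma perm_length_eq: "perm_length w = card (inversions w)"
  by (simp add: perm_length_def inversions_def)

lemma perm_length_id: "perm_length id = 0"
proof -
  have "{(p::nat, q). p < q \<and> id q < id p} = {}" by (auto dest: less_asym)
  thus ?thesis by (simp only: perm_length_def card.empty)
qed

lemma finite_inversions:
  assumes "w permutes {a..<b}"
  shows "finite (inversions w)"
proof (rule finite_subset)
  show "inversions w \<subseteq> {..<b} \<times> {..<b}"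
  proof (clarsimp simp: inversions_def)
    fix p q assume pq: "p < q" "w q < w p"
    have "q < b"
    proof (rule ccontr)
      assume "\<not> q < b"
      hence q: "w q = q" using assms by (auto simp: permutes_def)
      show False
      proof (cases "p \<in> {a..<b}")
        case True
        hence "w p \<in> {a..<b}" using permutes_in_image[OF assms] by blast
        thus False using pq q \<open>\<not> q < b\<close> by auto
      next
        case False
        hence "w p = p" using assms by (auto simp: permutes_def)
        thus False using pq q by auto
      qed
    qed
    thus "p < b \<and> q < b" using pq by auto
  qed
qed auto

text \<open>Composing with \<open>adj i\<close> relabels positions, and \<open>adj i\<close>
  preserves the order of every pair except the neighbours \<open>i\<close>, \<open>Suc i\<close>.
  Hence the old inversions are carried along injectively and only that pair is new.\<close>

lemma inversions_comp_adj:
  assumes "w i < w (Suc i)"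
  shows "inversions (w \<circ> adj i) = insert (i, Suc i) ((\<lambda>(p, q). (adj i p, adj i q)) ` inversions w)"
    and "(i, Suc i) \<notin> (\<lambda>(p, q). (adj i p, adj i q)) ` inversions w"
proof -
  have 1: "(adj i p, adj i q) \<in> inversions (w \<circ> adj i)" if "(p, q) \<in> inversions w" for p q
  proof -
    have "\<not> (p = i \<and> q = Suc i)" using that assms by (auto simp: inversions_def)
    thus ?thesis using that by (auto simp: inversions_def adj_less_iff)
  qed
  have 2: "(adj i p, adj i q) \<in> inversions w" if "(p, q) \<in> inversions (w \<circ> adj i)" "(p, q) \<noteq> (i, Suc i)" for p q
    using that by (auto simp: inversions_def adj_less_iff)
  show "inversions (w \<circ> adj i) = insert (i, Suc i) ((\<lambda>(p, q). (adj i p, adj i q)) ` inversions w)"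
  proof (intro equalityI subsetI)
    fix x assume x: "x \<in> inversions (w \<circ> adj i)"
    obtain p q where pq: "x = (p, q)" by fastforce
    show "x \<in> insert (i, Suc i) ((\<lambda>(p, q). (adj i p, adj i q)) ` inversions w)"
    proof (cases "x = (i, Suc i)")
      case False
      hence "(adj i p, adj i q) \<in> inversions w" using 2 x pq by auto
      thus ?thesis unfolding pq by (auto intro!: image_eqI[where x = "(adj i p, adj i q)"])
    qed auto
  next
    fix x assume "x \<in> insert (i, Suc i) ((\<lambda>(p, q). (adj i p, adj i q)) ` inversions w)"
    moreover have "(i, Suc i) \<in> inversions (w \<circ> adj i)" using assms by (simp add: inversions_def adj_apply)
    ultimately show "x \<in> inversions (w \<circ> adj i)" using 1 by auto
  qed
  show "(i, Suc i) \<notin> (\<lambda>(p, q). (adj i p, adj i q)) ` inversions w"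
  proof
    assume "(i, Suc i) \<in> (\<lambda>(p, q). (adj i p, adj i q)) ` inversions w"
    then obtain p q where "(p, q) \<in> inversions w" "i = adj i p" "Suc i = adj i q" by auto
    moreover from this have "p = Suc i" "q = i" by (auto simp: adj_apply split: if_splits)
    ultimately show False by (auto simp: inversions_def)
  qed
qed

lemma perm_length_comp_adj:
  assumes "w permutes {a..<b}" "w i < w (Suc i)"
  shows "perm_length (w \<circ> adj i) = Suc (perm_length w)"
proof -
  have "inj_on (\<lambda>(p, q). (adj i p, adj i q)) (inversions w)"
    by (rule inj_on_inverseI[where g = "\<lambda>(p, q). (adj i p, adj i q)"]) auto
  thus ?thesis
    unfolding perm_length_eq inversions_comp_adj(1)[OF assms(2)]
    using inversions_comp_adj(2)[OF assms(2)] finite_inversions[OF assms(1)]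
    by (simp add: card_image)
qed

lemma permutes_inj_eq: "w permutes S \<Longrightarrow> w x = w y \<longleftrightarrow> x = y"
  by (meson injD permutes_inj)

lemma permutes_comp_adj:
  "w permutes {a..<b} \<Longrightarrow> a \<le> i \<Longrightarrow> Suc i < b \<Longrightarrow> w \<circ> adj i permutes {a..<b}"
  by (intro permutes_compose adj_permutes)

lemma perm_length_comp_adj_descent:
  assumes "w permutes {a..<b}" "w (Suc i) < w i" "a \<le> i" "Suc i < b"
  shows "Suc (perm_length (w \<circ> adj i)) = perm_length w"
  using perm_length_comp_adj[of "w \<circ> adj i" a b i] permutes_comp_adj[OF assms(1,3,4)] assms(2)
  by (simp add: adj_apply)

lemma no_descent_imp_id:
  assumes "w permutes {a..<b}" "\<And>i. a \<le> i \<Longrightarrow> Suc i < b \<Longrightarrow> w i < w (Suc i)"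
  shows "w = id"
proof -
  \<comment> \<open>The ascents extend to all naturals: outside the interval \<open>w\<close> is the
    identity, and at either border a fixed point meets the image of the interval. A strictly
    increasing bijection is then squeezed by \<open>x \<le> w x\<close> and the same bound for its
    inverse.\<close>
  have "w i < w (Suc i)" for i
  proof (cases "a \<le> i \<and> Suc i < b")
    case False
    have in_im: "w x \<in> {a..<b}" if "x \<in> {a..<b}" for x using permutes_in_image[OF assms(1)] that by blast
    have out: "w x = x" if "x \<notin> {a..<b}" for x using assms(1) that by (simp add: permutes_def)
    consider "Suc i < a" | "Suc i = a" "a < b" | "b \<le> i" | "Suc i = b" "a \<le> i" | "Suc i = a" "b \<le> a"
      using False by linarith
    thus ?thesis
    proof cases
      case 2 thus ?thesis using out[of i] in_im[of "Suc i"] by auto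
    next
      case 4 thus ?thesis using out[of "Suc i"] in_im[of i] by auto
    qed (use out[of i] out[of "Suc i"] in auto)
  qed (use assms in auto)
  hence sm: "strict_mono w" by (simp add: strict_mono_Suc_iff)
  have ge: "x \<le> w x" for x using sm by (simp add: strict_mono_imp_increasing)
  have "x \<le> inv w x" for x
  proof (rule strict_mono_imp_increasing, rule strict_monoI)
    fix x y :: nat assume "x < y"
    thus "inv w x < inv w y"
      using sm assms(1) by (metis permutes_inverses(1) strict_mono_less)
  qed
  hence "w x \<le> x" for x using sm assms(1) by (metis permutes_inverses(1) strict_mono_less_eq permutes_inv_eq)
  thus ?thesis using ge by (auto simp: fun_eq_iff intro: antisym)
qed

lemma descent_exists:
  assumes "w permutes {a..<b}" "w \<noteq> id"
  obtains i where "a \<le> i" "Suc i < b" "w (Suc i) < w i"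
proof -
  obtain i where "a \<le> i" "Suc i < b" "\<not> w i < w (Suc i)" using no_descent_imp_id assms by blast
  moreover have "w i \<noteq> w (Suc i)" using assms(1) by (simp add: permutes_inj_eq)
  ultimately show ?thesis using that[of i] by auto
qed

section \<open>Words, reduced words and their permutations\<close>

lemma word_perm_Nil [simp]: "word_perm [] = id"
  by (simp add: word_perm_def)

lemma word_perm_Cons [simp]: "word_perm (i # xs) = adj i \<circ> word_perm xs"
  by (simp add: word_perm_def)

lemma word_perm_append [simp]: "word_perm (xs @ ys) = word_perm xs \<circ> word_perm ys"
  by (induction xs) (auto simp: o_assoc)

lemma word_perm_permutes:
  "set xs \<subseteq> {a..<b - 1} \<Longrightarrow> word_perm xs permutes {a..<b}"
  by (induction xs) (auto simp: permutes_id intro!: permutes_compose adj_permutes)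

lemma ex_word_permutes: "\<exists>b. word_perm xs permutes {0..<b}"
proof
  show "word_perm xs permutes {0..<Suc (Suc (Max (insert 0 (set xs))))}"
    by (rule word_perm_permutes) (auto simp: less_Suc_eq_le)
qed

lemma reduced_word_exists:
  assumes "w permutes {a..<b}"
  shows "\<exists>xs. set xs \<subseteq> {a..<b - 1} \<and> word_perm xs = w \<and> length xs = perm_length w"
  using assms
proof (induction "perm_length w" arbitrary: w rule: less_induct)
  case less
  show ?case
  proof (cases "w = id")
    case True
    have "perm_length id = 0" by (rule perm_length_id)
    thus ?thesis using True by (intro exI[of _ "[]"]) auto
  next
    case False
    obtain i where i: "a \<le> i" "Suc i < b" "w (Suc i) < w i" using descent_exists less.prems False by blast
    have l: "Suc (perm_length (w \<circ> adj i)) = perm_length w"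
      using perm_length_comp_adj_descent less.prems i by blast
    obtain xs where "set xs \<subseteq> {a..<b - 1}" "word_perm xs = w \<circ> adj i" "length xs = perm_length (w \<circ> adj i)"
      using less.hyps[of "w \<circ> adj i"] l less.prems i permutes_comp_adj by force
    thus ?thesis using i l by (intro exI[of _ "xs @ [i]"]) auto
  qed
qed

lemma perm_length_word_le: "perm_length (word_perm xs) \<le> length xs"
proof (induction xs rule: rev_induct)
  case (snoc i xs)
  obtain b where "word_perm (xs @ [i]) permutes {0..<b}" using ex_word_permutes by blast
  obtain b where b: "word_perm xs permutes {0..<b}" using ex_word_permutes by blast
  let ?w = "word_perm xs" and ?b = "max b (Suc (Suc i))"
  have pw: "?w permutes {0..<?b}" by (rule permutes_subset[OF b]) auto
  have "?w i \<noteq> ?w (Suc i)" using pw by (simp add: permutes_inj_eq)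
  hence "perm_length (?w \<circ> adj i) \<le> Suc (perm_length ?w)"
    using perm_length_comp_adj[OF pw, of i] perm_length_comp_adj_descent[OF pw, of i] by force
  moreover have "perm_length (word_perm (xs @ [i])) = perm_length (?w \<circ> adj i)" by (simp add: o_def)
  moreover have "length (xs @ [i]) = Suc (length xs)" by simp
  ultimately show ?case using snoc.IH by linarith
qed (simp add: perm_length_id[unfolded id_def] perm_length_id)

section \<open>Demazure multiplication by one generator on either side\<close>

definition dright :: "nat \<Rightarrow> (nat \<Rightarrow> nat) \<Rightarrow> nat \<Rightarrow> nat" where
  "dright i w = (if w i < w (Suc i) then w \<circ> adj i else w)"

definition dleft :: "nat \<Rightarrow> (nat \<Rightarrow> nat) \<Rightarrow> nat \<Rightarrow> nat" where
  "dleft i w = (if inv w i < inv w (Suc i) then adj i \<circ> w else w)"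

lemma inv_adj_comp: "bij w \<Longrightarrow> inv (adj i \<circ> w) = inv w \<circ> adj i"
  by (simp add: o_inv_distrib bij_adj)

lemma inv_comp_adj: "bij w \<Longrightarrow> inv (w \<circ> adj i) = adj i \<circ> inv w"
  by (simp add: o_inv_distrib bij_adj)

text \<open>Left multiplication compares the places of the values \<open>i\<close>,
  \<open>Suc i\<close>; right multiplication compares the values at the places \<open>j\<close>,
  \<open>Suc j\<close>. They interfere only when these places hold exactly these values. Then either
  one makes the same exchange and leaves the other nothing to do, or neither changes
  anything.\<close>

lemma dright_dleft_commute:
  assumes "bij w"
  shows "dleft i (dright j w) = dright j (dleft i w)"
proof -
  let ?a = "inv w i" and ?b = "inv w (Suc i)"
  have wa: "w ?a = i" "w ?b = Suc i" using assms by (simp_all add: bij_inv_eq_iff[symmetric] bij_is_surj surj_f_inv_f)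
  have ne: "?a \<noteq> ?b" using wa by auto
  have inj: "w x = w y \<longleftrightarrow> x = y" for x y using assms by (meson bij_is_inj injD)
  consider "?a = j \<and> ?b = Suc j" | "?a = Suc j \<and> ?b = j" | "\<not> (?a = j \<and> ?b = Suc j)" "\<not> (?a = Suc j \<and> ?b = j)" by blast
  thus ?thesis
  proof cases
    case 1
    hence w: "w j = i" "w (Suc j) = Suc i" using wa by auto
    have "adj i \<circ> w = w \<circ> adj j"
    proof
      fix x show "(adj i \<circ> w) x = (w \<circ> adj j) x"
        using w inj[of x j] inj[of x "Suc j"] by (auto simp: adj_apply)
    qed
    thus ?thesis using 1 w assms by (simp add: dleft_def dright_def inv_comp_adj adj_apply)
  next
    case 2
    hence w: "w j = Suc i" "w (Suc j) = i" using wa by auto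
    thus ?thesis using 2 w assms by (simp add: dleft_def dright_def)
  next
    case 3
    have 1: "inv (w \<circ> adj j) i < inv (w \<circ> adj j) (Suc i) \<longleftrightarrow> ?a < ?b"
      using 3 ne assms by (simp add: inv_comp_adj adj_less_iff)
    have w3: "\<not> (w j = i \<and> w (Suc j) = Suc i)" "\<not> (w j = Suc i \<and> w (Suc j) = i)"
      using 3 inj wa by metis+
    have 2: "(adj i \<circ> w) j < (adj i \<circ> w) (Suc j) \<longleftrightarrow> w j < w (Suc j)"
      using w3 inj[of j "Suc j"] by (simp add: adj_less_iff)
    show ?thesis unfolding dleft_def dright_def using 1 2 by (simp add: o_assoc)
  qed
qed

typedef fperm = "{w :: nat \<Rightarrow> nat. \<exists>b. w permutes {0..<b}}" morphisms app Abs_fperm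
  using permutes_id by blast

setup_lifting type_definition_fperm

lemma permutes_0_mono: "w permutes {0..<b} \<Longrightarrow> b \<le> c \<Longrightarrow> w permutes {0..<c::nat}"
  by (rule permutes_subset) auto

lemma ex_permutes_comp:
  assumes "\<exists>b. u permutes {0..<b::nat}" "\<exists>b. v permutes {0..<b}"
  shows "\<exists>b. u \<circ> v permutes {0..<b}"
proof -
  from assms obtain b c where "u permutes {0..<b}" "v permutes {0..<c}" by auto
  hence "u permutes {0..<max b c}" "v permutes {0..<max b c}" by (auto intro: permutes_0_mono)
  thus ?thesis using permutes_compose by blast
qed

lemma ex_permutes_adj: "\<exists>b. adj i permutes {0..<b}"
  by (rule exI[of _ "Suc (Suc i)"]) (simp add: adj_permutes)

lift_definition gen :: "nat \<Rightarrow> fperm" is adj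
  by (rule ex_permutes_adj)

lift_definition rmul :: "nat \<Rightarrow> fperm \<Rightarrow> fperm" is dright
  unfolding dright_def using ex_permutes_comp ex_permutes_adj by simp

lift_definition lmul :: "nat \<Rightarrow> fperm \<Rightarrow> fperm" is dleft
  unfolding dleft_def using ex_permutes_comp ex_permutes_adj by simp

instantiation fperm :: zero
begin
lift_definition zero_fperm :: fperm is id by (rule exI) (rule permutes_id)
instance ..
end

lemma app_permutes: "\<exists>b. app w permutes {0..<b}"
  using app by auto

lemma bij_app: "bij (app w)"
  using app_permutes permutes_bij by blast

lemma app_eq_iff: "app w x = app w y \<longleftrightarrow> x = y"
  by (meson bij_app bij_is_inj injD)

lemma app_inv [simp]: "app w (inv (app w) x) = x" "inv (app w) (app w x) = x"
  by (simp_all add: bij_app bij_is_surj surj_f_inv_f bij_is_inj)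

lemma app_Abs: "w permutes {a..<b} \<Longrightarrow> app (Abs_fperm w) = w"
  by (rule Abs_fperm_inverse) (auto intro!: exI[of _ b] elim: permutes_subset)

lemma lmul_rmul: "lmul i (rmul j w) = rmul j (lmul i w)"
proof (transfer fixing: i j)
  fix w :: "nat \<Rightarrow> nat" assume "\<exists>b. w permutes {0..<b}"
  thus "dleft i (dright j w) = dright j (dleft i w)"
    using permutes_bij dright_dleft_commute by blast
qed

definition act :: "nat list \<Rightarrow> fperm \<Rightarrow> fperm" where
  "act xs w = foldl (\<lambda>w i. rmul i w) w xs"

lemma act_simps [simp]: "act [] w = w" "act (i # xs) w = act xs (rmul i w)" "act (xs @ ys) w = act ys (act xs w)"
  by (simp_all add: act_def)

lemma lmul_act: "lmul i (act xs w) = act xs (lmul i w)"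
  by (induction xs arbitrary: w) (auto simp: lmul_rmul)

lemma lmul_0: "lmul i 0 = gen i"
  by transfer (simp add: dleft_def inv_id[unfolded id_def])

lemma rmul_0: "rmul i 0 = gen i"
  by transfer (simp add: dright_def)

text \<open>Left and right multiplications commute, so a word applied to the identity from the right
  can be applied from the left instead. This is what \<open>act_cong\<close> rests on.\<close>

lemma act_eq_foldr: "act xs 0 = foldr lmul xs 0"
  by (induction xs) (auto simp: lmul_act[symmetric] rmul_0 lmul_0[symmetric])

text \<open>A descent at the last letter would lower the length, while the length of the prefix is
  already at most its number of letters; the full word could then not be reduced.\<close>

lemma dright_word_perm:
  assumes "length (xs @ [i]) = perm_length (word_perm (xs @ [i]))"
  shows "length xs = perm_length (word_perm xs)" "word_perm xs i < word_perm xs (Suc i)"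
proof -
  obtain b where b: "word_perm xs permutes {0..<b}" using ex_word_permutes by blast
  let ?w = "word_perm xs" and ?b = "max b (Suc (Suc i))"
  have pw: "?w permutes {0..<?b}" by (rule permutes_0_mono[OF b]) auto
  have le: "perm_length ?w \<le> length xs" by (rule perm_length_word_le)
  have ne: "?w i \<noteq> ?w (Suc i)" using pw by (simp add: permutes_inj_eq)
  have eq: "perm_length (?w \<circ> adj i) = Suc (length xs)" using assms by simp
  show *: "?w i < ?w (Suc i)"
    using perm_length_comp_adj_descent[OF pw, of i] ne le eq by force
  show "length xs = perm_length (word_perm xs)"
    using perm_length_comp_adj[OF pw *] eq by simp
qed

lemma act_reduced:
  assumes "length xs = perm_length (word_perm xs)"
  shows "app (act xs 0) = word_perm xs"
  using assms
proof (induction xs rule: rev_induct)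
  case (snoc i xs)
  from dright_word_perm[OF snoc.prems] snoc.IH
  have "app (act xs 0) = word_perm xs" "word_perm xs i < word_perm xs (Suc i)" by auto
  thus ?case by (simp add: rmul.rep_eq dright_def)
qed (simp add: zero_fperm.rep_eq)

lemma act_surj: "\<exists>xs. act xs 0 = w"
proof -
  obtain b where "app w permutes {0..<b}" using app_permutes by blast
  from reduced_word_exists[OF this] obtain xs where "word_perm xs = app w" "length xs = perm_length (app w)"
    by auto
  thus ?thesis using act_reduced[of xs] by (auto simp: app_inject)
qed

text \<open>Left and right multiplications commute, so that the Demazure product \<open>u + act xs 0\<close> does not
  depend on the word \<open>xs\<close>. This replaces an appeal to Matsumoto's theorem.\<close>

lemma act_cong:
  assumes "act xs 0 = act ys 0"
  shows "act xs u = act ys u"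
proof -
  obtain us where us: "u = act us 0" using act_surj by metis
  have "act zs u = foldr lmul us (act zs 0)" for zs
  proof -
    have "act zs u = act (us @ zs) 0" by (simp add: us)
    also have "\<dots> = foldr lmul us (act zs 0)" by (simp only: act_eq_foldr foldr_append)
    finally show ?thesis .
  qed
  thus ?thesis using assms by simp
qed

text \<open>The Demazure product is written additively because multiplication of
  \<open>poly_mapping\<close> adds keys: the type \<open>fperm \<Rightarrow>\<^sub>0 'r\<close>
  thereby becomes the monoid algebra. The word for \<open>v\<close> is an arbitrary choice, harmless
  by \<open>act_cong\<close>.\<close>

instantiation fperm :: monoid_add
begin

definition plus_fperm :: "fperm \<Rightarrow> fperm \<Rightarrow> fperm" where
  "plus_fperm u v = act (SOME xs. act xs 0 = v) u"

lemma plus_act: "u + act xs 0 = act xs u"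
  unfolding plus_fperm_def by (rule act_cong) (rule someI, rule refl)

instance
proof
  fix u v w :: fperm
  obtain xs ys where v: "v = act xs 0" and w: "w = act ys 0" using act_surj by metis
  have "v + w = act (xs @ ys) 0" by (simp add: w plus_act v)
  hence "u + (v + w) = act (xs @ ys) u" by (simp only: plus_act)
  thus "u + v + w = u + (v + w)" by (simp add: plus_act v w)
  show "0 + v = v" by (simp add: v plus_act)
  show "v + 0 = v" using plus_act[of v "[]"] by simp
qed

end

lemma plus_gen: "w + gen i = rmul i w"
  using plus_act[of w "[i]"] by (simp add: rmul_0)

lemma gen_plus: "gen i + w = lmul i w"
proof -
  obtain xs where "w = act xs 0" using act_surj by metis
  thus ?thesis by (simp add: plus_act lmul_act lmul_0)
qed

lemma act_append_plus: "act (xs @ ys) 0 = act xs 0 + act ys 0"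
  by (simp add: plus_act)

lemma act_Cons_plus: "act (i # xs) 0 = gen i + act xs 0"
  using act_append_plus[of "[i]" xs] by (simp add: rmul_0)

lemma dright_idem: "dright i (dright i w) = dright i w"
  by (simp add: dright_def adj_apply)

lemma gen_idem: "gen i + gen i = gen i"
proof -
  have "rmul i (rmul i 0) = rmul i 0" by transfer (rule dright_idem)
  thus ?thesis by (simp add: plus_gen rmul_0)
qed

lemma gen_commute:
  assumes "Suc i < j"
  shows "gen i + gen j = gen j + gen i"
proof -
  have "dright i (dright j w) = dright j (dright i w)" for w
    using assms by (auto simp: dright_def fun_eq_iff adj_apply)
  hence "rmul i (rmul j 0) = rmul j (rmul i 0)" by transfer
  thus ?thesis by (metis plus_gen rmul_0)
qed

lemma gen_braid: "gen i + gen (Suc i) + gen i = gen (Suc i) + gen i + gen (Suc i)"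
proof -
  have "rmul i (rmul (Suc i) (rmul i 0)) = rmul (Suc i) (rmul i (rmul (Suc i) 0))"
    by transfer (simp add: dright_def adj_apply, auto simp: fun_eq_iff adj_apply)
  thus ?thesis by (simp add: plus_gen rmul_0)
qed


section \<open>The degenerate Hecke algebra as a monoid algebra\<close>

abbreviation single where "single \<equiv> Poly_Mapping.single"
abbreviation lookup where "lookup \<equiv> Poly_Mapping.lookup"
abbreviation keys where "keys \<equiv> Poly_Mapping.keys"

lemma poly_mapping_single_induct:
  fixes F :: "'a \<Rightarrow>\<^sub>0 'b::comm_monoid_add"
  assumes "P 0" "\<And>k c. P (single k c)" "\<And>F G. P F \<Longrightarrow> P G \<Longrightarrow> P (F + G)"
  shows "P F"
proof -
  have sum: "P (\<Sum>k\<in>K. single k (c k))" if "finite K" for K c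
    using that by induction (auto intro: assms)
  have "F = (\<Sum>k\<in>keys F. single k (lookup F k))"
    by (rule poly_mapping_eqI) (auto simp: lookup_sum lookup_single when_def in_keys_iff)
  thus ?thesis using sum[of "keys F" "lookup F"] by simp
qed

definition hh :: "nat \<Rightarrow> 'r::comm_ring_1 \<Rightarrow> fperm \<Rightarrow>\<^sub>0 'r" where
  "hh i t = 1 + single (gen i) (t - 1)"

lemma hh_1 [simp]: "hh i 1 = 1"
  by (simp add: hh_def)

lemma hh_mult: "hh i s * hh i t = hh i (s * t)"
  by (simp add: hh_def algebra_simps mult_single gen_idem single_add[symmetric] single_diff)
    
lemma hh_commute: "Suc i < j \<Longrightarrow> hh i s * hh j t = hh j t * hh i s"
  using gen_commute[of i j] by (simp add: hh_def algebra_simps mult_single mult.commute)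

lemma hh_commute': "Suc i < j \<or> Suc j < i \<Longrightarrow> hh i s * hh j t = hh j t * hh i s"
  using hh_commute[of i j s t] hh_commute[of j i t s] by auto

lemma triple_product:
  fixes a b :: "'m::monoid_add" and S T V :: "'r::comm_ring_1"
  assumes "a + a = a"
  shows "(1 + single a S) * ((1 + single b V) * (1 + single a T)) =
    1 + single a (S + T + S * T) + single b V + single (a + b) (S * V) + single (b + a) (V * T)
      + single (a + (b + a)) (S * V * T)"
proof -
  have "(1 + single a S) * (1 + single a T) = 1 + single a (S + T + S * T)"
    by (simp add: distrib_left distrib_right mult_single assms single_add add_ac)
  moreover have "(1 + single a S) * ((1 + single b V) * (1 + single a T)) =
    (1 + single a S) * (1 + single a T) + (1 + single a S) * (single b V * (1 + single a T))"
    by (simp only: distrib_left distrib_right mult_1_left mult_1_right add_ac)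
  moreover have "(1 + single a S) * (single b V * (1 + single a T)) =
    single b V + single (a + b) (S * V) + single (b + a) (V * T) + single (a + (b + a)) (S * V * T)"
    by (simp only: distrib_left distrib_right mult_single mult_1_left mult_1_right mult.assoc add_ac)
  ultimately show ?thesis by (simp only: add.assoc)
qed

text \<open>The middle parameter is the product of the outer ones, which makes
  \<open>S + T + S * T\<close> the coefficient of the repeated outer letter as well as of the middle
  letter. The two expansions by \<open>triple_product\<close> then agree term by term, the longest
  ones by the braid relation.\<close>

lemma hh_yang_baxter:
  "hh i s * (hh (Suc i) (s * t) * hh i t) = hh (Suc i) t * (hh i (s * t) * hh (Suc i) s)"
proof -
  define S T where "S = s - 1" and "T = t - 1"
  have st: "s * t - 1 = S + T + S * T" by (simp add: S_def T_def algebra_simps)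
  have b: "gen (Suc i) + (gen i + gen (Suc i)) = gen i + (gen (Suc i) + gen i)"
    using gen_braid[of i] by (simp add: add.assoc)
  show ?thesis
    unfolding hh_def st S_def[symmetric] T_def[symmetric] triple_product[OF gen_idem] b
    by (simp only: add_ac mult_ac)
qed

section \<open>Descents and the effect of one factor on a coefficient\<close>

lift_definition lsw :: "nat \<Rightarrow> fperm \<Rightarrow> fperm" is "\<lambda>i w. adj i \<circ> w"
  using ex_permutes_comp ex_permutes_adj by simp

lift_definition rsw :: "nat \<Rightarrow> fperm \<Rightarrow> fperm" is "\<lambda>i w. w \<circ> adj i"
  using ex_permutes_comp ex_permutes_adj by simp

definition ldesc :: "nat \<Rightarrow> fperm \<Rightarrow> bool" where
  "ldesc i w \<longleftrightarrow> inv (app w) (Suc i) < inv (app w) i"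

definition rdesc :: "nat \<Rightarrow> fperm \<Rightarrow> bool" where
  "rdesc i w \<longleftrightarrow> app w (Suc i) < app w i"

lemma inv_app_eq_iff: "inv (app w) x = inv (app w) y \<longleftrightarrow> x = y"
  by (metis app_inv(1))

lemma app_lsw: "app (lsw i w) = adj i \<circ> app w"
  by (rule lsw.rep_eq)

lemma app_rsw: "app (rsw i w) = app w \<circ> adj i"
  by (rule rsw.rep_eq)

lemma inv_app_lsw: "inv (app (lsw i w)) = inv (app w) \<circ> adj i"
  by (simp add: app_lsw inv_adj_comp bij_app)

lemma lsw_lsw [simp]: "lsw i (lsw i w) = w"
  by (simp add: app_inject[symmetric] app_lsw)

lemma rsw_rsw [simp]: "rsw i (rsw i w) = w"
  by (simp add: app_inject[symmetric] app_rsw o_assoc[symmetric])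

lemma lmul_eq: "lmul i w = (if ldesc i w then w else lsw i w)"
  using inv_app_eq_iff[of w i "Suc i"]
  by (auto simp: app_inject[symmetric] lmul.rep_eq dleft_def ldesc_def app_lsw)

lemma rmul_eq: "rmul i w = (if rdesc i w then w else rsw i w)"
  using app_eq_iff[of w i "Suc i"]
  by (auto simp: app_inject[symmetric] rmul.rep_eq dright_def rdesc_def app_rsw)

lemma ldesc_lsw: "ldesc i (lsw i w) \<longleftrightarrow> \<not> ldesc i w"
  using inv_app_eq_iff[of w i "Suc i"] by (auto simp: ldesc_def inv_app_lsw adj_apply)

lemma rdesc_rsw: "rdesc i (rsw i w) \<longleftrightarrow> \<not> rdesc i w"
  using app_eq_iff[of w i "Suc i"] by (auto simp: rdesc_def app_rsw adj_apply)

lemma lmul_eq_iff: "lmul i v = w \<longleftrightarrow> ldesc i w \<and> (v = w \<or> v = lsw i w)"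
  unfolding lmul_eq by (metis ldesc_lsw lsw_lsw)

lemma rmul_eq_iff: "rmul i v = w \<longleftrightarrow> rdesc i w \<and> (v = w \<or> v = rsw i w)"
  unfolding rmul_eq by (metis rdesc_rsw rsw_rsw)

lemma lsw_neq: "lsw i w \<noteq> w"
  by (metis ldesc_lsw)

lemma rsw_neq: "rsw i w \<noteq> w"
  by (metis rdesc_rsw)

text \<open>The fibre of \<open>lmul i\<close> over \<open>w\<close> is empty unless
  \<open>i\<close> is a left descent of \<open>w\<close>, and is the pair
  \<open>{w, lsw i w}\<close> otherwise.\<close>

lemma lookup_gen_left:
  "lookup (single (gen i) c * Y) w = (if ldesc i w then c * (lookup Y w + lookup Y (lsw i w)) else (0 :: 'r::comm_ring_1))"
proof (induction Y rule: poly_mapping_single_induct)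
  case (2 k d)
  have "lsw i w \<noteq> w" by (rule lsw_neq)
  thus ?case by (auto simp: mult_single lookup_single when_def gen_plus lmul_eq_iff)
qed (auto simp: distrib_left lookup_add algebra_simps)

lemma lookup_gen_right:
  "lookup (Y * single (gen i) c) w = (if rdesc i w then c * (lookup Y w + lookup Y (rsw i w)) else (0 :: 'r::comm_ring_1))"
proof (induction Y rule: poly_mapping_single_induct)
  case (2 k d)
  have "rsw i w \<noteq> w" by (rule rsw_neq)
  thus ?case by (auto simp: mult_single lookup_single when_def plus_gen rmul_eq_iff)
qed (auto simp: distrib_right lookup_add algebra_simps)

lemma lookup_hh_left:
  "lookup (hh i t * Y) w = lookup Y w + (if ldesc i w then (t - 1) * (lookup Y w + lookup Y (lsw i w)) else 0)"
  by (simp add: hh_def distrib_right lookup_add lookup_gen_left)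

lemma lookup_hh_right:
  "lookup (Y * hh i t) w = lookup Y w + (if rdesc i w then (t - 1) * (lookup Y w + lookup Y (rsw i w)) else 0)"
  by (simp add: hh_def distrib_left lookup_add lookup_gen_right)

definition prodh :: "(nat \<times> 'r::comm_ring_1) list \<Rightarrow> fperm \<Rightarrow>\<^sub>0 'r" where
  "prodh ws = prod_list (map (\<lambda>(i, t). hh i t) ws)"

lemma prodh_simps [simp]:
  "prodh [] = 1" "prodh ((i, t) # ws) = hh i t * prodh ws" "prodh (us @ ws) = prodh us * prodh ws"
  by (simp_all add: prodh_def)

lemma prodh_commute:
  assumes "\<And>i t. (i, t) \<in> set ws \<Longrightarrow> hh i t * Z = Z * hh i t"
  shows "prodh ws * Z = Z * prodh ws"
  using assms
proof (induction ws)
  case (Cons w ws)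
  obtain i t where w: "w = (i, t)" by fastforce
  have 1: "hh i t * Z = Z * hh i t" using Cons.prems by (auto simp: w)
  have 2: "prodh ws * Z = Z * prodh ws" using Cons by (auto simp: w)
  have "prodh (w # ws) * Z = hh i t * (prodh ws * Z)" by (simp add: w mult.assoc)
  also have "\<dots> = (hh i t * Z) * prodh ws" unfolding 2 by (simp only: mult.assoc)
  also have "\<dots> = Z * prodh (w # ws)" unfolding 1 by (simp add: w mult.assoc)
  finally show ?case .
qed simp

lemma prodh_no_ldesc:
  assumes "\<And>i. i \<in> fst ` set ws \<Longrightarrow> \<not> ldesc i z"
  shows "lookup (prodh ws * Y) z = lookup Y z"
  using assms by (induction ws) (auto simp: mult.assoc lookup_hh_left)

lemma prodh_no_rdesc:
  assumes "\<And>i. i \<in> fst ` set ws \<Longrightarrow> \<not> rdesc i z"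
  shows "lookup (Y * prodh ws) z = lookup Y z"
  using assms
proof (induction ws rule: rev_induct)
  case (snoc w ws)
  obtain i t where w: "w = (i, t)" by fastforce
  have "lookup (Y * prodh (ws @ [w])) z = lookup ((Y * prodh ws) * hh i t) z"
    by (simp add: w mult.assoc)
  also have "\<dots> = lookup (Y * prodh ws) z" using snoc.prems[of i] by (simp add: lookup_hh_right w)
  finally show ?case using snoc by simp
qed simp

text \<open>The coefficients are integer polynomials in the parameters, hence compatible with ring
  homomorphisms.\<close>

lemma lookup_prodh_hom:
  fixes h :: "'r::comm_ring_1 \<Rightarrow> 's::comm_ring_1"
  assumes one: "h 1 = 1" and add: "\<And>x y. h (x + y) = h x + h y" and mult: "\<And>x y. h (x * y) = h x * h y"
  shows "h (lookup (prodh ws) w) = lookup (prodh (map (\<lambda>(i, t). (i, h t)) ws)) w"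
proof -
  have zero: "h 0 = 0" using add[of 0 0] by simp
  have diff: "h (x - y) = h x - h y" for x y using add[of "x - y" y] by (simp add: algebra_simps)
  show ?thesis
  proof (induction ws arbitrary: w)
    case Nil show ?case by (simp add: lookup_one when_def one zero)
  next
    case (Cons p ws)
    obtain i t where p: "p = (i, t)" by fastforce
    show ?case by (simp add: p lookup_hh_left Cons.IH zero add mult diff one)
  qed
qed

subsection \<open>Supports in subwords\<close>

primrec subwords_act :: "nat list \<Rightarrow> fperm \<Rightarrow> fperm set" where
  "subwords_act [] z = {z}"
| "subwords_act (i # xs) z = subwords_act xs z \<union> lmul i ` subwords_act xs z"

lemma subwords_act_append:
  "subwords_act (xs @ ys) z = (\<Union>y \<in> subwords_act ys z. subwords_act xs y)"
  by (induction xs) auto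

text \<open>Bounding the keys of every product \<open>U * Y\<close>, and not only those of
  \<open>U\<close>, turns \<open>supp_mult\<close> into a composition of bounds;
  \<open>Y = 1\<close> gives back the keys of \<open>U\<close>.\<close>

definition supp :: "nat list \<Rightarrow> (fperm \<Rightarrow>\<^sub>0 'r::comm_ring_1) set" where
  "supp u = {U. \<forall>Y. keys (U * Y) \<subseteq> (\<Union>z \<in> keys Y. subwords_act u z)}"

lemma supp_mult: "U \<in> supp u \<Longrightarrow> V \<in> supp v \<Longrightarrow> U * V \<in> supp (u @ v)"
  unfolding supp_def by (fastforce simp: mult.assoc subwords_act_append)

lemma supp_1: "1 \<in> supp []"
  by (auto simp: supp_def)

lemma keys_gen_left: "keys (single (gen i) c * Y) \<subseteq> lmul i ` keys Y"
  using keys_mult[of "single (gen i) c" Y] by (auto simp: gen_plus split: if_splits)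

lemma supp_gen: "single (gen i) c \<in> supp [i]"
  using keys_gen_left by (fastforce simp: supp_def)

lemma supp_hh: "hh i t \<in> supp [i]"
  unfolding supp_def
proof (intro CollectI allI)
  fix Y
  have "keys (hh i t * Y) \<subseteq> keys Y \<union> keys (single (gen i) (t - 1) * Y)"
    unfolding hh_def distrib_right mult_1_left by (rule Poly_Mapping.keys_add)
  thus "keys (hh i t * Y) \<subseteq> (\<Union>z\<in>keys Y. subwords_act [i] z)"
    using keys_gen_left[of i "t - 1" Y] by fastforce
qed

lemma supp_prodh: "prodh ws \<in> supp (map fst ws)"
proof (induction ws)
  case (Cons p ws)
  obtain i t where p: "p = (i, t)" by fastforce
  show ?case using supp_mult[OF supp_hh[of i t] Cons.IH] by (simp add: p)
qed (simp add: supp_1)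

lemma single_act_Cons: "single (act (i # xs) 0) 1 = (single (gen i) 1 * single (act xs 0) 1 :: _ \<Rightarrow>\<^sub>0 'r::comm_ring_1)"
  unfolding mult_single act_Cons_plus by simp

lemma supp_single_act: "single (act xs 0) 1 \<in> supp xs"
proof (induction xs)
  case Nil
  have "single (0::fperm) 1 = (1 :: fperm \<Rightarrow>\<^sub>0 'a)" by simp
  thus ?case using supp_1 by simp
next
  case (Cons i xs)
  thus ?case using supp_mult[OF supp_gen Cons.IH, of i 1] by (simp only: single_act_Cons append_Cons append_Nil)
qed

lemma keys_supp: "U \<in> supp u \<Longrightarrow> keys U \<subseteq> subwords_act u 0"
  unfolding supp_def by (drule CollectD, drule spec[of _ 1]) auto

lemma permutes_lmul:
  assumes "app z permutes {a..<b}" "a \<le> i" "Suc i < b"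
  shows "app (lmul i z) permutes {a..<b}"
  using assms permutes_compose[OF assms(1) adj_permutes] by (simp add: lmul_eq app_lsw)

lemma subwords_act_permutes:
  assumes "set u \<subseteq> {a..<b - 1}" "app z permutes {a..<b}" "y \<in> subwords_act u z"
  shows "app y permutes {a..<b}"
  using assms(1,3)
proof (induction u arbitrary: y)
  case (Cons i u)
  have i: "a \<le> i" "Suc i < b" using Cons.prems(1) by auto
  from Cons.prems(2) consider "y \<in> subwords_act u z" | y' where "y' \<in> subwords_act u z" "y = lmul i y'"
    by auto
  thus ?case
  proof cases
    case 1 thus ?thesis using Cons.IH Cons.prems(1) by simp
  next
    case 2 thus ?thesis using Cons.IH Cons.prems(1) permutes_lmul[OF _ i] by simp
  qed
qed (use assms(2) in auto)

subsection \<open>The anti-automorphism induced by conjugation with the longest element\<close>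

lemma longest_permutes: "longest N permutes {1..<Suc N}"
proof (rule bij_imp_permutes)
  show "bij_betw (longest N) {1..<Suc N} {1..<Suc N}"
    by (rule bij_betwI[where g = "longest N"]) (auto simp: longest_def)
qed (auto simp: longest_def)

lemma longest_longest [simp]: "longest N (longest N p) = p"
  by (auto simp: longest_def)

lift_definition star :: "nat \<Rightarrow> fperm \<Rightarrow> fperm" is "\<lambda>N w. longest N \<circ> inv w \<circ> longest N"
proof -
  fix N and w :: "nat \<Rightarrow> nat" assume "\<exists>b. w permutes {0..<b}"
  moreover have "\<exists>b. longest N permutes {0..<b}"
    by (rule exI[of _ "Suc N"], rule permutes_subset[OF longest_permutes]) auto
  ultimately show "\<exists>b. longest N \<circ> inv w \<circ> longest N permutes {0..<b}"
    by (intro ex_permutes_comp) (auto intro: permutes_inv)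
qed

lemma longest_at:
  assumes "1 \<le> i" "i < N"
  shows "longest N (N - i) = Suc i" "longest N (Suc (N - i)) = i"
  using assms by (auto simp: longest_def)

lemma adj_longest:
  assumes "1 \<le> i" "i < N"
  shows "adj i (longest N p) = longest N (adj (N - i) p)"
proof -
  consider "p = N - i" | "p = Suc (N - i)" | "p \<noteq> N - i" "p \<noteq> Suc (N - i)" by blast
  thus ?thesis
  proof cases
    case 1
    thus ?thesis by (simp only: longest_at[OF assms] adj_apply simp_thms if_True) (simp add: longest_at[OF assms])
  next
    case 2
    thus ?thesis by (simp only: longest_at[OF assms] adj_apply simp_thms if_True) (simp add: longest_at[OF assms])
  next
    case 3
    hence "longest N p \<noteq> longest N (Suc (N - i))" "longest N p \<noteq> longest N (N - i)"
      by (metis longest_longest)+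
    thus ?thesis using 3 by (simp add: longest_at[OF assms] adj_apply)
  qed
qed

lemma star_lsw: "1 \<le> i \<Longrightarrow> i < N \<Longrightarrow> star N (lsw i w) = rsw (N - i) (star N w)"
  by (simp add: app_inject[symmetric] star.rep_eq inv_app_lsw app_rsw fun_eq_iff adj_longest)

lemma rdesc_star:
  assumes "app w permutes {1..<Suc N}" "1 \<le> i" "i < N"
  shows "rdesc (N - i) (star N w) \<longleftrightarrow> ldesc i w"
proof -
  note l = longest_at[OF assms(2,3)]
  have "inv (app w) i \<in> {1..<Suc N}" "inv (app w) (Suc i) \<in> {1..<Suc N}"
    using assms permutes_in_image[OF permutes_inv[OF assms(1)]] by auto
  hence "longest N (inv (app w) i) < longest N (inv (app w) (Suc i)) \<longleftrightarrow> inv (app w) (Suc i) < inv (app w) i"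
    unfolding longest_def by auto
  thus ?thesis by (simp add: rdesc_def ldesc_def star.rep_eq l)
qed

lemma star_eq_0: "star N w = 0 \<longleftrightarrow> w = 0"
proof -
  have "longest N \<circ> inv (app w) \<circ> longest N = id \<longleftrightarrow> app w = id"
  proof
    assume a: "longest N \<circ> inv (app w) \<circ> longest N = id"
    have "inv (app w) x = x" for x
      using fun_cong[OF a, of "longest N x"] by (metis comp_apply id_apply longest_longest)
    thus "app w = id" by (metis app_inv(1) eq_id_iff)
  next
    assume "app w = id"
    thus "longest N \<circ> inv (app w) \<circ> longest N = id" by (simp only: inv_id) (auto simp: fun_eq_iff)
  qed
  thus ?thesis by (simp add: app_inject[symmetric] star.rep_eq zero_fperm.rep_eq)
qed

definition star_word :: "nat \<Rightarrow> (nat \<times> 'r) list \<Rightarrow> (nat \<times> 'r) list" where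
  "star_word N ws = rev (map (\<lambda>(i, t). (N - i, t)) ws)"

lemma star_word_simps: "star_word N [] = []" "star_word N ((i, t) # ws) = star_word N ws @ [(N - i, t)]"
  "star_word N (us @ ws) = star_word N ws @ star_word N us"
  by (simp_all add: star_word_def)

text \<open>\<open>star N\<close> reverses products only within the permutations of
  \<open>{1..<Suc N}\<close>, where \<open>longest N\<close> acts. Comparing the recursion for a
  factor on the left at \<open>w\<close> with the one for a factor on the right at
  \<open>star N w\<close> avoids treating it as a map of the whole monoid.\<close>

lemma lookup_star_word:
  assumes "fst ` set ws \<subseteq> {1..<N}" "app w permutes {1..<Suc N}"
  shows "lookup (prodh (star_word N ws)) (star N w) = lookup (prodh ws) w"
  using assms
proof (induction ws arbitrary: w)
  case Nil
  thus ?case by (simp add: star_word_simps lookup_one star_eq_0)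
next
  case (Cons p ws)
  obtain i t where p: "p = (i, t)" by fastforce
  have i: "1 \<le> i" "i < N" using Cons.prems p by auto
  have "app (lsw i w) permutes {1..<Suc N}"
    unfolding app_lsw using Cons.prems i by (intro permutes_compose adj_permutes) auto
  hence "lookup (prodh (star_word N ws)) (star N (lsw i w)) = lookup (prodh ws) (lsw i w)"
    using Cons by auto
  moreover have "lookup (prodh (star_word N ws)) (star N w) = lookup (prodh ws) w"
    using Cons by auto
  moreover have "rdesc (N - i) (star N w) \<longleftrightarrow> ldesc i w" using rdesc_star Cons.prems i by blast
  moreover have "rsw (N - i) (star N w) = star N (lsw i w)" using star_lsw i by simp
  ultimately show ?case by (simp add: p star_word_simps lookup_hh_right lookup_hh_left)
qed


section \<open>Double Grothendieck polynomials as coefficients\<close>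

text \<open>A variable is represented as a pair consisting of a unit and its inverse, so that the same
  construction applies to Laurent polynomials and to elements of a field.\<close>

definition unit_pair :: "'r::comm_ring_1 \<times> 'r \<Rightarrow> bool" where
  "unit_pair x \<longleftrightarrow> fst x * snd x = 1"

primrec acol :: "nat \<Rightarrow> nat \<Rightarrow> 'r \<Rightarrow> (nat \<times> 'r) list" where
  "acol c 0 t = []"
| "acol c (Suc k) t = acol (Suc c) k t @ [(Suc c, t)]"

text \<open>Each variable contributes a descending run of letters whose parameter is its inverse,
  and each run is one letter shorter than the one before. The run of the last variable is empty, so
  the product does not depend on that variable.\<close>

primrec phi :: "nat \<Rightarrow> ('r \<times> 'r) list \<Rightarrow> (nat \<times> 'r) list" where
  "phi c [] = []"
| "phi c (x # xs) = acol c (length xs) (snd x) @ phi (Suc c) xs"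

definition phi_inv :: "nat \<Rightarrow> ('r \<times> 'r) list \<Rightarrow> (nat \<times> 'r) list" where
  "phi_inv c xs = rev (phi c (map prod.swap xs))"

lemma letters_acol: "fst ` set (acol c k t) = {c<..c + k}"
  by (induction k arbitrary: c) auto

lemma letters_phi: "fst ` set (phi c xs) \<subseteq> {c<..<c + length xs}"
proof (induction xs arbitrary: c)
  case (Cons x xs)
  have "{Suc c<..<Suc c + length xs} \<subseteq> {c<..<c + length (x # xs)}"
    "{c<..c + length xs} \<subseteq> {c<..<c + length (x # xs)}" by auto
  thus ?case using Cons[of "Suc c"] by (simp only: phi.simps set_append image_Un letters_acol Un_least)
qed simp

lemma letters_phi_inv: "fst ` set (phi_inv c xs) \<subseteq> {c<..<c + length xs}"
  unfolding phi_inv_def using letters_phi[of c "map prod.swap xs"] by simp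

lemma prodh_inverse:
  assumes "list_all2 (\<lambda>(i, s) (j, t). i = j \<and> s * t = 1) us vs"
  shows "prodh (rev us) * prodh vs = 1" "prodh vs * prodh (rev us) = 1"
proof -
  have "prodh (rev us) * prodh vs = 1 \<and> prodh vs * prodh (rev us) = 1"
    using assms
  proof (induction rule: list_all2_induct)
    case (Cons u us v vs)
    obtain i s t where u: "u = (i, s)" "v = (i, t)" "s * t = 1" using Cons(1) by (cases u, cases v) auto
    have "prodh (rev (u # us)) * prodh (v # vs) = prodh (rev us) * (hh i s * hh i t) * prodh vs"
      by (simp only: u rev.simps prodh_simps mult.assoc mult_1_right)
    also have "\<dots> = 1" using Cons by (simp add: hh_mult u)
    finally have 1: "prodh (rev (u # us)) * prodh (v # vs) = 1" .
    have "prodh (v # vs) * prodh (rev (u # us)) = hh i t * (prodh vs * prodh (rev us)) * hh i s"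
      by (simp only: u rev.simps prodh_simps mult.assoc mult_1_right)
    also have "\<dots> = 1" using Cons by (simp add: hh_mult u mult.commute)
    finally show ?case using 1 by simp
  qed simp
  thus "prodh (rev us) * prodh vs = 1" "prodh vs * prodh (rev us) = 1" by auto
qed

lemma list_all2_acol:
  "s * t = 1 \<Longrightarrow> list_all2 (\<lambda>(i, s) (j, t). i = j \<and> s * t = 1) (acol c k s) (acol c k t)"
  by (induction k arbitrary: c) (auto intro: list_all2_appendI)

lemma list_all2_phi:
  "\<forall>x\<in>set xs. unit_pair x \<Longrightarrow>
    list_all2 (\<lambda>(i, s) (j, t). i = j \<and> s * t = 1) (phi c (map prod.swap xs)) (phi c xs)"
  by (induction xs arbitrary: c) (auto intro!: list_all2_appendI list_all2_acol simp: unit_pair_def)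

lemma phi_inv_phi:
  assumes "\<forall>x\<in>set xs. unit_pair x"
  shows "prodh (phi_inv c xs) * prodh (phi c xs) = 1" "prodh (phi c xs) * prodh (phi_inv c xs) = 1"
  unfolding phi_inv_def using prodh_inverse[OF list_all2_phi[OF assms]] by auto

text \<open>The Yang-Baxter relation at the lower ends of the two runs turns the extra factor at
  \<open>Suc c\<close> into one at \<open>Suc (Suc c)\<close> with the same parameter, which the
  parts of the runs above absorb by induction.\<close>

lemma acol_exchange:
  fixes x y :: "'r::comm_ring_1 \<times> 'r"
  assumes "unit_pair x" "unit_pair y"
  shows "prodh (acol c (Suc k) (snd x)) * (prodh (acol (Suc c) k (snd y)) * hh (Suc c) (fst x * snd y)) =
    prodh (acol c (Suc k) (snd y)) * prodh (acol (Suc c) k (snd x))"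
proof (induction k arbitrary: c)
  case 0
  have "snd x * (fst x * snd y) = snd y" using assms by (simp add: unit_pair_def mult.assoc[symmetric] mult.commute)
  thus ?case by (simp add: hh_mult)
next
  case (Suc k)
  have xy: "snd x * (fst x * snd y) = snd y"
    using assms by (simp add: unit_pair_def mult.assoc[symmetric] mult.commute)
  define P where "P = (\<lambda>t::'r. prodh (acol (Suc c) (Suc k) t))"
  define Q where "Q = (\<lambda>t::'r. prodh (acol (Suc (Suc c)) k t))"
  have comm: "hh (Suc c) s * Q t = Q t * hh (Suc c) s" for s t
    unfolding Q_def
  proof (rule prodh_commute[symmetric])
    fix i u assume "(i, u) \<in> set (acol (Suc (Suc c)) k t)"
    hence "i \<in> fst ` set (acol (Suc (Suc c)) k t)" by force
    hence "Suc (Suc c) < i" unfolding letters_acol by auto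
    thus "hh i u * hh (Suc c) s = hh (Suc c) s * hh i u" by (intro hh_commute') auto
  qed
  have yb: "hh (Suc c) (snd x) * (hh (Suc (Suc c)) (snd y) * hh (Suc c) (fst x * snd y)) =
    hh (Suc (Suc c)) (fst x * snd y) * (hh (Suc c) (snd y) * hh (Suc (Suc c)) (snd x))"
    using hh_yang_baxter[of "Suc c" "snd x" "fst x * snd y"] by (simp only: xy)
  have IH: "P (snd x) * (Q (snd y) * hh (Suc (Suc c)) (fst x * snd y)) = P (snd y) * Q (snd x)"
    unfolding P_def Q_def using Suc.IH[of "Suc c"] .
  have "P (snd x) * hh (Suc c) (snd x) * (Q (snd y) * hh (Suc (Suc c)) (snd y) * hh (Suc c) (fst x * snd y))
    = P (snd x) * ((hh (Suc c) (snd x) * Q (snd y)) * (hh (Suc (Suc c)) (snd y) * hh (Suc c) (fst x * snd y)))"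
    by (simp only: mult.assoc)
  also have "\<dots> = P (snd x) * (Q (snd y) * (hh (Suc c) (snd x) * (hh (Suc (Suc c)) (snd y) * hh (Suc c) (fst x * snd y))))"
    by (simp only: comm mult.assoc)
  also have "\<dots> = (P (snd x) * (Q (snd y) * hh (Suc (Suc c)) (fst x * snd y))) * (hh (Suc c) (snd y) * hh (Suc (Suc c)) (snd x))"
    by (simp only: yb mult.assoc)
  also have "\<dots> = P (snd y) * ((Q (snd x) * hh (Suc c) (snd y)) * hh (Suc (Suc c)) (snd x))"
    by (simp only: IH mult.assoc)
  also have "\<dots> = P (snd y) * hh (Suc c) (snd y) * (Q (snd x) * hh (Suc (Suc c)) (snd x))"
    by (simp only: comm[symmetric] mult.assoc)
  finally show ?case
    by (simp only: acol.simps(2)[of c "Suc k"] acol.simps(2)[of "Suc c" k] prodh_simps P_def[symmetric]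
        Q_def[symmetric] mult_1_right) (simp only: P_def Q_def acol.simps prodh_simps mult_1_right)
qed

lemma phi_exchange:
  assumes "unit_pair x" "unit_pair y"
  shows "prodh (phi c (pre @ x # y # post)) * hh (Suc (c + length pre)) (fst x * snd y)
    = prodh (phi c (pre @ y # x # post))"
proof (induction pre arbitrary: c)
  case Nil
  let ?R = "prodh (phi (Suc (Suc c)) post)" and ?h = "hh (Suc c) (fst x * snd y)"
  have comm: "?R * ?h = ?h * ?R"
  proof (rule prodh_commute)
    fix i u assume "(i, u) \<in> set (phi (Suc (Suc c)) post)"
    hence "i \<in> fst ` set (phi (Suc (Suc c)) post)" by force
    hence "Suc (Suc c) < i" using letters_phi[of "Suc (Suc c)" post] by auto
    thus "hh i u * ?h = ?h * hh i u" by (intro hh_commute') auto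
  qed
  have "prodh (phi c ([] @ x # y # post)) * ?h =
    prodh (acol c (Suc (length post)) (snd x)) * (prodh (acol (Suc c) (length post) (snd y)) * (?R * ?h))"
    by (simp only: append_Nil phi.simps prodh_simps mult.assoc list.size add_0_right add_Suc_right)
  also have "\<dots> = (prodh (acol c (Suc (length post)) (snd x)) * (prodh (acol (Suc c) (length post) (snd y)) * ?h)) * ?R"
    by (simp only: comm mult.assoc)
  also have "\<dots> = prodh (phi c ([] @ y # x # post))"
    unfolding acol_exchange[OF assms] 
    by (simp only: append_Nil phi.simps prodh_simps mult.assoc list.size add_0_right add_Suc_right)
  finally show ?case by simp
next
  case (Cons z pre)
  show ?case using Cons.IH[of "Suc c"] by (simp add: mult.assoc)
qed

subsection \<open>Words of adjacent swaps\<close>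

definition swapl :: "nat \<Rightarrow> 'a list \<Rightarrow> 'a list" where
  "swapl i xs = xs[i - 1 := xs ! i, i := xs ! (i - 1)]"

primrec run :: "nat list \<Rightarrow> 'a list \<Rightarrow> 'a list" where
  "run [] xs = xs"
| "run (i # is) xs = run is (swapl i xs)"

primrec wts :: "nat list \<Rightarrow> ('r::comm_ring_1 \<times> 'r) list \<Rightarrow> (nat \<times> 'r) list" where
  "wts [] xs = []"
| "wts (i # is) xs = (i, fst (xs ! (i - 1)) * snd (xs ! i)) # wts is (swapl i xs)"

lemma run_append: "run (is @ js) xs = run js (run is xs)"
  by (induction "is" arbitrary: xs) auto

lemma wts_append: "wts (is @ js) xs = wts is xs @ wts js (run is xs)"
  by (induction "is" arbitrary: xs) auto

lemma map_fst_wts [simp]: "map fst (wts is xs) = is"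
  by (induction "is" arbitrary: xs) auto

lemma letters_wts [simp]: "fst ` set (wts is xs) = set is"
  by (metis map_fst_wts list.set_map)

lemma length_swapl [simp]: "length (swapl i xs) = length xs"
  by (simp add: swapl_def)

lemma length_run [simp]: "length (run is xs) = length xs"
  by (induction "is" arbitrary: xs) auto

lemma swapl_append: "swapl (Suc (length pre)) (pre @ x # y # post) = pre @ y # x # post"
  by (simp add: swapl_def list_update_append nth_append)

lemma swapl_split:
  assumes "1 \<le> i" "i < length xs"
  obtains pre x y post where "xs = pre @ x # y # post" "i = Suc (length pre)"
proof -
  have "xs = take (i - 1) xs @ xs ! (i - 1) # xs ! i # drop (Suc i) xs"
    using assms by (metis Cons_nth_drop_Suc One_nat_def Suc_pred append_take_drop_id less_imp_diff_less not_gr0 not_one_le_zero)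
  moreover have "i = Suc (length (take (i - 1) xs))" using assms by simp
  ultimately show ?thesis using that by blast
qed

lemma set_swapl: "1 \<le> i \<Longrightarrow> i < length xs \<Longrightarrow> set (swapl i xs) = set xs"
  by (erule (1) swapl_split) (auto simp: swapl_append)

lemma set_run: "set is \<subseteq> {1..<length xs} \<Longrightarrow> set (run is xs) = set xs"
  by (induction "is" arbitrary: xs) (auto simp: set_swapl)

lemma phi_run:
  assumes "set is \<subseteq> {1..<length xs}" "\<forall>x\<in>set xs. unit_pair x"
  shows "prodh (phi 0 xs) * prodh (wts is xs) = prodh (phi 0 (run is xs))"
  using assms
proof (induction "is" arbitrary: xs)
  case (Cons i "is")
  hence i: "1 \<le> i" "i < length xs" by auto
  then obtain pre x y post where s: "xs = pre @ x # y # post" "i = Suc (length pre)" by (rule swapl_split)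
  have "prodh (phi 0 xs) * hh i (fst (xs ! (i - 1)) * snd (xs ! i)) = prodh (phi 0 (swapl i xs))"
    using phi_exchange[of x y 0 pre post] Cons.prems(2) by (simp add: s swapl_append nth_append)
  thus ?case using Cons i by (simp add: mult.assoc[symmetric] set_swapl)
qed simp

lemma prodh_wts:
  assumes "set is \<subseteq> {1..<length xs}" "\<forall>x\<in>set xs. unit_pair x"
  shows "prodh (phi_inv 0 xs) * prodh (phi 0 (run is xs)) = prodh (wts is xs)"
  unfolding phi_run[OF assms, symmetric] by (simp add: mult.assoc[symmetric] phi_inv_phi(1)[OF assms(2)])

lemma rev_swapl:
  assumes "1 \<le> i" "i < length xs"
  shows "swapl (length xs - i) (rev (swapl i xs)) = rev xs"
proof -
  obtain pre x y post where s: "xs = pre @ x # y # post" "i = Suc (length pre)" using assms by (rule swapl_split)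
  have "length xs - i = Suc (length (rev post))" by (simp add: s)
  moreover have "rev (swapl i xs) = rev post @ x # y # rev pre" by (simp add: s swapl_append)
  ultimately show ?thesis by (simp only: swapl_append) (simp add: s)
qed

text \<open>Undoing a swap and reversing the list each exchange the two neighbours, so the same
  ratio occurs at the mirrored place, with the swaps in opposite order.\<close>

lemma run_wts_rev:
  assumes "set is \<subseteq> {1..<length xs}"
  shows "run (rev (map (\<lambda>i. length xs - i) is)) (rev (run is xs)) = rev xs \<and>
    wts (rev (map (\<lambda>i. length xs - i) is)) (rev (run is xs)) = star_word (length xs) (wts is xs)"
  using assms
proof (induction "is" arbitrary: xs)
  case (Cons i "is")
  hence i: "1 \<le> i" "i < length xs" by auto
  let ?N = "length xs" and ?ys = "swapl i xs"
  have *: "run (rev (map (\<lambda>i. ?N - i) is)) (rev (run is ?ys)) = rev ?ys"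
    "wts (rev (map (\<lambda>i. ?N - i) is)) (rev (run is ?ys)) = star_word ?N (wts is ?ys)"
    using Cons.IH[of ?ys] Cons.prems by auto
  have "rev ?ys ! (?N - i - 1) = xs ! (i - 1)" "rev ?ys ! (?N - i) = xs ! i"
    using i by (auto simp: rev_nth swapl_def nth_list_update)
  thus ?case using i * by (simp add: run_append wts_append star_word_simps rev_swapl)
qed (simp add: star_word_simps)

lemma lookup_wts_star:
  assumes "set is \<subseteq> {1..<length xs}" "\<forall>x\<in>set xs. unit_pair x" "app w permutes {1..<Suc (length xs)}"
  shows "lookup (prodh (wts is xs)) w =
    lookup (prodh (phi_inv 0 (rev (run is xs))) * prodh (phi 0 (rev xs))) (star (length xs) w)"
proof -
  let ?N = "length xs" and ?js = "rev (map (\<lambda>i. length xs - i) is)" and ?zs = "rev (run is xs)"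
  have "prodh (phi_inv 0 ?zs) * prodh (phi 0 (run ?js ?zs)) = prodh (wts ?js ?zs)"
    using assms by (intro prodh_wts) (fastforce simp: set_run)+
  hence "prodh (phi_inv 0 ?zs) * prodh (phi 0 (rev xs)) = prodh (star_word ?N (wts is xs))"
    using run_wts_rev[OF assms(1)] by simp
  thus ?thesis using lookup_star_word[of "wts is xs" ?N w] assms by simp
qed


subsection \<open>The staircase factorization and the top coefficient\<close>

primrec rcol :: "nat \<Rightarrow> ('r::comm_ring_1 \<times> 'r) list \<Rightarrow> 'r \<times> 'r \<Rightarrow> (nat \<times> 'r) list" where
  "rcol c [] x = []"
| "rcol c (y # ys) x = rcol (Suc c) ys x @ [(Suc c, fst y * snd x)]"

primrec stair :: "nat \<Rightarrow> ('r::comm_ring_1 \<times> 'r) list \<Rightarrow> ('r \<times> 'r) list \<Rightarrow> (nat \<times> 'r) list" where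
  "stair c [] ys = []"
| "stair c (x # xs) ys = rcol c (butlast ys) x @ stair (Suc c) xs (butlast ys)"

lemma phi_rcol:
  assumes "unit_pair x" "\<forall>y\<in>set ys. unit_pair y"
  shows "prodh (phi c (ys @ x # zs)) * prodh (rcol c ys x) = prodh (phi c (x # ys @ zs))"
  using assms(2)
proof (induction ys arbitrary: c)
  case (Cons y ys)
  have "prodh (phi c ((y # ys) @ x # zs)) * prodh (rcol c (y # ys) x) =
    prodh (acol c (length (ys @ x # zs)) (snd y)) *
      (prodh (phi (Suc c) (ys @ x # zs)) * prodh (rcol (Suc c) ys x)) * hh (Suc c) (fst y * snd x)"
    by (simp only: append_Cons phi.simps rcol.simps prodh_simps mult_1_right mult.assoc)
  also have "\<dots> = prodh (phi c (y # x # ys @ zs)) * hh (Suc c) (fst y * snd x)"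
    using Cons by (simp add: mult.assoc)
  also have "\<dots> = prodh (phi c (x # (y # ys) @ zs))"
    using phi_exchange[of y x c "[]" "ys @ zs"] assms(1) Cons.prems by simp
  finally show ?case .
qed simp

lemma phi_snoc_cong: "phi c (ys @ [y]) = phi c (ys @ [x])"
  by (induction ys arbitrary: c) auto

text \<open>The first entry \<open>x\<close> of the target is brought in at the end of
  \<open>ys\<close>, where by \<open>phi_snoc_cong\<close> it replaces the last entry at no cost,
  and is then swapped to the front. Repeating this behind it with the shortened list yields one
  factor for each cell of a staircase.\<close>

lemma phi_stair:
  assumes "length xs = length ys" "\<forall>x\<in>set xs. unit_pair x" "\<forall>y\<in>set ys. unit_pair y"
  shows "prodh (phi c xs) = prodh (phi c ys) * prodh (stair c xs ys)"
  using assms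
proof (induction xs arbitrary: ys c)
  case (Cons x xs)
  define us where "us = butlast ys"
  have ys: "ys = us @ [last ys]" using Cons.prems(1) by (cases ys rule: rev_cases) (auto simp: us_def)
  have len: "length xs = length us" using Cons.prems(1) by (simp add: us_def)
  have unit: "\<forall>y\<in>set us. unit_pair y" using Cons.prems(3) by (auto simp: us_def dest: in_set_butlastD)
  have "prodh (phi c ys) * prodh (rcol c us x) = prodh (phi c (us @ [x])) * prodh (rcol c us x)"
    by (subst ys, subst phi_snoc_cong[of c us "last ys" x]) simp
  also have "\<dots> = prodh (phi c (x # us))"
    using phi_rcol[of x us c "[]"] Cons.prems(2) unit by simp
  finally have "prodh (phi c ys) * prodh (stair c (x # xs) ys)
    = prodh (acol c (length xs) (snd x)) * (prodh (phi (Suc c) us) * prodh (stair (Suc c) xs us))"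
    by (simp add: us_def[symmetric] len mult.assoc[symmetric])
  also have "\<dots> = prodh (phi c (x # xs))"
    using Cons.IH[OF len _ unit, of "Suc c"] Cons.prems(2) by simp
  finally show ?case by simp
qed simp

lemma subwords_act_word:
  "y \<in> subwords_act u 0 \<Longrightarrow> \<exists>v. length v \<le> length u \<and> app y = word_perm v"
proof (induction u arbitrary: y)
  case (Cons i u)
  from Cons.prems obtain y' where y': "y' \<in> subwords_act u 0" "y = y' \<or> y = lmul i y'" by auto
  then obtain v where v: "length v \<le> length u" "app y' = word_perm v" using Cons.IH by blast
  have "y = y' \<or> y = lsw i y'" using y' by (auto simp: lmul_eq split: if_splits)
  thus ?case
  proof
    assume "y = y'" thus ?thesis using v by (intro exI[of _ v]) auto
  next
    assume "y = lsw i y'" thus ?thesis using v by (intro exI[of _ "i # v"]) (auto simp: app_lsw)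
  qed
qed (auto simp: zero_fperm.rep_eq)

lemma lookup_prodh_long:
  assumes "length ws < perm_length (app w)"
  shows "lookup (prodh ws) w = 0"
proof (rule ccontr)
  assume "lookup (prodh ws) w \<noteq> 0"
  hence "w \<in> subwords_act (map fst ws) 0"
    using keys_supp[OF supp_prodh, of ws] by (auto simp: in_keys_iff)
  from subwords_act_word[OF this] obtain v where "length v \<le> length ws" "app w = word_perm v" by auto
  thus False using perm_length_word_le[of v] assms by simp
qed

text \<open>Omitting a letter of a reduced word leaves too few letters to reach its permutation, so
  every factor must contribute its generator.\<close>

lemma lookup_prodh_reduced:
  assumes "length ws = perm_length (word_perm (map fst ws))" "app w = word_perm (map fst ws)"
  shows "lookup (prodh ws) w = prod_list (map (\<lambda>(i, t). t - 1) ws)"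
  using assms
proof (induction ws arbitrary: w rule: rev_induct)
  case Nil
  hence "w = 0" unfolding app_inject[symmetric] zero_fperm.rep_eq by (simp only: list.map word_perm_Nil)
  thus ?case by simp
next
  case (snoc p ws)
  obtain i t where p: "p = (i, t)" by fastforce
  have eq: "map fst (ws @ [p]) = map fst ws @ [i]" by (simp add: p)
  have red0: "length (map fst ws @ [i]) = perm_length (word_perm (map fst ws @ [i]))"
    using snoc.prems(1) by (simp only: eq length_append length_map list.size)
  have red: "length (map fst ws) = perm_length (word_perm (map fst ws))"
    "word_perm (map fst ws) i < word_perm (map fst ws) (Suc i)"
    using dright_word_perm[OF red0] by simp_all
  have rs: "app (rsw i w) = word_perm (map fst ws)"
    using snoc.prems(2) by (auto simp: app_rsw p fun_eq_iff)
  have "rdesc i w" using red(2) rs rdesc_rsw[of i w] by (auto simp: rdesc_def)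
  moreover have "lookup (prodh ws) w = 0"
    using snoc.prems by (intro lookup_prodh_long) simp
  moreover have "lookup (prodh ws) (rsw i w) = prod_list (map (\<lambda>(i, t). t - 1) ws)"
    using snoc.IH red(1) rs by simp
  ultimately show ?case by (simp add: p lookup_hh_right mult.commute)
qed

lemma map_fst_rcol: "map fst (rcol c ys x) = rev [Suc c..<Suc (c + length ys)]"
proof (induction ys arbitrary: c)
  case (Cons y ys)
  have "[Suc c..<Suc (c + length (y # ys))] = Suc c # [Suc (Suc c)..<Suc (Suc c + length ys)]"
    by (simp add: upt_conv_Cons del: upt_Suc)
  thus ?case by (simp only: rcol.simps map_append Cons.IH rev.simps list.map fst_conv)
qed simp

lemma word_perm_descending:
  "word_perm (rev [Suc c..<Suc (c + k)]) p =
    (if p = Suc c then Suc (c + k) else if Suc c < p \<and> p \<le> Suc (c + k) then p - 1 else p)"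
proof (induction k arbitrary: p)
  case (Suc k)
  have "word_perm (rev [Suc c..<Suc (c + Suc k)]) p = adj (Suc (c + k)) (word_perm (rev [Suc c..<Suc (c + k)]) p)"
    by simp
  thus ?case unfolding Suc.IH by (auto simp: adj_apply)
qed auto

lemma word_perm_stair:
  "length xs = length ys \<Longrightarrow> word_perm (map fst (stair c xs ys)) p =
    (if c < p \<and> p \<le> c + length xs then Suc (2 * c + length xs) - p else p)"
proof (induction xs arbitrary: ys c p)
  case (Cons x xs)
  have len: "length (butlast ys) = length xs" using Cons.prems by simp
  have "word_perm (map fst (stair c (x # xs) ys)) p =
    word_perm (rev [Suc c..<Suc (c + length xs)]) (word_perm (map fst (stair (Suc c) xs (butlast ys))) p)"
    by (simp only: stair.simps map_append word_perm_append comp_apply map_fst_rcol len)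
  also have "\<dots> = (if c < p \<and> p \<le> c + length (x # xs) then Suc (2 * c + length (x # xs)) - p else p)"
    unfolding Cons.IH[OF len[symmetric]] word_perm_descending by auto
  finally show ?case .
qed auto

lemma length_rcol [simp]: "length (rcol c ys x) = length ys"
  by (induction ys arbitrary: c) auto

lemma length_stair: "length xs = length ys \<Longrightarrow> length (stair c xs ys) = (\<Sum>k<length xs. k)"
proof (induction xs arbitrary: ys c)
  case (Cons x xs)
  have len: "length (butlast ys) = length xs" using Cons.prems by simp
  show ?case using Cons.IH[OF len[symmetric]] by (simp only: stair.simps length_append length_rcol len) simp
qed simp

lemma inversions_longest: "inversions (longest M) = {(p, q). 1 \<le> p \<and> p < q \<and> q \<le> M}"
  by (auto simp: inversions_def longest_def split: if_splits)

lemma perm_length_longest: "perm_length (longest M) = (\<Sum>k<M. k)"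
proof (induction M)
  case 0
  have "longest 0 = id" by (auto simp: longest_def)
  thus ?case by (simp only: perm_length_id) simp
next
  case (Suc M)
  have eq: "{(p, q). 1 \<le> p \<and> p < q \<and> q \<le> Suc M} = {(p, q). 1 \<le> p \<and> p < q \<and> q \<le> M} \<union> (\<lambda>p. (p, Suc M)) ` {1..M}"
    by (auto simp: le_Suc_eq)
  have fin: "finite {(p, q). 1 \<le> p \<and> p < q \<and> q \<le> M}"
    by (rule finite_subset[of _ "{1..M} \<times> {1..M}"]) auto
  have "card ((\<lambda>p. (p, Suc M)) ` {1..M}) = M" by (subst card_image) (auto simp: inj_on_def)
  thus ?case using Suc.IH unfolding perm_length_eq inversions_longest eq
    by (subst card_Un_disjoint) (auto simp: fin[unfolded One_nat_def])
qed

lemma prod_list_rcol: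
  "prod_list (map (\<lambda>(i, t). g t) (rcol c ys x)) = (\<Prod>p<length ys. g (fst (ys ! p) * snd x))"
  for g :: "'r::comm_ring_1 \<Rightarrow> 'r"
  by (induction ys arbitrary: c) (auto simp: prod.lessThan_Suc_shift mult.commute simp del: prod.lessThan_Suc)

lemma prod_list_stair:
  fixes g :: "'r::comm_ring_1 \<Rightarrow> 'r"
  shows "length xs = length ys \<Longrightarrow> prod_list (map (\<lambda>(i, t). g t) (stair c xs ys)) =
    (\<Prod>q<length xs. \<Prod>p<length xs - 1 - q. g (fst (ys ! p) * snd (xs ! q)))"
proof (induction xs arbitrary: ys c)
  case (Cons x xs)
  have len: "length (butlast ys) = length xs" using Cons.prems by simp
  have nth: "butlast ys ! p = ys ! p" if "p < length xs" for p
    using that Cons.prems by (simp add: nth_butlast)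
  have "(\<Prod>q<length xs. \<Prod>p<length xs - 1 - q. g (fst (butlast ys ! p) * snd (xs ! q))) =
    (\<Prod>q<length xs. \<Prod>p<length xs - Suc q. g (fst (ys ! p) * snd (xs ! q)))"
    by (intro prod.cong) (auto simp: nth)
  moreover have "(\<Prod>p<length xs. g (fst (butlast ys ! p) * snd x)) = (\<Prod>p<length xs. g (fst (ys ! p) * snd x))"
    by (intro prod.cong) (auto simp: nth)
  ultimately show ?case
    using Cons.IH[OF len[symmetric], of "Suc c"]
    by (simp add: prod_list_rcol len prod.lessThan_Suc_shift del: prod.lessThan_Suc length_butlast)
qed simp

text \<open>The sign accounts for the passage from generators with square \<open>- s_i\<close> to
  idempotent ones.\<close>

definition gcoeff :: "('r::comm_ring_1 \<times> 'r) list \<Rightarrow> ('r \<times> 'r) list \<Rightarrow> (nat \<Rightarrow> nat) \<Rightarrow> 'r" where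
  "gcoeff xs ys w = (-1) ^ perm_length w * lookup (prodh (phi_inv 0 ys) * prodh (phi 0 xs)) (Abs_fperm w)"

lemma gcoeff_longest:
  assumes "length xs = M" "length ys = M" "\<forall>x\<in>set xs. unit_pair x" "\<forall>y\<in>set ys. unit_pair y"
  shows "gcoeff xs ys (longest M) = (\<Prod>q<M. \<Prod>p<M - 1 - q. 1 - fst (ys ! p) * snd (xs ! q))"
proof -
  have 1: "prodh (phi_inv 0 ys) * prodh (phi 0 xs) = prodh (stair 0 xs ys)"
    using phi_stair[of xs ys 0] assms by (simp add: mult.assoc[symmetric] phi_inv_phi(1))
  have w: "word_perm (map fst (stair 0 xs ys)) = longest M"
    using word_perm_stair[of xs ys 0] assms by (auto simp: longest_def fun_eq_iff)
  have len: "length (stair 0 xs ys) = perm_length (longest M)"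
    using assms by (simp add: length_stair perm_length_longest)
  have "lookup (prodh (stair 0 xs ys)) (Abs_fperm (longest M)) = prod_list (map (\<lambda>(i, t). t - 1) (stair 0 xs ys))"
    by (rule lookup_prodh_reduced) (simp_all add: w len app_Abs[OF longest_permutes])
  moreover have "(-1) ^ length ws * prod_list (map (\<lambda>(i, t). t - 1) ws) = prod_list (map (\<lambda>(i, t). 1 - t) ws)"
    for ws :: "(nat \<times> 'a) list"
    by (induction ws) (auto simp: algebra_simps)
  ultimately have "gcoeff xs ys (longest M) = prod_list (map (\<lambda>(i, t). 1 - t) (stair 0 xs ys))"
    unfolding gcoeff_def 1 using len by metis
  thus ?thesis using prod_list_stair[of xs ys "\<lambda>t. 1 - t" 0] assms by simp
qed

text \<open>Exchanging the two variables multiplies by a single \<open>hh i\<close> on the right. At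
  \<open>w \<circ> adj i\<close>, which has a descent at \<open>i\<close>, this mixes just the
  coefficients at \<open>w \<circ> adj i\<close> and \<open>w\<close>; clearing the denominator
  gives the defining recursion.\<close>

lemma gcoeff_recursion:
  assumes "w permutes {1..<Suc M}" "1 \<le> i" "i < M" "w i < w (Suc i)"
    and "length xs = M" "\<forall>x\<in>set xs. unit_pair x"
  shows "(fst (xs ! (i - 1)) - fst (xs ! i)) * gcoeff xs ys w =
    fst (xs ! (i - 1)) * gcoeff xs ys (w \<circ> adj i) - fst (xs ! i) * gcoeff (swapl i xs) ys (w \<circ> adj i)"
proof -
  let ?a = "fst (xs ! (i - 1))" and ?b = "fst (xs ! i)" and ?b' = "snd (xs ! i)"
  let ?F = "prodh (phi_inv 0 ys) * prodh (phi 0 xs)" and ?v = "Abs_fperm (w \<circ> adj i)" and ?w = "Abs_fperm w"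
  have unit: "?b * ?b' = 1" using assms by (auto simp: unit_pair_def)
  have vp: "w \<circ> adj i permutes {1..<Suc M}" using assms by (intro permutes_comp_adj) auto
  have v: "app ?v = w \<circ> adj i" and w: "app ?w = w" using app_Abs[OF vp] app_Abs[OF assms(1)] .
  have rv: "rsw i ?v = ?w" by (simp add: app_inject[symmetric] app_rsw v w)
  have "rdesc i ?v" using assms(4) by (simp add: rdesc_def v adj_apply)
  moreover have "prodh (phi_inv 0 ys) * prodh (phi 0 (swapl i xs)) = ?F * hh i (?a * ?b')"
    using phi_run[of "[i]" xs] assms by (simp add: mult.assoc)
  ultimately have F': "lookup (prodh (phi_inv 0 ys) * prodh (phi 0 (swapl i xs))) ?v =
      lookup ?F ?v + (?a * ?b' - 1) * (lookup ?F ?v + lookup ?F ?w)"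
    by (simp add: lookup_hh_right rv)
  have "?b * (?a * ?b') = ?a" using unit by (simp add: mult.left_commute[of ?b])
  hence "?b * (lookup ?F ?v + (?a * ?b' - 1) * (lookup ?F ?v + lookup ?F ?w)) =
    ?a * lookup ?F ?v + (?a - ?b) * lookup ?F ?w"
    by (simp add: ring_distribs mult.assoc[symmetric])
  moreover have "perm_length (w \<circ> adj i) = Suc (perm_length w)"
    using perm_length_comp_adj assms by blast
  moreover have "(a - b) * (s * W) = a * (- 1 * s * V) - b * (- 1 * s * F)"
    if "b * F = a * V + (a - b) * W" for a b s V W F :: 'a
  proof -
    have "b * (- 1 * s * F) = - s * (b * F)" by simp
    thus ?thesis unfolding that by (simp add: algebra_simps)
  qed
  ultimately show ?thesis unfolding gcoeff_def F' by (simp only: power_Suc)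
qed


subsection \<open>Laurent polynomials\<close>

text \<open>An order on the variables makes the Laurent polynomials an integral domain, so that
  \<open>grothendieck_family_unique\<close> can cancel
  \<open>lvar (A i) - lvar (A (i + 1))\<close>.\<close>

instantiation gvar :: linorder
begin

primrec gvar_code :: "gvar \<Rightarrow> nat" where
  "gvar_code (A q) = 2 * q"
| "gvar_code (B p) = Suc (2 * p)"

definition less_eq_gvar :: "gvar \<Rightarrow> gvar \<Rightarrow> bool" where
  "less_eq_gvar x y \<longleftrightarrow> gvar_code x \<le> gvar_code y"

definition less_gvar :: "gvar \<Rightarrow> gvar \<Rightarrow> bool" where
  "less_gvar x y \<longleftrightarrow> gvar_code x < gvar_code y"

instance
proof
  fix x y :: gvar
  assume "x \<le> y" "y \<le> x"
  hence "gvar_code x = gvar_code y" by (simp add: less_eq_gvar_def)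
  thus "x = y" by (cases x; cases y) (auto, presburger+)
qed (auto simp: less_eq_gvar_def less_gvar_def)

end

lemma lvar_pow_mult: "lvar_pow x k * lvar_pow x l = lvar_pow x (k + l)"
  by (simp add: lvar_pow_def mult_single single_add)

lemma lvar_pow_0: "lvar_pow x 0 = 1"
  by (simp add: lvar_pow_def)

lemma lvar_diff_nonzero:
  assumes "x \<noteq> y"
  shows "lvar x - lvar y \<noteq> 0"
proof
  assume "lvar x - lvar y = 0"
  hence "keys (lvar x) = keys (lvar y)" by simp
  hence "single x (1::int) = single y 1" by (simp add: lvar_pow_def)
  hence "keys (single x (1::int)) = keys (single y (1::int))" by simp
  thus False using assms by simp
qed

lemma inj_map_key_transpose: "inj (Poly_Mapping.map_key (transpose (x :: 'a) y) :: ('a \<Rightarrow>\<^sub>0 'b::zero) \<Rightarrow> _)"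
proof (rule injI)
  fix f g :: "'a \<Rightarrow>\<^sub>0 'b"
  assume *: "Poly_Mapping.map_key (transpose x y) f = Poly_Mapping.map_key (transpose x y) g"
  have i: "inj (transpose x y)" by (rule bij_is_inj) simp
  have "lookup f (transpose x y k) = lookup g (transpose x y k)" for k
    using arg_cong[OF *, of "\<lambda>h. lookup h k"] by (simp add: Poly_Mapping.map_key.rep_eq[OF i])
  hence "lookup f k = lookup g k" for k by (metis transpose_involutory)
  thus "f = g" by (rule poly_mapping_eqI)
qed

lemma map_key_transpose_involutory:
  "Poly_Mapping.map_key (transpose x y) (Poly_Mapping.map_key (transpose x y) m) = m"
proof -
  have i: "inj (transpose x y)" by (rule bij_is_inj) simp
  show ?thesis by (rule poly_mapping_eqI) (simp add: Poly_Mapping.map_key.rep_eq[OF i])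
qed

lemma swap_a_single:
  "swap_a i (single m c) = single (Poly_Mapping.map_key (transpose (A i) (A (Suc i))) m) c"
  unfolding swap_a_def Suc_eq_plus1[symmetric]
  by (subst map_key_transpose_involutory[of "A i" "A (Suc i)" m, symmetric])
    (rule map_key_single[OF inj_map_key_transpose])

lemma swap_a_add: "swap_a i (f + g) = swap_a i f + swap_a i g"
  unfolding swap_a_def by (rule map_key_plus[OF inj_map_key_transpose])

lemma swap_a_0: "swap_a i 0 = 0"
  using swap_a_add[of i 0 0] by simp

lemma swap_a_mult: "swap_a i (f * g) = swap_a i f * swap_a i g"
proof (induction f rule: poly_mapping_single_induct)
  case (2 m c)
  have inj: "inj (transpose (A i) (A (Suc i)))" by (rule bij_is_inj) simp
  show ?case
    by (induction g rule: poly_mapping_single_induct)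
      (auto simp: swap_a_0 swap_a_add distrib_left mult_single swap_a_single map_key_plus[OF inj])
qed (auto simp: swap_a_0 swap_a_add distrib_right)

lemma swap_a_1: "swap_a i 1 = 1"
proof -
  have "inj (transpose (A i) (A (Suc i)))" by (rule bij_is_inj) simp
  thus ?thesis using swap_a_single[of i 0 1] by (simp add: map_key_zero)
qed

lemma swap_a_lvar_pow: "swap_a i (lvar_pow x k) = lvar_pow (transpose (A i) (A (Suc i)) x) k"
proof -
  have inj: "inj (transpose (A i) (A (Suc i)))" by (rule bij_is_inj) simp
  have "Poly_Mapping.map_key (transpose (A i) (A (Suc i))) (single x k) = single (transpose (A i) (A (Suc i)) x) k"
    using map_key_single[OF inj, of "transpose (A i) (A (Suc i)) x" k] by simp
  thus ?thesis by (simp add: lvar_pow_def swap_a_single)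
qed

definition mono_eval :: "(gvar \<Rightarrow> 'a::field) \<Rightarrow> (gvar \<Rightarrow>\<^sub>0 int) \<Rightarrow> 'a" where
  "mono_eval v m = (\<Prod>x \<in> keys m. v x powi lookup m x)"

lemma laurent_eval_eq: "laurent_eval v f = (\<Sum>m \<in> keys f. of_int (lookup f m) * mono_eval v m)"
  by (simp add: laurent_eval_def mono_eval_def)

lemma mono_eval_superset:
  assumes "finite S" "keys m \<subseteq> S"
  shows "mono_eval v m = (\<Prod>x \<in> S. v x powi lookup m x)"
  unfolding mono_eval_def by (rule prod.mono_neutral_left) (use assms in \<open>auto simp: in_keys_iff\<close>)

lemma laurent_eval_superset:
  assumes "finite S" "keys f \<subseteq> S"
  shows "laurent_eval v f = (\<Sum>m \<in> S. of_int (lookup f m) * mono_eval v m)"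
  unfolding laurent_eval_eq by (rule sum.mono_neutral_left) (use assms in \<open>auto simp: in_keys_iff\<close>)

lemma laurent_eval_add: "laurent_eval v (f + g) = laurent_eval v f + laurent_eval v g"
proof -
  let ?S = "keys f \<union> keys g"
  have "keys (f + g) \<subseteq> ?S" by (rule Poly_Mapping.keys_add)
  thus ?thesis
    by (simp add: laurent_eval_superset[of ?S f] laurent_eval_superset[of ?S g] laurent_eval_superset[of ?S "f + g"]
        lookup_add sum.distrib distrib_right)
qed

lemma laurent_eval_single: "laurent_eval v (single m c) = of_int c * mono_eval v m"
  by (simp add: laurent_eval_eq)

lemma laurent_eval_lvar_pow: "laurent_eval v (lvar_pow x k) = v x powi k"
  by (simp add: lvar_pow_def laurent_eval_single mono_eval_def)

lemma mono_eval_add: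
  assumes "\<And>x. v x \<noteq> 0"
  shows "mono_eval v (m + m') = mono_eval v m * mono_eval v m'"
proof -
  let ?S = "keys m \<union> keys m'"
  have "keys (m + m') \<subseteq> ?S" by (rule Poly_Mapping.keys_add)
  thus ?thesis
    by (simp add: mono_eval_superset[of ?S m] mono_eval_superset[of ?S m'] mono_eval_superset[of ?S "m + m'"]
        lookup_add prod.distrib[symmetric] power_int_add assms)
qed

lemma laurent_eval_1: "laurent_eval v 1 = 1"
  using laurent_eval_single[of v 0 1] by (simp add: mono_eval_def)

lemma laurent_eval_mult:
  assumes "\<And>x. v x \<noteq> 0"
  shows "laurent_eval v (f * g) = laurent_eval v f * laurent_eval v g"
proof (induction f rule: poly_mapping_single_induct)
  case 1 show ?case by (simp add: laurent_eval_eq)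
next
  case (2 m c)
  show ?case
  proof (induction g rule: poly_mapping_single_induct)
    case 1 show ?case by (simp add: laurent_eval_eq)
  qed (auto simp: laurent_eval_add distrib_left mult_single laurent_eval_single mono_eval_add assms)
qed (auto simp: laurent_eval_add distrib_right)

text \<open>Keeps track of the variables that occur: \<open>laurent_eval_mult\<close> asks for a
  valuation without zeros, while a valuation read from lists is controlled only within their
  range.\<close>

definition lvars_in :: "gvar set \<Rightarrow> laurent set" where
  "lvars_in S = {f. \<forall>m \<in> keys f. keys m \<subseteq> S}"

lemma lvars_in_add: "f \<in> lvars_in S \<Longrightarrow> g \<in> lvars_in S \<Longrightarrow> f + g \<in> lvars_in S"
  using Poly_Mapping.keys_add[of f g] by (auto simp: lvars_in_def)

lemma lvars_in_uminus: "f \<in> lvars_in S \<Longrightarrow> - f \<in> lvars_in S"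
  by (auto simp: lvars_in_def)

lemma lvars_in_mult: "f \<in> lvars_in S \<Longrightarrow> g \<in> lvars_in S \<Longrightarrow> f * g \<in> lvars_in S"
  unfolding lvars_in_def
proof (intro CollectI ballI subsetI)
  fix m x assume fg: "f \<in> {f. \<forall>m \<in> keys f. keys m \<subseteq> S}" "g \<in> {f. \<forall>m \<in> keys f. keys m \<subseteq> S}"
    and m: "m \<in> keys (f * g)" and x: "x \<in> keys m"
  obtain a b where "m = a + b" "a \<in> keys f" "b \<in> keys g" using m Poly_Mapping.keys_mult[of f g] by auto
  thus "x \<in> S" using fg x Poly_Mapping.keys_add[of a b] by blast
qed

lemma lvars_in_0: "0 \<in> lvars_in S"
  by (simp add: lvars_in_def)

lemma lvars_in_1: "1 \<in> lvars_in S"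
  by (simp add: lvars_in_def)

lemma lvars_in_lvar_pow: "x \<in> S \<Longrightarrow> lvar_pow x k \<in> lvars_in S"
  by (simp add: lvars_in_def lvar_pow_def)

lemma laurent_eval_cong:
  assumes "f \<in> lvars_in S" "\<And>x. x \<in> S \<Longrightarrow> v x = v' x"
  shows "laurent_eval v f = laurent_eval v' f"
proof -
  have "mono_eval v m = mono_eval v' m" if "m \<in> keys f" for m
  proof -
    have "keys m \<subseteq> S" using that assms(1) by (simp add: lvars_in_def)
    thus ?thesis unfolding mono_eval_def by (intro prod.cong refl) (simp add: assms(2) subsetD)
  qed
  thus ?thesis unfolding laurent_eval_eq by (intro sum.cong) auto
qed

lemma lookup_prodh_lvars_in:
  assumes "\<forall>(i, t) \<in> set ws. t \<in> lvars_in S"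
  shows "lookup (prodh ws) w \<in> lvars_in S"
  using assms
proof (induction ws arbitrary: w)
  case Nil
  show ?case by (auto simp: lookup_one when_def lvars_in_0 lvars_in_1)
next
  case (Cons p ws)
  obtain i t where p: "p = (i, t)" by fastforce
  have t: "t - 1 \<in> lvars_in S" using Cons.prems lvars_in_add[OF _ lvars_in_uminus[OF lvars_in_1], of t]
    by (simp add: p)
  have IH: "lookup (prodh ws) w \<in> lvars_in S" for w using Cons by (auto simp: p)
  show ?case by (simp add: p lookup_hh_left IH lvars_in_add lvars_in_mult t)
qed

lemma snd_phi: "(i, t) \<in> set (phi c xs) \<Longrightarrow> t \<in> snd ` set xs"
proof (induction xs arbitrary: c)
  case (Cons x xs)
  have "(i, t) \<in> set (acol c k s) \<Longrightarrow> t = s" for c k s by (induction k arbitrary: c) auto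
  thus ?case using Cons by auto
qed simp

lemma snd_phi_inv: "(i, t) \<in> set (phi_inv c xs) \<Longrightarrow> t \<in> fst ` set xs"
  unfolding phi_inv_def using snd_phi[of i t c "map prod.swap xs"] by (auto simp: image_iff)

lemma map_phi: "map (\<lambda>(i, t). (i, h t)) (phi c xs) = phi c (map (map_prod h h) xs)"
proof (induction xs arbitrary: c)
  case (Cons x xs)
  have "map (\<lambda>(i, t). (i, h t)) (acol c k s) = acol c k (h s)" for c k s
    by (induction k arbitrary: c) auto
  thus ?case using Cons by simp
qed simp

lemma map_phi_inv: "map (\<lambda>(i, t). (i, h t)) (phi_inv c xs) = phi_inv c (map (map_prod h h) xs)"
proof -
  have "map prod.swap (map (map_prod h h) xs) = map (map_prod h h) (map prod.swap xs)" by auto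
  thus ?thesis by (simp only: phi_inv_def rev_map[symmetric] map_phi)
qed

text \<open>Naturality serves twice: for \<open>swap_a\<close> within the Laurent ring, and for
  evaluation in a field.\<close>

lemma gcoeff_hom:
  fixes h :: "'r::comm_ring_1 \<Rightarrow> 's::comm_ring_1"
  assumes "h 1 = 1" "\<And>x y. h (x + y) = h x + h y" "\<And>x y. h (x * y) = h x * h y"
  shows "h (gcoeff xs ys w) = gcoeff (map (map_prod h h) xs) (map (map_prod h h) ys) w"
proof -
  have "h 0 = 0" using assms(2)[of 0 0] by simp
  hence neg: "h (- 1) = - 1" using assms(2)[of "-1" 1] assms(1) by (simp add: eq_neg_iff_add_eq_0)
  have pow: "h ((- 1) ^ k) = (- 1) ^ k" for k by (induction k) (auto simp only: assms power_0 power_Suc neg)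
  show ?thesis
    unfolding gcoeff_def assms(3) pow prodh_simps(3)[symmetric] lookup_prodh_hom[of h, OF assms]
    by (simp add: map_phi map_phi_inv)
qed

definition lvars :: "(nat \<Rightarrow> gvar) \<Rightarrow> nat \<Rightarrow> (laurent \<times> laurent) list" where
  "lvars V M = map (\<lambda>q. (lvar (V q), lvar_pow (V q) (-1))) [1..<Suc M]"

lemma length_lvars [simp]: "length (lvars V M) = M"
  by (simp add: lvars_def)

lemma nth_lvars: "q < M \<Longrightarrow> lvars V M ! q = (lvar (V (Suc q)), lvar_pow (V (Suc q)) (-1))"
  by (simp add: lvars_def nth_append del: upt_Suc)

lemma unit_lvars: "\<forall>x\<in>set (lvars V M). unit_pair x"
  by (auto simp: lvars_def unit_pair_def lvar_pow_mult lvar_pow_0 simp del: upt_Suc)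

lemma swap_a_lvars:
  assumes "1 \<le> i" "i < M"
  shows "map (map_prod (swap_a i) (swap_a i)) (lvars A M) = swapl i (lvars A M)"
  by (rule nth_equalityI)
    (use assms in \<open>auto simp: nth_lvars swap_a_lvar_pow swapl_def nth_list_update transpose_def\<close>)

lemma swap_a_lvars_B: "map (map_prod (swap_a i) (swap_a i)) (lvars B M) = lvars B M"
  by (rule nth_equalityI) (auto simp: nth_lvars swap_a_lvar_pow transpose_def)

lemma grothendieck_family_gcoeff: "grothendieck_family M (gcoeff (lvars A M) (lvars B M))"
  unfolding grothendieck_family_def
proof (intro conjI allI impI)
  have "gcoeff (lvars A M) (lvars B M) (longest M) =
    (\<Prod>q<M. \<Prod>p<M - 1 - q. 1 - lvar (B (Suc p)) * lvar_pow (A (Suc q)) (-1))"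
    unfolding gcoeff_longest[OF length_lvars length_lvars unit_lvars unit_lvars]
    by (intro prod.cong) (auto simp: nth_lvars)
  also have "\<dots> = (\<Prod>(q, p) \<in> Sigma {..<M} (\<lambda>q. {..<M - 1 - q}). 1 - lvar (B (Suc p)) * lvar_pow (A (Suc q)) (-1))"
    by (rule prod.Sigma) auto
  also have "\<dots> = (\<Prod>(p, q) \<in> {(p, q). 1 \<le> p \<and> 1 \<le> q \<and> p + q \<le> M}. 1 - lvar (B p) * lvar_pow (A q) (-1))"
    by (rule prod.reindex_bij_witness[of _ "\<lambda>(p, q). (q - 1, p - 1)" "\<lambda>(q, p). (Suc p, Suc q)"]) auto
  finally show "gcoeff (lvars A M) (lvars B M) (longest M) =
    (\<Prod>(p, q) \<in> {(p, q). 1 \<le> p \<and> 1 \<le> q \<and> p + q \<le> M}. 1 - lvar (B p) * lvar_pow (A q) (-1))" .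
next
  fix w i assume w: "w permutes {1..M} \<and> 1 \<le> i \<and> i < M \<and> w i < w (i + 1)"
  have sw: "swap_a i (gcoeff (lvars A M) (lvars B M) (w \<circ> adj i)) =
      gcoeff (swapl i (lvars A M)) (lvars B M) (w \<circ> adj i)"
    using w unfolding gcoeff_hom[of "swap_a i", OF swap_a_1 swap_a_add swap_a_mult]
    by (simp add: swap_a_lvars swap_a_lvars_B)
  have "lvars A M ! (i - 1) = (lvar (A i), lvar_pow (A i) (-1))"
    "lvars A M ! i = (lvar (A (i + 1)), lvar_pow (A (i + 1)) (-1))"
    using w by (auto simp: nth_lvars)
  thus "(lvar (A i) - lvar (A (i + 1))) * gcoeff (lvars A M) (lvars B M) w =
      lvar (A i) * gcoeff (lvars A M) (lvars B M) (w \<circ> adj i) -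
      lvar (A (i + 1)) * swap_a i (gcoeff (lvars A M) (lvars B M) (w \<circ> adj i))"
    unfolding sw
    using gcoeff_recursion[of w M i "lvars A M" "lvars B M"] w unit_lvars[of A M]
    by (simp add: atLeastLessThanSuc_atLeastAtMost)
qed

lemma perm_length_le_longest:
  assumes "w permutes {1..<Suc M}"
  shows "perm_length w \<le> perm_length (longest M)"
proof -
  have "inversions w \<subseteq> inversions (longest M)"
  proof (clarsimp simp: inversions_longest, unfold inversions_def, clarsimp)
    fix p q assume pq: "p < q" "w q < w p"
    have out: "w x = x" if "x \<notin> {1..<Suc M}" for x using assms that by (simp add: permutes_def)
    have im: "w x \<in> {1..<Suc M}" if "x \<in> {1..<Suc M}" for x using permutes_in_image[OF assms] that by blast
    show "Suc 0 \<le> p \<and> q \<le> M"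
      using pq out[of p] out[of q] im[of p] im[of q] by (cases "p \<in> {1..<Suc M}"; cases "q \<in> {1..<Suc M}") auto
  qed
  moreover have "finite (inversions (longest M))" by (rule finite_inversions[OF longest_permutes])
  ultimately show ?thesis unfolding perm_length_eq by (simp add: card_mono)
qed

lemma ascent_exists:
  assumes "w permutes {1..<Suc M}" "w \<noteq> longest M"
  obtains i where "1 \<le> i" "i < M" "w i < w (Suc i)"
proof -
  let ?u = "w \<circ> longest M"
  have "?u \<noteq> id"
  proof
    assume "?u = id"
    hence "w x = longest M x" for x by (metis comp_apply id_apply longest_longest)
    thus False using assms(2) by auto
  qed
  moreover have "?u permutes {1..<Suc M}" using assms(1) longest_permutes permutes_compose by blast
  ultimately obtain j where j: "1 \<le> j" "Suc j < Suc M" "?u (Suc j) < ?u j" using descent_exists by blast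
  have "w (M - j) < w (Suc (M - j))"
    using j by (simp add: longest_def Suc_diff_le)
  thus ?thesis using that[of "M - j"] j by auto
qed

text \<open>Descending induction on the length from \<open>longest M\<close>: any other permutation
  has an ascent, where the recursion determines its value from that of a longer permutation.\<close>

lemma grothendieck_family_unique:
  assumes "grothendieck_family M G" "grothendieck_family M H" "w permutes {1..<Suc M}"
  shows "G w = H w"
  using assms(3)
proof (induction "perm_length (longest M) - perm_length w" arbitrary: w rule: less_induct)
  case less
  show ?case
  proof (cases "w = longest M")
    case True
    thus ?thesis using assms(1,2) by (simp add: grothendieck_family_def)
  next
    case False
    obtain i where i: "1 \<le> i" "i < M" "w i < w (Suc i)" using ascent_exists less.prems False by blast
    have p: "w \<circ> adj i permutes {1..<Suc M}" using less.prems i by (intro permutes_comp_adj) auto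
    have "perm_length (w \<circ> adj i) = Suc (perm_length w)" using perm_length_comp_adj less.prems i by blast
    hence IH: "G (w \<circ> adj i) = H (w \<circ> adj i)"
      using less.hyps[of "w \<circ> adj i"] p perm_length_le_longest[OF p] by simp
    have "(lvar (A i) - lvar (A (i + 1))) * G w = (lvar (A i) - lvar (A (i + 1))) * H w"
      using assms(1,2) less.prems i IH
      by (simp add: grothendieck_family_def atLeastLessThanSuc_atLeastAtMost)
    thus ?thesis using lvar_diff_nonzero[of "A i" "A (i + 1)"] by simp
  qed
qed

lemma grothendieck_laurent_eq:
  assumes "w permutes {1..<Suc M}"
  shows "grothendieck_laurent M w = gcoeff (lvars A M) (lvars B M) w"
  unfolding grothendieck_laurent_def
  by (rule the_equality) (use grothendieck_family_gcoeff grothendieck_family_unique[OF _ _ assms] in blast)+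

abbreviation fpair :: "'a::field \<Rightarrow> 'a \<times> 'a" where
  "fpair x \<equiv> (x, inverse x)"

lemma unit_fpair: "x \<noteq> 0 \<Longrightarrow> unit_pair (fpair x)"
  by (simp add: unit_pair_def)

theorem grothendieck_eq_gcoeff:
  fixes as bs :: "'a::field list"
  assumes "length bs = length as" "0 \<notin> set as" "0 \<notin> set bs" "w permutes {1..<Suc (length as)}"
  shows "grothendieck w as bs = gcoeff (map fpair as) (map fpair bs) w"
proof -
  define M where "M = length as"
  define v where "v = (\<lambda>x. case x of A q \<Rightarrow> as ! (q - 1) | B p \<Rightarrow> bs ! (p - 1))"
  \<comment> \<open>List lookups outside the range might be zero. Changing them to 1 makes
    evaluation multiplicative and does not affect polynomials in the variables of
    \<open>S\<close>.\<close>
  define v' where "v' = (\<lambda>x. if v x = 0 then 1 else v x)"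
  define S where "S = A ` {1..M} \<union> B ` {1..M}"
  have v0: "v x \<noteq> 0" if "x \<in> S" for x
  proof (cases x)
    case (A q)
    hence "as ! (q - 1) \<in> set as" using that by (intro nth_mem) (auto simp: S_def M_def)
    thus ?thesis using assms(2) A by (auto simp: v_def)
  next
    case (B p)
    hence "bs ! (p - 1) \<in> set bs" using that assms(1) by (intro nth_mem) (auto simp: S_def M_def)
    thus ?thesis using assms(3) B by (auto simp: v_def)
  qed
  have nz: "as ! q \<noteq> 0" "bs ! q \<noteq> 0" if "q < M" for q
    using that assms(1-3) unfolding M_def by (metis nth_mem)+
  have A: "map (map_prod (laurent_eval v') (laurent_eval v')) (lvars A M) = map fpair as"
    using nz by (intro nth_equalityI)
      (auto simp: M_def nth_lvars laurent_eval_lvar_pow v'_def power_int_minus v_def)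
  have B: "map (map_prod (laurent_eval v') (laurent_eval v')) (lvars B M) = map fpair bs"
    using nz assms(1) by (intro nth_equalityI)
      (auto simp: M_def nth_lvars laurent_eval_lvar_pow v'_def power_int_minus v_def)
  have "lookup (prodh (phi_inv 0 (lvars B M) @ phi 0 (lvars A M))) (Abs_fperm w) \<in> lvars_in S"
    by (rule lookup_prodh_lvars_in)
      (auto dest!: snd_phi snd_phi_inv simp: lvars_def S_def less_Suc_eq_le intro!: lvars_in_lvar_pow simp del: upt_Suc)
  moreover have "(-1) ^ k \<in> lvars_in S" for k
    by (induction k) (auto intro: lvars_in_1 lvars_in_uminus)
  ultimately have in_S: "gcoeff (lvars A M) (lvars B M) w \<in> lvars_in S"
    unfolding gcoeff_def by (simp add: lvars_in_mult)
  have "grothendieck w as bs = laurent_eval v (gcoeff (lvars A M) (lvars B M) w)"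
    unfolding grothendieck_def v_def using grothendieck_laurent_eq[OF assms(4)] by (simp add: M_def)
  also have "\<dots> = laurent_eval v' (gcoeff (lvars A M) (lvars B M) w)"
    by (rule laurent_eval_cong[OF in_S]) (simp add: v'_def v0)
  also have "\<dots> = gcoeff (map fpair as) (map fpair bs) w"
    unfolding A[symmetric] B[symmetric]
    by (rule gcoeff_hom) (auto simp: laurent_eval_1 laurent_eval_add laurent_eval_mult v'_def)
  finally show ?thesis .
qed


section \<open>The absolute Hecke product is the Demazure product\<close>

text \<open>Each letter goes to the negative of an idempotent, whose square is its own negative as
  the relations demand; hence the sign by word length.\<close>

definition hecke_eval :: "(nat list \<Rightarrow>\<^sub>0 int) \<Rightarrow> (fperm \<Rightarrow>\<^sub>0 int)" where
  "hecke_eval = frag_extend (\<lambda>xs. single (act xs 0) ((-1) ^ length xs))"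

lemma hecke_eval_diff: "hecke_eval (f - g) = hecke_eval f - hecke_eval g"
  by (simp add: hecke_eval_def frag_extend_diff)

lemma frag_cmul_single: "frag_cmul c (single x d) = single x (c * d)"
  by (rule poly_mapping_eqI) (simp add: lookup_single when_def)

lemma hecke_eval_single: "hecke_eval (single xs c) = single (act xs 0) (c * (-1) ^ length xs)"
proof -
  have "hecke_eval (frag_cmul c (single xs 1)) = frag_cmul c (single (act xs 0) ((-1) ^ length xs))"
    unfolding hecke_eval_def frag_extend_cmul frag_extend_of by simp
  thus ?thesis by (simp add: frag_cmul_single)
qed

lemma act_eq_context:
  assumes "act us 0 = act vs 0"
  shows "act (xs @ us @ ys) 0 = act (xs @ vs @ ys) 0"
  using assms by (simp only: act_append_plus)

lemma hecke_eval_ideal: "f \<in> hecke_ideal \<Longrightarrow> hecke_eval f = 0"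
proof (induction rule: hecke_ideal.induct)
  case (commute i j xs ys)
  have "act [i, j] 0 = act [j, i] 0" using gen_commute[of i j] commute by (simp add: plus_gen rmul_0)
  from act_eq_context[OF this, of xs ys] show ?case
    by (simp only: hecke_eval_diff hecke_eval_single length_append list.size) simp
next
  case (braid i xs ys)
  have "act [i, i + 1, i] 0 = act [i + 1, i, i + 1] 0" using gen_braid[of i] by (simp add: plus_gen rmul_0)
  from act_eq_context[OF this, of xs ys] show ?case
    by (simp only: hecke_eval_diff hecke_eval_single length_append list.size) simp
next
  case (square i xs ys)
  have "act [i, i] 0 = act [i] 0" using gen_idem[of i] by (simp add: plus_gen rmul_0)
  from act_eq_context[OF this, of xs ys]
  have "hecke_eval (single (xs @ [i, i] @ ys) 1 - single (xs @ [i] @ ys) (-1)) = 0"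
    by (simp only: hecke_eval_diff hecke_eval_single length_append list.size) simp
  thus ?case by (simp add: single_uminus)
qed (simp add: hecke_eval_diff)

text \<open>Rewriting of words by the relations of the degenerate Hecke algebra, up to sign.\<close>

inductive wstep :: "nat list \<Rightarrow> nat list \<Rightarrow> bool" where
  wstep_commute: "1 \<le> i \<Longrightarrow> 1 \<le> j \<Longrightarrow> i + 2 \<le> j \<or> j + 2 \<le> i \<Longrightarrow> wstep (xs @ [i, j] @ ys) (xs @ [j, i] @ ys)"
| wstep_braid: "1 \<le> i \<Longrightarrow> wstep (xs @ [i + 1, i, i + 1] @ ys) (xs @ [i, i + 1, i] @ ys)"
| wstep_square: "1 \<le> i \<Longrightarrow> wstep (xs @ [i, i] @ ys) (xs @ [i] @ ys)"

lemma hecke_ideal_0: "0 \<in> hecke_ideal"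
  using hecke_ideal.diff[OF hecke_ideal.commute[of 1 3 "[]" "[]"] hecke_ideal.commute[of 1 3 "[]" "[]"]] by simp

lemma hecke_ideal_uminus: "f \<in> hecke_ideal \<Longrightarrow> - f \<in> hecke_ideal"
  using hecke_ideal.diff[OF hecke_ideal_0] by fastforce

lemma hecke_ideal_add: "f \<in> hecke_ideal \<Longrightarrow> g \<in> hecke_ideal \<Longrightarrow> f + g \<in> hecke_ideal"
  using hecke_ideal.diff[OF _ hecke_ideal_uminus] by fastforce

lemma wstep_ideal:
  assumes "wstep xs ys"
  shows "\<exists>c. (c = 1 \<or> c = -1) \<and> single xs 1 - single ys c \<in> hecke_ideal"
  using assms
proof cases
  case (wstep_commute i j us vs)
  have "single xs 1 - single ys 1 \<in> hecke_ideal"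
  proof (cases "i + 2 \<le> j")
    case True
    thus ?thesis using hecke_ideal.commute[of i j us vs] wstep_commute by simp
  next
    case False
    thus ?thesis using hecke_ideal_uminus[OF hecke_ideal.commute[of j i us vs]] wstep_commute by simp
  qed
  thus ?thesis by blast
next
  case (wstep_braid i us vs)
  thus ?thesis using hecke_ideal_uminus[OF hecke_ideal.braid[of i us vs]] by (intro exI[of _ 1]) simp
next
  case (wstep_square i us vs)
  thus ?thesis using hecke_ideal.square[of i us vs] by (intro exI[of _ "-1"]) (simp add: single_uminus)
qed

lemma wsteps_ideal:
  assumes "wstep\<^sup>*\<^sup>* xs ys"
  shows "\<exists>c. (c = 1 \<or> c = -1) \<and> single xs 1 - single ys c \<in> hecke_ideal"
  using assms
proof (induction rule: converse_rtranclp_induct)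
  case base
  show ?case by (intro exI[of _ 1]) (simp add: hecke_ideal_0)
next
  case (step xs zs)
  obtain c where c: "c = 1 \<or> c = -1" "single xs 1 - single zs c \<in> hecke_ideal"
    using wstep_ideal[OF step(1)] by blast
  obtain d where d: "d = 1 \<or> d = -1" "single zs 1 - single ys d \<in> hecke_ideal"
    using step by blast
  from c(1) show ?case
  proof
    assume "c = 1"
    hence "single xs 1 - single ys d \<in> hecke_ideal" using hecke_ideal_add[OF c(2) d(2)] by simp
    thus ?thesis using d by blast
  next
    assume "c = -1"
    hence "single xs 1 - single ys (- d) \<in> hecke_ideal"
      using hecke_ideal.diff[OF c(2) d(2)] by (simp add: single_uminus)
    thus ?thesis using d by (intro exI[of _ "- d"]) auto
  qed
qed

lemma wstep_context: "wstep xs ys \<Longrightarrow> wstep (us @ xs @ vs) (us @ ys @ vs)"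
proof (induction rule: wstep.induct)
  case (wstep_commute i j xs ys)
  thus ?case using wstep.wstep_commute[of i j "us @ xs" "ys @ vs"] by simp
next
  case (wstep_braid i xs ys)
  thus ?case using wstep.wstep_braid[of i "us @ xs" "ys @ vs"] by simp
next
  case (wstep_square i xs ys)
  thus ?case using wstep.wstep_square[of i "us @ xs" "ys @ vs"] by simp
qed

lemma wsteps_context: "wstep\<^sup>*\<^sup>* xs ys \<Longrightarrow> wstep\<^sup>*\<^sup>* (us @ xs @ vs) (us @ ys @ vs)"
  by (induction rule: rtranclp_induct) (auto dest: wstep_context[of _ _ us vs])

lemma wsteps_commute:
  assumes "1 \<le> i" "\<forall>j\<in>set xs. 1 \<le> j \<and> (i + 2 \<le> j \<or> j + 2 \<le> i)"
  shows "wstep\<^sup>*\<^sup>* (xs @ [i]) (i # xs)"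
  using assms(2)
proof (induction xs)
  case (Cons j xs)
  have "wstep\<^sup>*\<^sup>* (j # xs @ [i]) (j # i # xs)" using wsteps_context[of _ _ "[j]" "[]"] Cons by simp
  moreover have "wstep (j # i # xs) (i # j # xs)"
    using wstep.wstep_commute[of j i "[]" xs] Cons.prems assms(1) by auto
  ultimately show ?case by simp
qed simp

text \<open>Normal forms \<open>(s\<^sub>1)(s\<^sub>2 s\<^sub>1)\<dots>\<close>: a suffix of each descending run, one run for each \<open>k\<close>.\<close>

primrec normal_words :: "nat \<Rightarrow> nat list set" where
  "normal_words 0 = {[]}"
| "normal_words (Suc k) = {u @ rev [j..<k + 2] | u j. u \<in> normal_words k \<and> 1 \<le> j \<and> j \<le> k + 2}"

lemma normal_words_SucI:
  "u \<in> normal_words k \<Longrightarrow> 1 \<le> j \<Longrightarrow> j \<le> k + 2 \<Longrightarrow> u @ rev [j..<k + 2] \<in> normal_words (Suc k)"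
  unfolding normal_words.simps by blast

lemma normal_words_SucE:
  assumes "u \<in> normal_words (Suc k)"
  obtains v j where "u = v @ rev [j..<k + 2]" "v \<in> normal_words k" "1 \<le> j" "j \<le> k + 2"
  using assms unfolding normal_words.simps by blast

declare upt_Suc [simp del] normal_words.simps(2) [simp del]

lemma upt_split: "a \<le> b \<Longrightarrow> b \<le> c \<Longrightarrow> [a..<c] = [a..<b] @ [b..<c::nat]"
  using upt_add_eq_append[of a b "c - b"] by simp

text \<open>The last run descends from \<open>Suc k\<close> to \<open>j\<close>. The new letter
  \<open>i\<close> commutes through it if below \<open>j - 1\<close>, extends it if equal to
  \<open>j - 1\<close>, is swallowed if equal to \<open>j\<close>, and otherwise passes it by one
  braid move, emerging as \<open>i - 1\<close>. A letter that emerges on the left is at most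
  \<open>k\<close>, so the shorter normal word takes it up by induction.\<close>

lemma normal_words_step:
  "u \<in> normal_words k \<Longrightarrow> 1 \<le> i \<Longrightarrow> i \<le> k \<Longrightarrow> \<exists>u'\<in>normal_words k. wstep\<^sup>*\<^sup>* (u @ [i]) u'"
proof (induction k arbitrary: u i)
  case (Suc k)
  obtain v j where u: "u = v @ rev [j..<k + 2]" "v \<in> normal_words k" "1 \<le> j" "j \<le> k + 2"
    using Suc.prems(1) by (rule normal_words_SucE)
  have lift: "\<exists>u'\<in>normal_words (Suc k). wstep\<^sup>*\<^sup>* (u @ [i]) u'"
    if st: "wstep\<^sup>*\<^sup>* (rev [j..<k + 2] @ [i]) (i' # rev [j..<k + 2])" and i': "1 \<le> i'" "i' \<le> k" for i'
  proof -
    obtain v' where v': "v' \<in> normal_words k" "wstep\<^sup>*\<^sup>* (v @ [i']) v'"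
      using Suc.IH[OF u(2) i'] by blast
    have "wstep\<^sup>*\<^sup>* (u @ [i]) (v @ i' # rev [j..<k + 2])"
      using wsteps_context[OF st, of v "[]"] unfolding u(1) by simp
    also have "wstep\<^sup>*\<^sup>* (v @ i' # rev [j..<k + 2]) (v' @ rev [j..<k + 2])"
      using wsteps_context[OF v'(2), of "[]" "rev [j..<k + 2]"] by simp
    finally show ?thesis using normal_words_SucI[OF v'(1) u(3,4)] by blast
  qed
  consider "i + 1 < j" | "i + 1 = j" | "i = j" | "j < i" by linarith
  thus ?case
  proof cases
    case 1
    have "wstep\<^sup>*\<^sup>* (rev [j..<k + 2] @ [i]) (i # rev [j..<k + 2])"
      by (rule wsteps_commute) (use 1 Suc.prems(2) u(3) in auto)
    moreover have "i \<le> k" using 1 u(4) by linarith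
    ultimately show ?thesis using Suc.prems(2) by (intro lift)
  next
    case 2
    have "[i..<k + 2] = i # [Suc i..<k + 2]" using Suc.prems(3) by (intro upt_conv_Cons) simp
    hence "u @ [i] = v @ rev [i..<k + 2]" using 2 unfolding u(1) by simp
    moreover have "v @ rev [i..<k + 2] \<in> normal_words (Suc k)"
      using u(2) Suc.prems(2,3) by (intro normal_words_SucI) auto
    ultimately show ?thesis by (metis rtranclp.rtrancl_refl)
  next
    case 3
    have "[i..<k + 2] = i # [Suc i..<k + 2]" using Suc.prems(3) by (intro upt_conv_Cons) simp
    hence "u = (v @ rev [Suc i..<k + 2]) @ [i]" unfolding u(1) 3[symmetric] by simp
    moreover have "wstep ((v @ rev [Suc i..<k + 2]) @ [i, i] @ []) ((v @ rev [Suc i..<k + 2]) @ [i] @ [])"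
      using Suc.prems(2) by (intro wstep_square)
    ultimately have "wstep (u @ [i]) u" by simp
    thus ?thesis using Suc.prems(1) by blast
  next
    case 4
    define E where "E = rev [j..<i - 1]"
    define D where "D = rev [Suc i..<k + 2]"
    have "[i..<k + 2] = i # [Suc i..<k + 2]" using Suc.prems(3) by (intro upt_conv_Cons) simp
    moreover have "[i - 1..<k + 2] = (i - 1) # [Suc (i - 1)..<k + 2]" using Suc.prems(3) by (intro upt_conv_Cons) simp
    moreover have "Suc (i - 1) = i" using Suc.prems(2) by simp
    moreover have "[j..<k + 2] = [j..<i - 1] @ [i - 1..<k + 2]" using 4 Suc.prems(3) by (intro upt_split) simp_all
    ultimately have "[j..<k + 2] = [j..<i - 1] @ [i - 1, i] @ [Suc i..<k + 2]" by (simp only: append.simps)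
    hence split: "rev [j..<k + 2] = D @ [i, i - 1] @ E" by (simp add: D_def E_def)
    have "wstep\<^sup>*\<^sup>* (E @ [i]) (i # E)"
      by (rule wsteps_commute) (use 4 Suc.prems(2) u(3) in \<open>auto simp: E_def\<close>)
    from wsteps_context[OF this, of "D @ [i, i - 1]" "[]"]
    have "wstep\<^sup>*\<^sup>* (rev [j..<k + 2] @ [i]) (D @ [i, i - 1, i] @ E)" unfolding split by simp
    also have "wstep (D @ [i, i - 1, i] @ E) (D @ [i - 1, i, i - 1] @ E)"
      using wstep.wstep_braid[of "i - 1" D E] 4 u(3) by simp
    also have "wstep\<^sup>*\<^sup>* (D @ [i - 1, i, i - 1] @ E) ((i - 1) # D @ [i, i - 1] @ E)"
    proof -
      have "wstep\<^sup>*\<^sup>* (D @ [i - 1]) ((i - 1) # D)"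
        by (rule wsteps_commute) (use 4 u(3) in \<open>auto simp: D_def\<close>)
      from wsteps_context[OF this, of "[]" "[i, i - 1] @ E"] show ?thesis by simp
    qed
    finally have "wstep\<^sup>*\<^sup>* (rev [j..<k + 2] @ [i]) ((i - 1) # rev [j..<k + 2])" unfolding split .
    moreover have "1 \<le> i - 1" "i - 1 \<le> k" using 4 u(3) Suc.prems(3) by linarith+
    ultimately show ?thesis by (rule lift)
  qed
qed simp

lemma normal_words_exist:
  assumes "set xs \<subseteq> {1..k}"
  shows "\<exists>u\<in>normal_words k. wstep\<^sup>*\<^sup>* xs u"
  using assms
proof (induction xs rule: rev_induct)
  case Nil
  have "[] \<in> normal_words k"
  proof (induction k)
    case (Suc k)
    thus ?case using normal_words_SucI[of "[]" k "k + 2"] by simp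
  qed simp
  thus ?case by blast
next
  case (snoc i xs)
  then obtain u where u: "u \<in> normal_words k" "wstep\<^sup>*\<^sup>* xs u" by auto
  from normal_words_step[OF u(1), of i] snoc.prems obtain u' where u': "u' \<in> normal_words k" "wstep\<^sup>*\<^sup>* (u @ [i]) u'"
    by auto
  have "wstep\<^sup>*\<^sup>* (xs @ [i]) (u @ [i])" using wsteps_context[OF u(2), of "[]" "[i]"] by simp
  thus ?case using u' by (metis rtranclp_trans)
qed

lemma normal_words_letters: "u \<in> normal_words k \<Longrightarrow> set u \<subseteq> {1..k}"
proof (induction k arbitrary: u)
  case (Suc k)
  from Suc.prems obtain v j where "u = v @ rev [j..<k + 2]" "v \<in> normal_words k" "1 \<le> j" "j \<le> k + 2"
    by (rule normal_words_SucE)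
  thus ?case using Suc.IH[of v] by fastforce
qed simp

lemma normal_words_reduced:
  "u \<in> normal_words k \<Longrightarrow> length u = perm_length (word_perm u)"
proof (induction k arbitrary: u)
  case (Suc k)
  obtain v j where u: "u = v @ rev [j..<k + 2]" "v \<in> normal_words k" "1 \<le> j" "j \<le> k + 2"
    using Suc.prems(1) by (rule normal_words_SucE)
  have v: "word_perm v permutes {1..<k + 2}"
    by (rule word_perm_permutes) (use normal_words_letters[OF u(2)] in auto)
  have len: "length v = perm_length (word_perm v)" using Suc.IH u by blast
  \<comment> \<open>After \<open>m\<close> letters of the last run the largest value
    \<open>k + 2\<close> sits at position \<open>k + 2 - m\<close> and everything to its left is
    untouched, so the next letter acts at an ascent.\<close>
  have "m \<le> k + 1 \<Longrightarrow> length (v @ rev [k + 2 - m..<k + 2]) = perm_length (word_perm (v @ rev [k + 2 - m..<k + 2])) \<and>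
    word_perm (v @ rev [k + 2 - m..<k + 2]) (k + 2 - m) = k + 2 \<and>
    (\<forall>x < k + 2 - m. word_perm (v @ rev [k + 2 - m..<k + 2]) x = word_perm v x)" for m
  proof (induction m)
    case 0
    have "word_perm v (k + 2) = k + 2" using v by (simp add: permutes_def)
    thus ?case using len by simp
  next
    case (Suc m)
    define i where "i = k + 2 - Suc m"
    have i: "k + 2 - m = Suc i" "1 \<le> i" using Suc.prems by (auto simp: i_def)
    define w where "w = word_perm (v @ rev [Suc i..<k + 2])"
    have split: "v @ rev [i..<k + 2] = (v @ rev [Suc i..<k + 2]) @ [i]"
      using Suc.prems by (simp add: i_def upt_conv_Cons)
    have "m \<le> k + 1" using Suc.prems by simp
    note IH = Suc.IH[OF this, unfolded i(1), folded w_def]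
    have w: "length (v @ rev [Suc i..<k + 2]) = perm_length w" "w (Suc i) = k + 2" "\<And>x. x < Suc i \<Longrightarrow> w x = word_perm v x"
      using IH by blast+
    have wp: "w permutes {1..<k + 3}" unfolding w_def
      by (rule word_perm_permutes) (use normal_words_letters[OF u(2)] i in auto)
    have "word_perm v i \<in> {1..<k + 2}" using permutes_in_image[OF v, of i] i Suc.prems by (auto simp: i_def)
    hence "w i < w (Suc i)" using w by simp
    from perm_length_comp_adj[OF wp this]
    have "length (v @ rev [i..<k + 2]) = perm_length (word_perm (v @ rev [i..<k + 2]))"
      unfolding split word_perm_append[of "v @ _"] w_def[symmetric] using w(1) by (simp add: o_def)
    moreover have "word_perm (v @ rev [i..<k + 2]) i = k + 2"
      unfolding split word_perm_append[of "v @ _"] w_def[symmetric] using w(2) by (simp add: adj_apply)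
    moreover have "\<forall>x<i. word_perm (v @ rev [i..<k + 2]) x = word_perm v x"
      unfolding split word_perm_append[of "v @ _"] w_def[symmetric] using w(3) by (simp add: adj_apply)
    ultimately show ?case unfolding i_def by blast
  qed
  from this[of "k + 2 - j"] have "length (v @ rev [k + 2 - (k + 2 - j)..<k + 2]) =
      perm_length (word_perm (v @ rev [k + 2 - (k + 2 - j)..<k + 2]))" using u by linarith
  moreover have "k + 2 - (k + 2 - j) = j" using u by simp
  ultimately show ?case unfolding u(1) by (simp only:)
qed (simp add: perm_length_id[unfolded id_def] perm_length_id)

lemma act_concat_reduced:
  assumes "list_all2 reduced_word xss us"
  shows "act (concat xss) 0 = sum_list (map Abs_fperm us)"
  using assms
proof (induction rule: list_all2_induct)
  case (Cons xs xss u us)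
  have "app (act xs 0) = u" using act_reduced[of xs] Cons(1) by (auto simp: reduced_word_def)
  hence "act xs 0 = Abs_fperm u" by (metis app_inverse)
  thus ?case using Cons by (simp only: concat.simps act_append_plus list.map sum_list_simps)
qed simp

text \<open>Rewriting to a normal word provides the reduced word and the sign;
  \<open>hecke_eval\<close> shows that no other permutation satisfies the description.\<close>

theorem hecke_prod_eq:
  assumes "\<forall>u\<in>set us. u permutes {1..<Suc M}"
  shows "hecke_prod us = app (sum_list (map Abs_fperm us))"
  unfolding hecke_prod_def
proof (rule the_equality)
  have "\<forall>u\<in>set us. \<exists>xs. set xs \<subseteq> {1..<M} \<and> word_perm xs = u \<and> length xs = perm_length u"
    using assms reduced_word_exists[of _ 1 "Suc M"] by simp
  then obtain f where f: "\<And>u. u \<in> set us \<Longrightarrow> set (f u) \<subseteq> {1..<M} \<and> word_perm (f u) = u \<and> length (f u) = perm_length u"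
    by metis
  let ?xss = "map f us"
  have red: "list_all2 reduced_word ?xss us"
    unfolding list_all2_map1 by (rule list.rel_refl_strong) (use f in \<open>fastforce simp: reduced_word_def\<close>)
  have "set (concat ?xss) \<subseteq> {1..M}" using f by fastforce
  from normal_words_exist[OF this] obtain ys where ys: "ys \<in> normal_words M" "wstep\<^sup>*\<^sup>* (concat ?xss) ys" by blast
  obtain c where c: "c = 1 \<or> c = -1" "single (concat ?xss) 1 - single ys c \<in> hecke_ideal"
    using wsteps_ideal[OF ys(2)] by blast
  have "hecke_eval (single (concat ?xss) 1 - single ys c) = 0" by (rule hecke_eval_ideal[OF c(2)])
  \<comment> \<open>Passing to keys forgets the signs, which are nonzero.\<close>
  hence "keys (single (act (concat ?xss) 0) ((-1::int) ^ length (concat ?xss))) = keys (single (act ys 0) (c * (-1) ^ length ys))"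
    by (simp add: hecke_eval_diff hecke_eval_single)
  hence "act (concat ?xss) 0 = act ys 0" using c(1) by (auto split: if_splits)
  hence w: "app (sum_list (map Abs_fperm us)) = word_perm ys"
    using act_concat_reduced[OF red] act_reduced[OF normal_words_reduced[OF ys(1)]] by simp
  have "word_perm ys permutes {1..<M + 2}"
    by (rule word_perm_permutes) (use normal_words_letters[OF ys(1)] in auto)
  moreover have "{1..<M + 2} = {1..M + 1}" by auto
  ultimately have "\<exists>k. app (sum_list (map Abs_fperm us)) permutes {1..k}" unfolding w by metis
  moreover have "reduced_word ys (app (sum_list (map Abs_fperm us)))"
    using w normal_words_reduced[OF ys(1)] normal_words_letters[OF ys(1)] by (auto simp: reduced_word_def)
  ultimately show "(\<exists>k. app (sum_list (map Abs_fperm us)) permutes {1..k}) \<and>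
     (\<exists>xss ys c. list_all2 reduced_word xss us \<and> reduced_word ys (app (sum_list (map Abs_fperm us))) \<and>
       (c = 1 \<or> c = -1) \<and> single (concat xss) 1 - single ys c \<in> hecke_ideal)"
    using red c by blast
next
  fix w
  assume "(\<exists>k. w permutes {1..k}) \<and> (\<exists>xss ys c. list_all2 reduced_word xss us \<and> reduced_word ys w \<and>
       (c = 1 \<or> c = -1) \<and> single (concat xss) 1 - single ys c \<in> hecke_ideal)"
  then obtain xss ys and c :: int where *: "list_all2 reduced_word xss us" "reduced_word ys w" "c = 1 \<or> c = -1"
    "single (concat xss) 1 - single ys c \<in> hecke_ideal" by blast
  have "hecke_eval (single (concat xss) 1 - single ys c) = 0" by (rule hecke_eval_ideal[OF *(4)])
  hence "keys (single (act (concat xss) 0) ((-1::int) ^ length (concat xss))) = keys (single (act ys 0) (c * (-1) ^ length ys))"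
    by (simp add: hecke_eval_diff hecke_eval_single)
  hence "act (concat xss) 0 = act ys 0" using *(3) by (auto split: if_splits)
  thus "w = app (sum_list (map Abs_fperm us))"
    using act_concat_reduced[OF *(1)] act_reduced[of ys] *(2) by (auto simp: reduced_word_def)
qed


section \<open>Block swaps\<close>

text \<open>Block swap: the \<open>k\<close> points after \<open>c\<close> trade places with the
  next \<open>m\<close> points. In their index ranges \<open>W_perm r i j\<close> and
  \<open>delta_perm n r j\<close> both have this form.\<close>

definition bs :: "nat \<Rightarrow> nat \<Rightarrow> nat \<Rightarrow> nat \<Rightarrow> nat" where
  "bs c k m p = (if p \<le> c then p else if p \<le> c + k then p + m else if p \<le> c + k + m then p - k else p)"

lemma bs_inverse: "bs c m k (bs c k m p) = p"
  by (auto simp: bs_def)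

lemma bs_permutes:
  assumes "c + k + m \<le> N"
  shows "bs c k m permutes {1..<Suc N}"
proof (rule bij_imp_permutes)
  show "bij_betw (bs c k m) {1..<Suc N} {1..<Suc N}"
    by (rule bij_betwI[where g = "bs c m k"]) (use assms in \<open>auto simp: bs_inverse\<close>, auto simp: bs_def)
qed (use assms in \<open>auto simp: bs_def\<close>)

lemma bs_0 [simp]: "bs c 0 m = id" "bs c k 0 = id"
  by (auto simp: bs_def fun_eq_iff)

lemma perm_length_bs: "perm_length (bs c k m) = k * m"
proof -
  have "inversions (bs c k m) = {c<..c + k} \<times> {c + k<..c + k + m}"
    by (auto simp: inversions_def bs_def split: if_splits)
  thus ?thesis by (simp add: perm_length_eq card_cartesian_product)
qed

lemma bs_compose: "bs c k m \<circ> bs (c + k) k' m = bs c (k + k') m"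
  by (auto simp: bs_def fun_eq_iff)

text \<open>Under \<open>run\<close>, each ascending row moves one of \<open>m\<close> entries past
  a block of \<open>k\<close> entries, the last of the \<open>m\<close> entries first.\<close>

primrec rectword :: "nat \<Rightarrow> nat \<Rightarrow> nat \<Rightarrow> nat list" where
  "rectword c k 0 = []"
| "rectword c k (Suc m) = [Suc (c + m)..<Suc (c + m + k)] @ rectword c k m"

lemma set_rectword: "set (rectword c k m) \<subseteq> {c<..<c + k + m}"
  by (induction m) auto

lemma length_rectword [simp]: "length (rectword c k m) = k * m"
  by (induction m) auto

lemma rectword_0 [simp]: "rectword c 0 m = []"
  by (induction m) auto

lemma word_perm_ascending: "word_perm [Suc c..<Suc (c + k)] = bs c k 1"
proof (induction k)
  case (Suc k)
  have "word_perm [Suc c..<Suc (c + Suc k)] = bs c k 1 \<circ> adj (Suc (c + k))"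
    using Suc by (simp add: upt_Suc)
  also have "\<dots> = bs c (Suc k) 1" by (auto simp: fun_eq_iff bs_def adj_apply)
  finally show ?case .
qed (simp add: upt_Suc)

lemma word_perm_rectword: "word_perm (rectword c k m) = bs c k m"
proof (induction m)
  case (Suc m)
  have "word_perm (rectword c k (Suc m)) = bs (c + m) k 1 \<circ> bs c k m"
    using word_perm_ascending[of "c + m" k] Suc by simp
  also have "\<dots> = bs c k (Suc m)" by (auto simp: fun_eq_iff bs_def)
  finally show ?case .
qed simp

lemma act_rectword: "act (rectword c k m) 0 = Abs_fperm (bs c k m)"
proof -
  have "app (act (rectword c k m) 0) = bs c k m"
    using act_reduced[of "rectword c k m"] by (simp add: word_perm_rectword perm_length_bs)
  thus ?thesis by (metis app_inverse)
qed

lemma app_bs: "app (Abs_fperm (bs c k m)) = bs c k m"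
  by (rule app_Abs[OF bs_permutes[OF order_refl]])

text \<open>An increasing \<open>w\<close> preserves every ascent met along a reduced word, so no
  letter is absorbed and the Demazure product is ordinary composition.\<close>

lemma act_increasing:
  assumes "length xs = perm_length (word_perm xs)" "set xs \<subseteq> {1..<L}" "strict_mono_on {1..L} (app w)"
  shows "app (act xs w) = app w \<circ> word_perm xs"
  using assms(1,2)
proof (induction xs rule: rev_induct)
  case (snoc i xs)
  let ?v = "word_perm xs"
  from dright_word_perm[OF snoc.prems(1)]
  have red: "length xs = perm_length ?v" "?v i < ?v (Suc i)" by auto
  have v: "?v permutes {1..<Suc L}" by (rule word_perm_permutes) (use snoc.prems in auto)
  have "?v i \<in> {1..L}" "?v (Suc i) \<in> {1..L}"
    using permutes_in_image[OF v, of i] permutes_in_image[OF v, of "Suc i"] snoc.prems by auto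
  hence "app w (?v i) < app w (?v (Suc i))" using strict_mono_onD[OF assms(3)] red(2) by blast
  moreover have "app (act xs w) = app w \<circ> ?v" using snoc red by auto
  ultimately show ?case by (simp add: rmul.rep_eq dright_def o_assoc)
qed simp

lemma sign_word_perm: "sign (word_perm xs) = (-1) ^ length xs"
proof (induction xs)
  case (Cons i xs)
  have "permutation (adj i)" unfolding adj_def by (rule permutation_swap_id)
  moreover have "permutation (word_perm xs)"
  proof -
    obtain b where "word_perm xs permutes {0..<b}" using ex_word_permutes by blast
    thus ?thesis by (rule permutation_permutes[THEN iffD2, OF exI, OF conjI, rotated]) simp
  qed
  moreover have "sign (adj i) = -1" by (simp add: adj_def sign_swap_id)
  ultimately show ?case by (simp only: word_perm_Cons sign_compose Cons.IH list.size) simp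
qed (simp add: sign_id)

text \<open>Lengths are not additive under composition, but their parities are; the final sign needs
  only these.\<close>

lemma sign_perm_length: "w permutes {a..<b} \<Longrightarrow> sign w = (-1) ^ perm_length w"
  using reduced_word_exists[of w a b] sign_word_perm by metis

section \<open>Zelevinsky permutations\<close>

locale ranks =
  fixes n :: nat and r :: "nat \<Rightarrow> nat \<Rightarrow> nat"
  assumes n: "1 \<le> n" and rank: "rank_conditions n r"
begin

abbreviation e :: "nat \<Rightarrow> nat" where "e i \<equiv> r i i"

text \<open>Positions are cut at the numbers \<open>tsum\<close>, with block \<open>n\<close> first,
  and values at the numbers \<open>hsum\<close>, with block \<open>0\<close> first.\<close>

definition tsum :: "nat \<Rightarrow> nat" where "tsum k = (\<Sum>l=k..n. e l)"

definition hsum :: "nat \<Rightarrow> nat" where "hsum k = (\<Sum>l<k. e l)"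

text \<open>The ranks with the first index shifted by one, so that the boundary values
  \<open>r i j = 0\<close> for \<open>i < 0\<close> or \<open>j > n\<close> can be included.\<close>

definition rho :: "nat \<Rightarrow> nat \<Rightarrow> nat" where
  "rho a j = (if a = 0 \<or> n < j then 0 else rk r (a - 1) j)"

abbreviation N :: nat where "N \<equiv> total_dim n r"

lemma tsum_Suc: "k \<le> n \<Longrightarrow> tsum k = e k + tsum (Suc k)"
  by (simp add: tsum_def sum.atLeast_Suc_atMost)

lemma tsum_end [simp]: "tsum (Suc n) = 0"
  by (simp add: tsum_def)

lemma hsum_Suc [simp]: "hsum (Suc k) = hsum k + e k"
  by (simp add: hsum_def)

lemma hsum_0 [simp]: "hsum 0 = 0"
  by (simp add: hsum_def)

lemma hsum_tsum: "k \<le> Suc n \<Longrightarrow> hsum k + tsum k = N"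
proof (induction k)
  case 0 show ?case by (simp add: tsum_def total_dim_def)
next
  case (Suc k) thus ?case using tsum_Suc[of k] by simp
qed

lemma tsum_0: "tsum 0 = N"
  using hsum_tsum[of 0] by simp

lemma tsum_antimono: "k \<le> l \<Longrightarrow> tsum l \<le> tsum k"
  unfolding tsum_def by (intro sum_mono2) auto

lemma hsum_mono: "k \<le> l \<Longrightarrow> hsum k \<le> hsum l"
  unfolding hsum_def by (intro sum_mono2) auto

lemma rank_le: "i < j \<Longrightarrow> j \<le> n \<Longrightarrow> r i j \<le> r i (j - 1)" "i < j \<Longrightarrow> j \<le> n \<Longrightarrow> r i j \<le> r (i + 1) j"
  using rank by (auto simp: rank_conditions_def)

lemma rank_super: "0 < i \<Longrightarrow> i \<le> j \<Longrightarrow> j < n \<Longrightarrow> r (i - 1) j + r i (j + 1) \<le> r i j + r (i - 1) (j + 1)"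
  using rank by (auto simp: rank_conditions_def)

lemma rho_mono: "rho a j \<le> rho (Suc a) j"
proof (cases "a = 0 \<or> n < j")
  case False
  then obtain i where a: "a = Suc i" by (cases a) auto
  consider "j \<le> i" | "j = Suc i" | "Suc i < j" by linarith
  thus ?thesis
  proof cases
    case 1 thus ?thesis using False by (simp add: rho_def a rk_def)
  next
    case 2 thus ?thesis using False rank_le(2)[of i j] by (simp add: rho_def a rk_def)
  next
    case 3 thus ?thesis using False rank_le(2)[of i j] by (simp add: rho_def a rk_def)
  qed
qed (auto simp: rho_def)

lemma rho_anti: "rho a (Suc j) \<le> rho a j"
proof (cases "a = 0 \<or> n < Suc j")
  case False
  then obtain i where a: "a = Suc i" by (cases a) auto
  consider "Suc j \<le> i" | "j = i" | "i < j" by linarith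
  thus ?thesis
  proof cases
    case 1 thus ?thesis using False by (simp add: rho_def a rk_def sum.atLeast_Suc_atMost[of j])
  next
    case 2 thus ?thesis using False rank_le(1)[of i "Suc j"] by (simp add: rho_def a rk_def)
  next
    case 3 thus ?thesis using False rank_le(1)[of i "Suc j"] by (simp add: rho_def a rk_def)
  qed
qed (auto simp: rho_def)

text \<open>For indices up to \<open>n\<close>, the difference of the two sides counts the positions
  of block \<open>j\<close> that \<open>zel n r\<close> sends into value block \<open>a\<close>, as
  \<open>zone\<close> makes precise. At the boundary the inequality reduces to monotonicity.\<close>

lemma rho_super: "rho (Suc a) (Suc j) + rho a j \<le> rho a (Suc j) + rho (Suc a) j"
proof (cases "a = 0 \<or> n < Suc j")
  case True
  thus ?thesis using rho_anti[of "Suc a" j] rho_mono[of a j] by (auto simp: rho_def)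
next
  case False
  then obtain i where a: "a = Suc i" by (cases a) auto
  consider "j < i" | "j = i" | "i < j" by linarith
  thus ?thesis
  proof cases
    case 1
    thus ?thesis using False by (simp add: rho_def a rk_def sum.atLeast_Suc_atMost[of j])
  next
    case 2 thus ?thesis using False by (simp add: rho_def a rk_def)
  next
    case 3 thus ?thesis using False rank_super[of "Suc i" j] by (cases "j = Suc i") (simp_all add: rho_def a rk_def)
  qed
qed

lemma rho_mono': "a \<le> b \<Longrightarrow> rho a j \<le> rho b j"
  by (rule lift_Suc_mono_le[of "\<lambda>a. rho a j"]) (rule rho_mono)

lemma rho_super': "a \<le> b \<Longrightarrow> rho b (Suc j) + rho a j \<le> rho a (Suc j) + rho b j"
proof (induction b rule: dec_induct)
  case (step b) thus ?case using rho_super[of b j] by linarith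
qed simp

lemma rho_super'': "j \<le> k \<Longrightarrow> rho (Suc a) k + rho a j \<le> rho a k + rho (Suc a) j"
proof (induction k rule: dec_induct)
  case (step k) thus ?case using rho_super[of a k] by linarith
qed simp

lemma rho_0 [simp]: "rho 0 j = 0"
  by (simp add: rho_def)

lemma rho_end: "rho a (Suc n) = 0"
  by (simp add: rho_def)

lemma rho_tsum: "rho (Suc n) k = tsum k"
  by (auto simp: rho_def rk_def tsum_def)

lemma rho_hsum: "rho a 0 = hsum a"
  by (cases a) (auto simp: rho_def rk_def hsum_def atLeast0AtMost lessThan_Suc_atMost)

lemma rho_low:
  assumes "Suc k < a" "a \<le> Suc n"
  shows "rho a k = e k + rho a (Suc k)"
proof -
  obtain i where a: "a = Suc i" "k < i" using assms by (cases a) auto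
  thus ?thesis using assms by (simp add: rho_def rk_def sum.atLeast_Suc_atMost)
qed

lemma W_perm_bs:
  assumes "1 \<le> j" "j \<le> n" "i < n"
  shows "W_perm r i j = bs (rho (Suc i) j) (rho (Suc (Suc i)) j - rho (Suc i) j) (rho (Suc i) (j - 1) - rho (Suc i) j)"
proof
  fix p
  have 1: "rk r i j = rho (Suc i) j" "rk r (i + 1) j = rho (Suc (Suc i)) j" "rk r i (j - 1) = rho (Suc i) (j - 1)"
    using assms by (auto simp: rho_def)
  have 2: "rho (Suc i) j \<le> rho (Suc (Suc i)) j" "rho (Suc i) j \<le> rho (Suc i) (j - 1)"
    using rho_mono[of "Suc i" j] rho_anti[of "Suc i" "j - 1"] assms by auto
  show "W_perm r i j p = bs (rho (Suc i) j) (rho (Suc (Suc i)) j - rho (Suc i) j) (rho (Suc i) (j - 1) - rho (Suc i) j) p"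
    unfolding W_perm_def 1 bs_def using 2 by auto
qed

lemma W_perm_permutes:
  assumes "1 \<le> j" "j \<le> n" "i < n"
  shows "W_perm r i j permutes {1..<Suc N}"
  unfolding W_perm_bs[OF assms]
proof (rule bs_permutes)
  obtain k where j: "j = Suc k" using assms by (cases j) auto
  have "rho (Suc (Suc i)) j + rho (Suc i) k \<le> rho (Suc i) j + rho (Suc (Suc i)) k"
    unfolding j by (rule rho_super)
  moreover have "rho (Suc (Suc i)) k \<le> N"
    using rho_mono'[of "Suc (Suc i)" "Suc n" k] assms tsum_antimono[of 0 k] by (simp add: rho_tsum tsum_0)
  moreover have "rho (Suc i) j \<le> rho (Suc (Suc i)) j" "rho (Suc i) j \<le> rho (Suc i) k"
    using rho_mono[of "Suc i" j] rho_anti[of "Suc i" k] by (auto simp: j)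
  ultimately show "rho (Suc i) j + (rho (Suc (Suc i)) j - rho (Suc i) j) + (rho (Suc i) (j - 1) - rho (Suc i) j) \<le> N"
    unfolding j by simp
qed

text \<open>The partial products \<open>W\<^sub>0\<^sub>j \<dots> W\<^sub>m\<^sub>-\<^sub>1\<^sub>,\<^sub>j\<close> and \<open>Z\<^sub>1 \<dots> Z\<^sub>k\<close>, where \<open>Z\<^sub>j = W\<^sub>0\<^sub>j \<dots> W\<^sub>n\<^sub>-\<^sub>1\<^sub>,\<^sub>j\<close>.\<close>

definition wcol :: "nat \<Rightarrow> nat \<Rightarrow> nat \<Rightarrow> nat" where
  "wcol j m = foldr (\<circ>) (map (\<lambda>i. W_perm r i j) [0..<m]) id"

definition zpart :: "nat \<Rightarrow> nat \<Rightarrow> nat" where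
  "zpart k = foldr (\<circ>) (concat (map (\<lambda>j. map (\<lambda>i. W_perm r i j) [0..<n]) [1..<Suc k])) id"

lemma foldr_comp: "foldr (\<circ>) (xs @ ys) id = foldr (\<circ>) xs id \<circ> foldr (\<circ>) ys id"
  by (induction xs) (auto simp: o_assoc)

lemma wcol_Suc: "wcol j (Suc m) = wcol j m \<circ> W_perm r m j"
  by (simp add: wcol_def upt_Suc foldr_comp del: foldr_append)

lemma wcol_0 [simp]: "wcol j 0 = id"
  by (simp add: wcol_def)

lemma zpart_Suc: "zpart (Suc k) = zpart k \<circ> wcol (Suc k) n"
proof -
  have "[1..<Suc (Suc k)] = [1..<Suc k] @ [Suc k]" by (simp add: upt_Suc)
  thus ?thesis by (simp add: zpart_def wcol_def foldr_comp del: foldr_append One_nat_def)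
qed

lemma zpart_0 [simp]: "zpart 0 = id"
  by (simp add: zpart_def)

lemma zel_zpart: "zel n r = zpart n"
  by (simp add: zel_def zpart_def)

lemma wcol_permutes: "1 \<le> j \<Longrightarrow> j \<le> n \<Longrightarrow> m \<le> n \<Longrightarrow> wcol j m permutes {1..<Suc N}"
proof (induction m)
  case 0 show ?case unfolding wcol_0 by (rule permutes_id)
next
  case (Suc m)
  thus ?case unfolding wcol_Suc by (intro permutes_compose W_perm_permutes) auto
qed

lemma zpart_permutes: "k \<le> n \<Longrightarrow> zpart k permutes {1..<Suc N}"
proof (induction k)
  case 0 show ?case unfolding zpart_0 by (rule permutes_id)
next
  case (Suc k)
  thus ?case unfolding zpart_Suc by (intro permutes_compose wcol_permutes) auto
qed

lemma zel_permutes: "zel n r permutes {1..<Suc N}"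
  unfolding zel_zpart by (rule zpart_permutes) simp

lemma sign_wcol:
  "1 \<le> j \<Longrightarrow> j \<le> n \<Longrightarrow> m \<le> n \<Longrightarrow> sign (wcol j m) =
    (-1) ^ (\<Sum>i<m. (rho (Suc (Suc i)) j - rho (Suc i) j) * (rho (Suc i) (j - 1) - rho (Suc i) j))"
proof (induction m)
  case (Suc m)
  have "permutation (wcol j m)" "permutation (W_perm r m j)"
    using wcol_permutes[of j m] W_perm_permutes[of j m] Suc.prems permutes_imp_permutation by auto
  moreover have "sign (W_perm r m j) =
      (-1) ^ ((rho (Suc (Suc m)) j - rho (Suc m) j) * (rho (Suc m) (j - 1) - rho (Suc m) j))"
    using sign_perm_length[OF W_perm_permutes[of j m]] Suc.prems
    by (simp add: W_perm_bs perm_length_bs)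
  ultimately show ?case using Suc by (simp only: wcol_Suc sign_compose power_add sum.lessThan_Suc)
qed (simp add: sign_id)

definition crossings :: nat where
  "crossings = (\<Sum>j\<in>{1..n}. \<Sum>i<n. (rho (Suc (Suc i)) j - rho (Suc i) j) * (rho (Suc i) (j - 1) - rho (Suc i) j))"

lemma sign_zpart:
  "k \<le> n \<Longrightarrow> sign (zpart k) =
    (-1) ^ (\<Sum>j\<in>{1..k}. \<Sum>i<n. (rho (Suc (Suc i)) j - rho (Suc i) j) * (rho (Suc i) (j - 1) - rho (Suc i) j))"
proof (induction k)
  case (Suc k)
  have "permutation (zpart k)" "permutation (wcol (Suc k) n)"
    using zpart_permutes[of k] wcol_permutes[of "Suc k" n] Suc.prems permutes_imp_permutation by auto
  moreover have "{1..Suc k} = insert (Suc k) {1..k}" by auto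
  ultimately show ?case using Suc sign_wcol[of "Suc k" n]
    by (simp only: zpart_Suc sign_compose) (simp add: power_add mult.commute)
qed (simp add: sign_id)

lemma sign_zel: "sign (zel n r) = (-1) ^ crossings"
  unfolding zel_zpart crossings_def by (rule sign_zpart) simp

text \<open>A factor with \<open>i < j\<close> contributes a summand of the codimension, one with
  \<open>i \<ge> j\<close> a rectangle whose sides are entries of the dimension vector. The second
  part is therefore common to all ranks with that dimension vector.\<close>

lemma crossings_eq:
  "int crossings = expected_codim n r + (\<Sum>j\<in>{1..n}. \<Sum>i\<in>{j..<n}. int (e (Suc i)) * int (e (j - 1)))"
proof -
  define f where "f i j = (int (r i (j - 1)) - int (r i j)) * (int (r (i + 1) j) - int (r i j))" for i j
  have trm: "int ((rho (Suc (Suc i)) j - rho (Suc i) j) * (rho (Suc i) (j - 1) - rho (Suc i) j)) =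
      (if i < j then f i j else int (e (Suc i)) * int (e (j - 1)))" if "j \<in> {1..n}" "i < n" for i j
  proof -
    have le: "rho (Suc i) j \<le> rho (Suc (Suc i)) j" "rho (Suc i) j \<le> rho (Suc i) (j - 1)"
      using rho_mono[of "Suc i" j] rho_anti[of "Suc i" "j - 1"] that by auto
    hence eq: "int ((rho (Suc (Suc i)) j - rho (Suc i) j) * (rho (Suc i) (j - 1) - rho (Suc i) j)) =
      (int (rho (Suc (Suc i)) j) - int (rho (Suc i) j)) * (int (rho (Suc i) (j - 1)) - int (rho (Suc i) j))"
      by (simp add: of_nat_diff)
    show ?thesis
    proof (cases "i < j")
      case True
      have "rho (Suc i) j = r i j" "rho (Suc (Suc i)) j = r (i + 1) j" "rho (Suc i) (j - 1) = r i (j - 1)"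
        using True that by (cases "j = Suc i"; auto simp: rho_def rk_def)+
      thus ?thesis using True unfolding eq by (simp add: f_def mult.commute)
    next
      case False
      hence "rho (Suc (Suc i)) j = e (Suc i) + rho (Suc i) j" using that by (simp add: rho_def rk_def)
      moreover have "j - 1 \<le> i" using False by simp
      hence "rho (Suc i) (j - 1) = e (j - 1) + rho (Suc i) j"
        using that False sum.atLeast_Suc_atMost[of "j - 1" i e] by (auto simp: rho_def rk_def)
      ultimately show ?thesis using False unfolding eq by simp
    qed
  qed
  have split: "(\<Sum>i<n. if i < j then f i j else g i) = (\<Sum>i<j. f i j) + (\<Sum>i\<in>{j..<n}. g i)"
    if "j \<in> {1..n}" for j and g :: "nat \<Rightarrow> int"
  proof -
    have "{..<n} = {..<j} \<union> {j..<n}" using that by auto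
    moreover have "(\<Sum>i\<in>{..<j} \<union> {j..<n}. if i < j then f i j else g i) =
      (\<Sum>i<j. if i < j then f i j else g i) + (\<Sum>i\<in>{j..<n}. if i < j then f i j else g i)"
      by (rule sum.union_disjoint) auto
    ultimately show ?thesis by simp
  qed
  have "int crossings = (\<Sum>j\<in>{1..n}. \<Sum>i<n. if i < j then f i j else int (e (Suc i)) * int (e (j - 1)))"
    unfolding crossings_def of_nat_sum by (intro sum.cong refl) (use trm in auto)
  also have "\<dots> = (\<Sum>j\<in>{1..n}. \<Sum>i<j. f i j) + (\<Sum>j\<in>{1..n}. \<Sum>i\<in>{j..<n}. int (e (Suc i)) * int (e (j - 1)))"
    unfolding sum.distrib[symmetric] by (intro sum.cong refl split)
  also have "(\<Sum>j\<in>{1..n}. \<Sum>i<j. f i j) = (\<Sum>(j, i)\<in>Sigma {1..n} (\<lambda>j. {..<j}). f i j)"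
    by (rule sum.Sigma) auto
  also have "\<dots> = expected_codim n r"
    unfolding expected_codim_def f_def
    by (rule sum.reindex_bij_witness[of _ "\<lambda>(i, j). (j, i)" "\<lambda>(j, i). (i, j)"]) auto
  finally show ?thesis .
qed

subsection \<open>The Zelevinsky permutation on the position blocks\<close>

lemma W_perm_fixed_high:
  assumes "1 \<le> j" "j \<le> n" "i < n" "rho (Suc (Suc i)) j + rho (Suc i) (j - 1) < x + rho (Suc i) j"
  shows "W_perm r i j x = x"
proof -
  have "rho (Suc i) j \<le> rho (Suc (Suc i)) j" "rho (Suc i) j \<le> rho (Suc i) (j - 1)"
    using rho_mono[of "Suc i" j] rho_anti[of "Suc i" "j - 1"] assms by auto
  thus ?thesis using assms by (auto simp: W_perm_bs bs_def)
qed

lemma wcol_fixed: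
  assumes "1 \<le> j" "j \<le> n" "m \<le> n" "rho (Suc m) (j - 1) < x"
  shows "wcol j m x = x"
  using assms(3,4)
proof (induction m)
  case (Suc m)
  obtain k where j: "j = Suc k" using assms by (cases j) auto
  have "W_perm r m j x = x"
    using rho_super[of "Suc m" k] Suc.prems assms(2) by (intro W_perm_fixed_high) (auto simp: j)
  moreover have "rho (Suc m) (j - 1) < x" using rho_mono[of "Suc m" "j - 1"] Suc.prems by simp
  ultimately show ?case using Suc by (simp add: wcol_Suc)
qed simp

text \<open>At most one factor moves the point, namely \<open>W_perm r (a - 1) j\<close>, whose
  lower block contains it; afterwards it lies beyond the reach of the remaining factors.\<close>

lemma wcol_zone:
  assumes "1 \<le> j" "j \<le> n" "m \<le> n" "a \<le> m" "rho a j < x" "x \<le> rho (Suc a) j"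
  shows "wcol j m x = x + rho a (j - 1) - rho a j"
  using assms(3,4)
proof (induction m)
  case (Suc m)
  have le: "rho (Suc m) j \<le> rho (Suc (Suc m)) j" "rho (Suc m) j \<le> rho (Suc m) (j - 1)"
    using rho_mono[of "Suc m" j] rho_anti[of "Suc m" "j - 1"] assms by auto
  show ?case
  proof (cases "a = Suc m")
    case True
    have W: "W_perm r m j x = x + rho a (j - 1) - rho a j"
      using True assms le Suc.prems by (auto simp: W_perm_bs bs_def)
    have "rho (Suc m) (j - 1) < W_perm r m j x" using W le assms(5) True by simp
    hence "wcol j m (W_perm r m j x) = W_perm r m j x" using Suc.prems assms by (intro wcol_fixed) auto
    thus ?thesis using W by (simp add: wcol_Suc)
  next
    case False
    have "x \<le> rho (Suc m) j" using rho_mono'[of "Suc a" "Suc m" j] False Suc.prems assms by simp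
    hence "W_perm r m j x = x" using Suc.prems assms by (simp add: W_perm_bs bs_def)
    thus ?thesis using Suc False by (simp add: wcol_Suc)
  qed
qed simp

text \<open>Factors with \<open>i \<ge> a\<close> find the point in their upper block, which is long
  enough by \<open>rho_super'\<close>, and move it down past the lower block. Factors with
  \<open>i < a\<close> do not reach it.\<close>

lemma wcol_entering:
  assumes "1 \<le> j" "j \<le> n" "m \<le> n" "a \<le> m"
    and "rho a (j - 1) < t + rho a j" "t + rho (Suc a) j \<le> rho (Suc a) (j - 1)" "1 \<le> t"
  shows "wcol j m (rho (Suc m) j + t) = rho (Suc a) j + t"
  using assms(3,4)
proof (induction m)
  case (Suc m)
  obtain k where j: "j = Suc k" using assms by (cases j) auto
  have le: "rho (Suc m) j \<le> rho (Suc (Suc m)) j" "rho (Suc m) j \<le> rho (Suc m) (j - 1)"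
    using rho_mono[of "Suc m" j] rho_anti[of "Suc m" "j - 1"] assms by auto
  show ?case
  proof (cases "a = Suc m")
    case True
    have "W_perm r m j (rho (Suc (Suc m)) j + t) = rho (Suc (Suc m)) j + t"
      using assms Suc.prems le True by (intro W_perm_fixed_high) auto
    moreover have "wcol j m (rho (Suc (Suc m)) j + t) = rho (Suc (Suc m)) j + t"
      using assms Suc.prems le True by (intro wcol_fixed) auto
    ultimately show ?thesis using True by (simp add: wcol_Suc)
  next
    case False
    have "rho (Suc m) j + rho (Suc a) (j - 1) \<le> rho (Suc a) j + rho (Suc m) (j - 1)"
      using rho_super'[of "Suc a" "Suc m" k] False Suc.prems by (simp add: j)
    hence "W_perm r m j (rho (Suc (Suc m)) j + t) = rho (Suc m) j + t"
      using assms Suc.prems le by (auto simp: W_perm_bs bs_def)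
    thus ?thesis using Suc False by (simp add: wcol_Suc)
  qed
qed (use assms in simp)

text \<open>The shifts \<open>rho a (j - 1) - rho a j\<close> of successive columns telescope, and
  \<open>rho_super\<close> keeps the point inside zone \<open>a\<close>.\<close>

lemma zpart_zone:
  "k \<le> n \<Longrightarrow> a \<le> n \<Longrightarrow> rho a k < x \<Longrightarrow> x \<le> rho (Suc a) k \<Longrightarrow> zpart k x = x + rho a 0 - rho a k"
proof (induction k arbitrary: x)
  case (Suc k)
  have w: "wcol (Suc k) n x = x + rho a k - rho a (Suc k)"
    using wcol_zone[of "Suc k" n a x] Suc.prems by simp
  have "zpart k (wcol (Suc k) n x) = wcol (Suc k) n x + rho a 0 - rho a k"
    by (rule Suc.IH) (use Suc.prems w rho_super[of a k] rho_anti[of a k] in auto)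
  thus ?case using w Suc.prems by (simp add: zpart_Suc)
qed simp

lemma zpart_high: "k \<le> l \<Longrightarrow> l \<le> n \<Longrightarrow> tsum k < x \<Longrightarrow> zpart l x = zpart k x"
proof (induction l rule: dec_induct)
  case (step l)
  have "rho (Suc n) l < x" using tsum_antimono[of k l] step by (simp add: rho_tsum)
  hence "wcol (Suc l) n x = x" using step by (intro wcol_fixed) auto
  thus ?case using step by (simp add: zpart_Suc)
qed simp

text \<open>Position \<open>t\<close> of the block of \<open>e k\<close> positions that starts after \<open>tsum (Suc k)\<close> is sent into the
  value block number \<open>a\<close>.\<close>

definition zone :: "nat \<Rightarrow> nat \<Rightarrow> nat \<Rightarrow> bool" where
  "zone k t a \<longleftrightarrow> k \<le> n \<and> a \<le> n \<and> 1 \<le> t \<and>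
    rho a k < t + rho a (Suc k) \<and> t + rho (Suc a) (Suc k) \<le> rho (Suc a) k"

text \<open>Read from the right, the columns beyond \<open>Suc k\<close> fix the position, column
  \<open>Suc k\<close> moves it into zone \<open>a\<close>, and the remaining columns shift that
  zone. For \<open>k = n\<close> there is no entering column, in accordance with
  \<open>rho_end\<close>.\<close>

lemma zel_zone:
  assumes "zone k t a"
  shows "zel n r (tsum (Suc k) + t) = t + rho (Suc a) (Suc k) + rho a 0 - rho a k"
proof -
  have z: "k \<le> n" "a \<le> n" "1 \<le> t" "rho a k < t + rho a (Suc k)" "t + rho (Suc a) (Suc k) \<le> rho (Suc a) k"
    using assms by (auto simp: zone_def)
  have m: "rho a (Suc k) \<le> rho (Suc a) (Suc k)" by (rule rho_mono)
  have zk: "zpart k (t + rho (Suc a) (Suc k)) = t + rho (Suc a) (Suc k) + rho a 0 - rho a k"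
    by (rule zpart_zone) (use z m in auto)
  show ?thesis
  proof (cases "k = n")
    case True
    thus ?thesis using zk by (simp add: zel_zpart rho_end)
  next
    case False
    have "wcol (Suc k) n (rho (Suc n) (Suc k) + t) = rho (Suc a) (Suc k) + t"
      by (rule wcol_entering) (use z False in auto)
    hence "zpart (Suc k) (tsum (Suc k) + t) = t + rho (Suc a) (Suc k) + rho a 0 - rho a k"
      using zk by (simp add: zpart_Suc rho_tsum add.commute)
    moreover have "zpart n (tsum (Suc k) + t) = zpart (Suc k) (tsum (Suc k) + t)"
      using zpart_high[of "Suc k" n] z False by simp
    ultimately show ?thesis by (simp add: zel_zpart)
  qed
qed

lemma zone_exists:
  assumes "k \<le> n" "1 \<le> t" "t \<le> e k"
  obtains a where "zone k t a"
proof -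
  define P where "P a \<longleftrightarrow> t + rho a (Suc k) \<le> rho a k" for a
  have "P (Suc n)" using assms tsum_Suc[of k] by (simp add: P_def rho_tsum)
  moreover have "\<not> P 0" using assms by (simp add: P_def)
  ultimately obtain a where "a \<le> n" "\<not> P a" "P (Suc a)"
    using ex_least_nat_less[of P "Suc n"] by (auto simp: less_Suc_eq_le)
  thus ?thesis using that[of a] assms by (auto simp: zone_def P_def)
qed

lemma zel_zone_bounds:
  assumes "zone k t a"
  shows "hsum a < zel n r (tsum (Suc k) + t)" "zel n r (tsum (Suc k) + t) \<le> hsum (Suc a)"
    "hsum a + rho (Suc a) (Suc k) - rho a (Suc k) < zel n r (tsum (Suc k) + t)"
    "zel n r (tsum (Suc k) + t) \<le> hsum a + (rho (Suc a) k - rho a k)"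
proof -
  have z: "rho a k < t + rho a (Suc k)" "t + rho (Suc a) (Suc k) \<le> rho (Suc a) k"
    using assms by (auto simp: zone_def)
  have m: "rho a (Suc k) \<le> rho (Suc a) (Suc k)" "rho a k \<le> rho (Suc a) k" by (rule rho_mono)+
  have s: "rho (Suc a) k + hsum a \<le> rho a k + hsum (Suc a)"
    using rho_super''[of 0 k a] by (simp add: rho_hsum del: hsum_Suc)
  show "hsum a < zel n r (tsum (Suc k) + t)" "zel n r (tsum (Suc k) + t) \<le> hsum (Suc a)"
    "hsum a + rho (Suc a) (Suc k) - rho a (Suc k) < zel n r (tsum (Suc k) + t)"
    "zel n r (tsum (Suc k) + t) \<le> hsum a + (rho (Suc a) k - rho a k)"
    using z m s unfolding zel_zone[OF assms] rho_hsum by linarith+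
qed

lemma block_exists:
  assumes "1 \<le> p" "p \<le> N"
  obtains k t where "k \<le> n" "1 \<le> t" "t \<le> e k" "p = tsum (Suc k) + t"
proof -
  define P where "P l \<longleftrightarrow> tsum l < p" for l
  have "P (Suc n)" using assms by (simp add: P_def)
  moreover have "\<not> P 0" using assms by (simp add: P_def tsum_0)
  ultimately obtain k where k: "k \<le> n" "\<not> P k" "P (Suc k)"
    using ex_least_nat_less[of P "Suc n"] by (auto simp: less_Suc_eq_le)
  show ?thesis
    by (rule that[of k "p - tsum (Suc k)"]) (use k tsum_Suc[of k] in \<open>auto simp: P_def\<close>)
qed

lemma zone_unique_order:
  assumes "zone k t a" "zone k t' a'" "t \<le> t'"
  shows "a \<le> a'"
proof (rule ccontr)
  assume "\<not> a \<le> a'"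
  hence "rho a (Suc k) + rho (Suc a') k \<le> rho (Suc a') (Suc k) + rho a k"
    by (intro rho_super') simp
  thus False using assms by (auto simp: zone_def)
qed

lemma zel_increasing_on_block:
  assumes "k \<le> n" "1 \<le> t" "t < t'" "t' \<le> e k"
  shows "zel n r (tsum (Suc k) + t) < zel n r (tsum (Suc k) + t')"
proof -
  obtain a where a: "zone k t a" using zone_exists[of k t] assms by auto
  obtain a' where a': "zone k t' a'" using zone_exists[of k t'] assms by auto
  have "a \<le> a'" using zone_unique_order[OF a a'] assms by simp
  show ?thesis
  proof (cases "a = a'")
    case True
    have "rho a k < t + rho (Suc a) (Suc k)"
      using a rho_mono[of a "Suc k"] by (auto simp: zone_def)
    thus ?thesis using a a' assms(3) unfolding zel_zone[OF a] zel_zone[OF a'] True by linarith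
  next
    case False
    hence "hsum (Suc a) \<le> hsum a'" using \<open>a \<le> a'\<close> by (intro hsum_mono) simp
    thus ?thesis using zel_zone_bounds(2)[OF a] zel_zone_bounds(1)[OF a'] by linarith
  qed
qed

text \<open>By \<open>rho_low\<close>, position block \<open>k\<close> has no values beyond value
  block \<open>Suc k\<close>. This bound is what a subword with a missing crossing violates.\<close>

lemma zel_upper:
  assumes "j \<le> n" "tsum j < p" "p \<le> N"
  shows "zel n r p \<le> hsum (Suc j)"
proof -
  obtain k t where k: "k \<le> n" "1 \<le> t" "t \<le> e k" "p = tsum (Suc k) + t"
    using block_exists assms by (metis One_nat_def Suc_leI gr_implies_not0 neq0_conv)
  obtain a where a: "zone k t a" using zone_exists k by blast
  have "Suc k \<le> j"
  proof (rule ccontr)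
    assume "\<not> Suc k \<le> j"
    hence "tsum k \<le> tsum j" by (intro tsum_antimono) simp
    thus False using assms k tsum_Suc[of k] by simp
  qed
  moreover have "a \<le> Suc k"
  proof (rule ccontr)
    assume "\<not> a \<le> Suc k"
    hence "rho a k = e k + rho a (Suc k)" using a by (intro rho_low) (auto simp: zone_def)
    thus False using a k by (auto simp: zone_def)
  qed
  ultimately have "hsum (Suc a) \<le> hsum (Suc j)" by (intro hsum_mono) simp
  thus ?thesis using zel_zone_bounds(2)[OF a] k by simp
qed

text \<open>Within value block \<open>a\<close>, a position block of larger index receives smaller
  values, by the last two bounds of \<open>zel_zone_bounds\<close>, and it also lies further to the
  left. Inside a single position block \<open>zel n r\<close> increases.\<close>

lemma inv_zel_increasing_on_block:
  assumes "a \<le> n" "hsum a < v" "v < v'" "v' \<le> hsum (Suc a)"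
  shows "inv (zel n r) v < inv (zel n r) v'"
proof (rule ccontr)
  let ?p = "inv (zel n r) v" and ?q = "inv (zel n r) v'"
  have zp: "zel n r ?p = v" "zel n r ?q = v'" using zel_permutes permutes_inverses(1) by metis+
  assume "\<not> ?p < ?q"
  moreover have "?p \<noteq> ?q" using zp assms(3) by auto
  ultimately have pq: "?q < ?p" by simp
  have "hsum (Suc a) \<le> N" using hsum_tsum[of "Suc a"] assms(1) by simp
  hence "v \<in> {1..<Suc N}" "v' \<in> {1..<Suc N}" using assms by auto
  hence "?p \<in> {1..<Suc N}" "?q \<in> {1..<Suc N}" using permutes_in_image[OF permutes_inv[OF zel_permutes]] by auto
  hence p1: "1 \<le> ?p" "?p \<le> N" and q1: "1 \<le> ?q" "?q \<le> N" by auto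
  obtain k t where k: "k \<le> n" "1 \<le> t" "t \<le> e k" "?p = tsum (Suc k) + t" using block_exists[OF p1] .
  obtain k' t' where k': "k' \<le> n" "1 \<le> t'" "t' \<le> e k'" "?q = tsum (Suc k') + t'" using block_exists[OF q1] .
  obtain b where b: "zone k t b" using zone_exists k by blast
  obtain b' where b': "zone k' t' b'" using zone_exists k' by blast
  note B = zel_zone_bounds[OF b, folded k(4), unfolded zp(1)]
  note B' = zel_zone_bounds[OF b', folded k'(4), unfolded zp(2)]
  have "hsum (Suc a) \<le> hsum b" if "a < b" using that by (intro hsum_mono) simp
  moreover have "hsum (Suc b) \<le> hsum a" if "b < a" using that by (intro hsum_mono) simp
  ultimately have ba: "b = a" using B(1,2) assms by (metis le_less_trans less_le_not_le linorder_neqE_nat order_trans less_imp_le)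
  have "hsum (Suc a) \<le> hsum b'" if "a < b'" using that by (intro hsum_mono) simp
  moreover have "hsum (Suc b') \<le> hsum a" if "b' < a" using that by (intro hsum_mono) simp
  ultimately have ba': "b' = a" using B'(1,2) assms by (metis le_less_trans less_le_not_le linorder_neqE_nat order_trans less_imp_le)
  show False
  proof (cases "k < k'")
    case True
    have "rho (Suc a) k' + rho a (Suc k) \<le> rho a k' + rho (Suc a) (Suc k)"
      using True by (intro rho_super'') simp
    moreover have "rho a k' \<le> rho (Suc a) k'" by (rule rho_mono)
    ultimately show False using B(3) B'(4) assms(3) unfolding ba ba' by linarith
  next
    case False
    have "k = k'"
    proof (rule ccontr)
      assume "k \<noteq> k'"
      hence "tsum k \<le> tsum (Suc k')" using False by (intro tsum_antimono) simp
      thus False using pq k k' tsum_Suc[of k] by simp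
    qed
    hence "t' < t" using pq k k' by simp
    thus False using zel_increasing_on_block[of k t' t] k k' \<open>k = k'\<close> zp assms(3) by simp
  qed
qed

end


section \<open>Forced crossings\<close>

lemma append_eq_append_Cons_cases:
  assumes "us @ vs = xs @ i # ys"
  obtains w where "us = xs @ i # w" "ys = w @ vs" | w where "xs = us @ w" "vs = w @ i # ys"
proof -
  from assms consider ws where "us = xs @ ws" "ws @ vs = i # ys" | ws where "xs = us @ ws" "vs = ws @ i # ys"
    by (auto simp: append_eq_append_conv2)
  thus ?thesis
  proof cases
    case 1
    show ?thesis
    proof (cases ws)
      case Nil
      thus ?thesis using 1 that(2)[of "[]"] by simp
    next
      case (Cons b w)
      thus ?thesis using 1 that(1)[of w] by simp
    qed
  next
    case 2
    thus ?thesis using that(2) by blast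
  qed
qed

section \<open>Counting large values along subwords\<close>

definition above :: "nat set \<Rightarrow> fperm \<Rightarrow> nat \<Rightarrow> nat" where
  "above P y u = card {p \<in> P. u < app y p}"

lemma above_lmul: "i \<noteq> u \<Longrightarrow> above P (lmul i y) u = above P y u"
proof -
  assume "i \<noteq> u"
  hence "u < adj i v \<longleftrightarrow> u < v" for v by (auto simp: adj_apply)
  thus ?thesis by (simp add: above_def lmul_eq app_lsw)
qed

lemma above_subwords: "y' \<in> subwords_act w y \<Longrightarrow> u \<notin> set w \<Longrightarrow> above P y' u = above P y u"
  by (induction w arbitrary: y') (auto simp: above_lmul)

context
  fixes P :: "nat set"
  assumes P: "finite P"
begin

lemma above_antimono: "u \<le> v \<Longrightarrow> above P y v \<le> above P y u"
  unfolding above_def using P by (intro card_mono) auto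

lemma above_Suc: "above P y u \<le> Suc (above P y (Suc u))"
proof -
  have "{p \<in> P. u < app y p} \<subseteq> insert (inv (app y) (Suc u)) {p \<in> P. Suc u < app y p}"
  proof
    fix p assume p: "p \<in> {p \<in> P. u < app y p}"
    show "p \<in> insert (inv (app y) (Suc u)) {p \<in> P. Suc u < app y p}"
    proof (cases "app y p = Suc u")
      case True
      hence "inv (app y) (Suc u) = p" by (metis app_inv(2))
      thus ?thesis by simp
    next
      case False
      thus ?thesis using p by auto
    qed
  qed
  hence "above P y u \<le> card (insert (inv (app y) (Suc u)) {p \<in> P. Suc u < app y p})"
    unfolding above_def using P by (intro card_mono) auto
  also have "\<dots> \<le> Suc (above P y (Suc u))"
    unfolding above_def using P by (simp add: card_insert_if)
  finally show ?thesis .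
qed

text \<open>Only the letter \<open>u\<close> changes the number of values above \<open>u\<close>.
  Letters act on values from the right end of the row: those beyond \<open>u\<close> leave the count
  at \<open>u\<close> alone, the others leave the count at \<open>Suc u\<close> alone. Raising the
  threshold between them costs at most one.\<close>

lemma above_row:
  assumes "y' \<in> subwords_act [a..<b] y"
  shows "above P y u \<le> Suc (above P y' (Suc u))"
proof (cases "a \<le> Suc u \<and> Suc u \<le> b")
  case True
  hence "[a..<b] = [a..<Suc u] @ [Suc u..<b]" using upt_split by blast
  then obtain y1 where y1: "y1 \<in> subwords_act [Suc u..<b] y" "y' \<in> subwords_act [a..<Suc u] y1"
    using assms by (auto simp: subwords_act_append)
  have "above P y u = above P y1 u" using above_subwords[OF y1(1), of u P] by simp
  moreover have "above P y' (Suc u) = above P y1 (Suc u)" using above_subwords[OF y1(2), of "Suc u" P] by simp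
  ultimately show ?thesis using above_Suc[of y1 u] by simp
next
  case False
  hence "Suc u \<notin> set [a..<b]" by auto
  thus ?thesis using above_subwords[OF assms, of "Suc u" P] above_Suc[of y u] by simp
qed

lemma above_rect:
  "y' \<in> subwords_act (rectword c k m) y \<Longrightarrow> above P y u \<le> above P y' (u + m) + m"
proof (induction m arbitrary: y')
  case (Suc m)
  obtain y1 where y1: "y1 \<in> subwords_act (rectword c k m) y"
    "y' \<in> subwords_act [Suc (c + m)..<Suc (c + m + k)] y1"
    using Suc.prems by (auto simp: subwords_act_append)
  show ?case using Suc.IH[OF y1(1)] above_row[OF y1(2), of "u + m"] by simp
qed simp

text \<open>The row lacking \<open>i\<close> does not affect the count at threshold
  \<open>i\<close>, so the threshold may be lowered to \<open>i\<close> before the row and further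
  after it. This saves the loss of one that \<open>above_row\<close> charges.\<close>

lemma above_rect_missing:
  "rectword c k m = us @ i # vs \<Longrightarrow> y' \<in> subwords_act (us @ vs) y \<Longrightarrow>
    Suc (above P y (c + k)) \<le> above P y' (c + m) + m"
proof (induction m arbitrary: us vs y')
  case (Suc m)
  let ?row = "[Suc (c + m)..<Suc (c + m + k)]"
  from Suc.prems(1) have "?row @ rectword c k m = us @ i # vs" by simp
  thus ?case
  proof (cases rule: append_eq_append_Cons_cases)
    case (1 w)
    have i: "Suc (c + m) \<le> i" "i \<le> c + m + k"
      using arg_cong[OF 1(1), of "\<lambda>xs. i \<in> set xs"] by auto
    have "distinct ?row" by simp
    hence notin: "i \<notin> set (us @ w)" unfolding 1(1) by auto
    obtain y1 where y1: "y1 \<in> subwords_act (rectword c k m) y" "y' \<in> subwords_act (us @ w) y1"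
      using Suc.prems(2) 1(2) by (auto simp: subwords_act_append)
    have "above P y (c + k) \<le> above P y1 (c + k + m) + m" by (rule above_rect[OF y1(1)])
    also have "above P y1 (c + k + m) \<le> above P y1 i" using i by (intro above_antimono) simp
    also have "above P y1 i = above P y' i" using above_subwords[OF y1(2) notin] by simp
    also have "above P y' i \<le> above P y' (c + Suc m)" using i by (intro above_antimono) simp
    finally show ?thesis by simp
  next
    case (2 w)
    obtain y1 where y1: "y1 \<in> subwords_act (w @ vs) y" "y' \<in> subwords_act ?row y1"
      using Suc.prems(2) 2(1) by (auto simp: subwords_act_append)
    show ?thesis using Suc.IH[OF 2(2) y1(1)] above_row[OF y1(2), of "c + m"] by simp
  qed
qed simp

end

text \<open>Each factor is split as \<open>1 + (t - 1) s_i\<close>. The summand 1 produces an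
  element supported on the word without that letter, whose coefficient vanishes by
  assumption.\<close>

lemma lookup_forced_crossings:
  fixes ws :: "(nat \<times> 'r::comm_ring_1) list"
  assumes "U \<in> supp u" "V \<in> supp v"
    and "\<And>us i vs (Z :: fperm \<Rightarrow>\<^sub>0 'r). map fst ws = us @ i # vs \<Longrightarrow> Z \<in> supp (u @ us @ vs @ v) \<Longrightarrow> lookup Z z = 0"
  shows "lookup (U * (prodh ws * V)) z =
    prod_list (map (\<lambda>(i, t). t - 1) ws) * lookup (U * (single (act (map fst ws) 0) 1 * V)) z"
proof -
  have "ws = xs @ ys \<Longrightarrow> lookup (U * (single (act (map fst xs) 0) 1 * (prodh ys * V))) z =
    prod_list (map (\<lambda>(i, t). t - 1) ys) * lookup (U * (single (act (map fst ws) 0) 1 * V)) z" for xs ys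
  proof (induction ys arbitrary: xs)
    case (Cons p ys)
    obtain i t where p: "p = (i, t)" by fastforce
    let ?S = "single (act (map fst xs) 0) (1::'r)"
    have "?S * single (gen i) (t - 1) = single 0 (t - 1) * single (act (map fst (xs @ [p])) 0) 1"
      by (simp add: p mult_single plus_gen)
    moreover have "U * (?S * (hh i t * (prodh ys * V))) =
      U * (?S * (prodh ys * V)) + U * ((?S * single (gen i) (t - 1)) * (prodh ys * V))"
      unfolding hh_def by (simp only: distrib_left distrib_right mult_1_left mult.assoc)
    moreover have "lookup (U * (?S * (prodh ys * V))) z = 0"
    proof (rule assms(3))
      show "map fst ws = map fst xs @ i # map fst ys" using Cons.prems by (simp add: p)
      show "U * (?S * (prodh ys * V)) \<in> supp (u @ map fst xs @ map fst ys @ v)"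
        by (intro supp_mult assms supp_single_act supp_prodh)
    qed
    moreover have "U * (single 0 (t - 1) * W) = single 0 (t - 1) * (U * W)" for W
    proof -
      have "U * single 0 (t - 1) = single 0 (t - 1) * U"
        by (induction U rule: poly_mapping_single_induct) (auto simp: mult_single distrib_left distrib_right mult.commute)
      thus ?thesis by (simp only: mult.assoc[symmetric])
    qed
    moreover have "lookup (single (0::fperm) (t - 1) * W) z = (t - 1) * lookup W z" for W
      by (induction W rule: poly_mapping_single_induct)
        (auto simp: mult_single distrib_left lookup_add lookup_single when_def)
    ultimately show ?case
      using Cons.IH[of "xs @ [p]"] Cons.prems
      by (simp only: p prodh_simps list.map prod_list.Cons mult.assoc lookup_add split_conv append.assoc append.simps) simp
  qed simp
  from this[of "[]" ws] show ?thesis by simp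
qed

text \<open>Demazure multiplication acts only at an ascent, so it never undoes an inverted pair of
  values.\<close>

lemma inverted_rmul:
  assumes "a < b" "inv (app w) b < inv (app w) a"
  shows "inv (app (rmul i w)) b < inv (app (rmul i w)) a"
proof (cases "rdesc i w")
  case False
  have "inv (app w) a \<noteq> inv (app w) b" using assms by simp
  moreover have "\<not> (inv (app w) b = i \<and> inv (app w) a = Suc i)"
  proof
    assume *: "inv (app w) b = i \<and> inv (app w) a = Suc i"
    hence "app w i = b" "app w (Suc i) = a" by (metis app_inv(1))+
    thus False using False assms(1) by (simp add: rdesc_def)
  qed
  moreover have "inv (app (rsw i w)) = adj i \<circ> inv (app w)" by (simp add: app_rsw inv_comp_adj bij_app)
  ultimately show ?thesis using False assms(2)
    by (simp add: rmul_eq adj_less_iff)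
qed (simp add: rmul_eq assms)

lemma inverted_plus:
  assumes "a < b" "inv (app w) b < inv (app w) a"
  shows "inv (app (w + v)) b < inv (app (w + v)) a"
proof -
  obtain xs where v: "v = act xs 0" using act_surj by metis
  have "inv (app (act xs w)) b < inv (app (act xs w)) a"
    using assms by (induction xs arbitrary: w) (auto simp: inverted_rmul)
  thus ?thesis by (simp add: v plus_act)
qed

lemma lookup_inverted:
  assumes "a < b" "inv (app w) b < inv (app w) a" "inv (app z) a < inv (app z) b"
  shows "lookup (single w c * Y) z = (0 :: 'r::comm_ring_1)"
proof (rule ccontr)
  assume "lookup (single w c * Y) z \<noteq> 0"
  hence "z \<in> keys (single w c * Y)" by (simp add: in_keys_iff)
  then obtain v where "z = w + v" using Poly_Mapping.keys_mult[of "single w c" Y] by (auto split: if_splits)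
  thus False using inverted_plus[OF assms(1,2), of v] assms(3) by simp
qed

text \<open>Behind \<open>w\<close>, the generator in \<open>hh i t\<close> would invert a pair of
  values that later factors cannot restore, whereas \<open>z\<close> has this pair in order. Only
  the summand 1 survives.\<close>

lemma lookup_drop_prodh:
  fixes Y :: "fperm \<Rightarrow>\<^sub>0 'r::comm_ring_1"
  assumes "\<And>i. i \<in> fst ` set ws \<Longrightarrow> app w i < app w (Suc i) \<and> inv (app z) (app w i) < inv (app z) (app w (Suc i))"
  shows "lookup (single w 1 * (prodh ws * Y)) z = lookup (single w 1 * Y) z"
  using assms
proof (induction ws)
  case (Cons p ws)
  obtain i t where p: "p = (i, t)" by fastforce
  have i: "app w i < app w (Suc i)" "inv (app z) (app w i) < inv (app z) (app w (Suc i))"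
    using Cons.prems[of i] by (auto simp: p)
  have rm: "rmul i w = rsw i w" using i(1) by (simp add: rmul_eq rdesc_def)
  have "single w 1 * (prodh (p # ws) * Y) =
    single w 1 * (prodh ws * Y) + single (rsw i w) (t - 1) * (prodh ws * Y)"
    by (simp only: p prodh_simps hh_def distrib_left distrib_right mult_1_left mult.assoc)
      (simp only: mult.assoc[symmetric] mult_single plus_gen rm mult_1_left)
  moreover have "lookup (single (rsw i w) (t - 1) * (prodh ws * Y)) z = 0"
  proof (rule lookup_inverted[where a = "app w i" and b = "app w (Suc i)"])
    have "inv (app (rsw i w)) = adj i \<circ> inv (app w)" by (simp add: app_rsw inv_comp_adj bij_app)
    thus "inv (app (rsw i w)) (app w (Suc i)) < inv (app (rsw i w)) (app w i)" by (simp add: adj_apply)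
  qed (use i in auto)
  ultimately show ?case using Cons by (simp add: lookup_add)
qed simp

context ranks
begin

definition rword :: "nat \<Rightarrow> nat list" where
  "rword j = rectword 0 (e j) (e (j - 1))"

definition dword :: "nat \<Rightarrow> nat list" where
  "dword j = rectword (e j) (tsum (Suc j)) (e (j - 1))"

text \<open>For \<open>j = n\<close> this is the identity, as \<open>tsum (Suc n) = 0\<close>;
  products can thus run uniformly over \<open>1..n\<close> although the statement stops at
  \<open>delta_(n-1)\<close>.\<close>

definition dl :: "nat \<Rightarrow> fperm" where
  "dl j = Abs_fperm (bs (e j) (tsum (Suc j)) (e (j - 1)))"

lemma act_dword: "act (dword j) 0 = dl j"
  by (simp add: dword_def dl_def act_rectword)

lemma app_dl: "app (dl j) = bs (e j) (tsum (Suc j)) (e (j - 1))"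
  by (simp add: dl_def app_bs)

lemma delta_perm_bs:
  assumes "1 \<le> j" "j < n"
  shows "delta_perm n r j = bs (e j) (tsum (Suc j)) (e (j - 1))"
proof
  fix p
  have "rk r n j = tsum j" "rk r n (j - 1) = tsum (j - 1)" "rk r n (j + 1) = tsum (Suc j)"
    using assms by (auto simp: rk_def tsum_def)
  moreover have "tsum j = e j + tsum (Suc j)" "tsum (j - 1) = e (j - 1) + tsum j"
    using tsum_Suc[of j] tsum_Suc[of "j - 1"] assms by auto
  ultimately show "delta_perm n r j p = bs (e j) (tsum (Suc j)) (e (j - 1)) p"
    unfolding delta_perm_def bs_def by auto
qed

lemma letters_rword: "set (rword j) \<subseteq> {1..<e j + e (j - 1)}"
  using set_rectword[of 0 "e j" "e (j - 1)"] by (fastforce simp: rword_def)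

lemma tsum_pred: "1 \<le> j \<Longrightarrow> j \<le> n \<Longrightarrow> tsum (j - 1) = e (j - 1) + (e j + tsum (Suc j))"
  using tsum_Suc[of "j - 1"] tsum_Suc[of j] by simp

lemma letters_dword: "1 \<le> j \<Longrightarrow> j \<le> n \<Longrightarrow> set (dword j) \<subseteq> {e j<..<tsum (j - 1)}"
  using set_rectword[of "e j" "tsum (Suc j)" "e (j - 1)"] tsum_pred[of j]
  by (fastforce simp: dword_def)

definition wd :: "nat \<Rightarrow> nat list" where
  "wd j = rword j @ dword j"

lemma letters_wd: "1 \<le> j \<Longrightarrow> j \<le> n \<Longrightarrow> set (wd j) \<subseteq> {1..<tsum (j - 1)}"
  using letters_rword[of j] letters_dword[of j] tsum_pred[of j] by (fastforce simp: wd_def)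

definition wds :: "nat \<Rightarrow> nat \<Rightarrow> nat list" where
  "wds a b = concat (map wd [a..<b])"

lemma wds_Suc: "a \<le> b \<Longrightarrow> wds a (Suc b) = wds a b @ wd b"
  by (simp add: wds_def upt_Suc)

lemma wds_Cons: "a < b \<Longrightarrow> wds a b = wd a @ wds (Suc a) b"
  by (simp add: wds_def upt_conv_Cons)

lemma wds_empty [simp]: "wds a a = []"
  by (simp add: wds_def)

lemma letters_wds: "1 \<le> a \<Longrightarrow> b \<le> Suc n \<Longrightarrow> set (wds a b) \<subseteq> {1..<tsum (a - 1)}"
proof
  fix x assume ab: "1 \<le> a" "b \<le> Suc n" and "x \<in> set (wds a b)"
  then obtain j where j: "a \<le> j" "j < b" "x \<in> set (wd j)" by (auto simp: wds_def)
  hence "x \<in> {1..<tsum (j - 1)}" using letters_wd[of j] ab by auto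
  moreover have "tsum (j - 1) \<le> tsum (a - 1)" using j by (intro tsum_antimono) simp
  ultimately show "x \<in> {1..<tsum (a - 1)}" by auto
qed

text \<open>Follow the \<open>hsum j\<close> positions beyond \<open>tsum j\<close>, whose values
  all start above \<open>tsum j\<close>. The rectangle letters avoid the thresholds, and the words
  \<open>dword j\<close>, ..., \<open>dword 1\<close> cost \<open>e (j - 1)\<close>, ...,
  \<open>e 0\<close>, altogether \<open>hsum j\<close>. A missing crossing saves one, so some
  position ends above the last threshold.\<close>

lemma missing_crossing:
  assumes j: "1 \<le> j" "j \<le> n" and d: "dword j = us @ i # vs"
    and y: "y \<in> subwords_act (wds 1 j @ rword j @ us @ vs @ wds (Suc j) (Suc n)) 0"
  shows "\<exists>p. tsum j < p \<and> p \<le> N \<and> hsum (Suc j) < app y p"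
proof -
  define P where "P = {tsum j<..N}"
  have P: "finite P" by (simp add: P_def)
  have N: "N = hsum j + tsum j" using hsum_tsum[of j] j by simp
  from y obtain y1 y2 y3 where y1: "y1 \<in> subwords_act (wds (Suc j) (Suc n)) 0"
    and y2: "y2 \<in> subwords_act (us @ vs) y1" and y3: "y3 \<in> subwords_act (rword j) y2"
    and y4: "y \<in> subwords_act (wds 1 j) y3"
    unfolding subwords_act_append[of "wds 1 j"] subwords_act_append[of "rword j"]
      append.assoc[of us vs, symmetric] subwords_act_append[of "us @ vs"] by blast
  have "above P 0 (tsum j) = hsum j"
  proof -
    have "{p \<in> P. tsum j < app 0 p} = P" by (auto simp: P_def zero_fperm.rep_eq)
    thus ?thesis by (simp add: above_def P_def N)
  qed
  moreover have "above P y1 (tsum j) = above P 0 (tsum j)"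
    by (rule above_subwords[OF y1]) (use letters_wds[of "Suc j" "Suc n"] in auto)
  moreover have "Suc (above P y1 (e j + tsum (Suc j))) \<le> above P y2 (e j + e (j - 1)) + e (j - 1)"
    by (rule above_rect_missing[OF P d[unfolded dword_def] y2])
  moreover have "above P y3 (e j + e (j - 1)) = above P y2 (e j + e (j - 1))"
    by (rule above_subwords[OF y3]) (use letters_rword[of j] in auto)
  moreover have "hsum j = hsum (j - 1) + e (j - 1)" using j hsum_Suc[of "j - 1"] by simp
  ultimately have start: "Suc (hsum (j - 1)) \<le> above P y3 (e j + e (j - 1))"
    using tsum_Suc[of j] j by simp
  \<comment> \<open>With the words of steps \<open>1..l\<close> still to come, the threshold is
    \<open>e l + ... + e j\<close> and more than \<open>hsum l\<close> positions lie above it; the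
    induction descends to \<open>l = 0\<close>.\<close>
  have "l < j \<Longrightarrow> y' \<in> subwords_act (wds (Suc l) j) y3 \<Longrightarrow> Suc (hsum l) \<le> above P y' (hsum (Suc j) - hsum l)" for l y'
  proof (induction "j - l" arbitrary: l y')
    case (Suc m)
    show ?case
    proof (cases "Suc l = j")
      case True
      have "hsum (Suc j) - hsum l = e j + e (j - 1)" using True by auto
      thus ?thesis using start Suc.prems True by auto
    next
      case False
      hence l: "Suc l < j" using Suc.prems by simp
      have w: "wds (Suc l) j = rword (Suc l) @ dword (Suc l) @ wds (Suc (Suc l)) j"
        using wds_Cons[of "Suc l" j] l by (simp add: wd_def)
      obtain u1 u2 where u1: "u1 \<in> subwords_act (wds (Suc (Suc l)) j) y3"
        and u2: "u2 \<in> subwords_act (dword (Suc l)) u1" and u3: "y' \<in> subwords_act (rword (Suc l)) u2"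
        using Suc.prems(2) unfolding w subwords_act_append[of "rword _"] subwords_act_append[of "dword _"] by blast
      have "Suc (hsum (Suc l)) \<le> above P u1 (hsum (Suc j) - hsum (Suc l))"
        using Suc.hyps(1)[of "Suc l" u1] Suc.hyps(2) l u1 by simp
      also have "\<dots> \<le> above P u2 (hsum (Suc j) - hsum (Suc l) + e l) + e l"
        using above_rect[OF P u2[unfolded dword_def]] by simp
      also have "hsum (Suc j) - hsum (Suc l) + e l = hsum (Suc j) - hsum l"
        using hsum_mono[of "Suc l" "Suc j"] l by simp
      also have "above P u2 (hsum (Suc j) - hsum l) = above P y' (hsum (Suc j) - hsum l)"
      proof (rule above_subwords[OF u3, symmetric])
        have "hsum (Suc (Suc l)) \<le> hsum (Suc j)" using l by (intro hsum_mono) simp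
        thus "hsum (Suc j) - hsum l \<notin> set (rword (Suc l))" using letters_rword[of "Suc l"] by (auto dest!: subsetD)
      qed
      finally show ?thesis by simp
    qed
  qed simp
  from this[of 0 y] have "1 \<le> above P y (hsum (Suc j))" using y4 j by simp
  hence "{p \<in> P. hsum (Suc j) < app y p} \<noteq> {}" unfolding above_def by (metis card.empty not_one_le_zero)
  thus ?thesis by (auto simp: P_def)
qed

lemma lookup_missing_crossing:
  fixes Z :: "fperm \<Rightarrow>\<^sub>0 'r::comm_ring_1"
  assumes "1 \<le> j" "j \<le> n" "dword j = us @ i # vs"
    and Z: "Z \<in> supp ((wds 1 j @ rword j) @ us @ vs @ wds (Suc j) (Suc n))"
    and z: "app z = zel n r"
  shows "lookup Z z = 0"
proof (rule ccontr)
  assume "lookup Z z \<noteq> 0"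
  hence "z \<in> subwords_act (wds 1 j @ rword j @ us @ vs @ wds (Suc j) (Suc n)) 0"
    using keys_supp[OF Z] by (auto simp: in_keys_iff)
  from missing_crossing[OF assms(1-3) this] obtain p where "tsum j < p" "p \<le> N" "hsum (Suc j) < zel n r p"
    unfolding z by blast
  thus False using zel_upper[of j p] assms by simp
qed

subsection \<open>The product of the forced crossings\<close>

primrec dcomp :: "nat \<Rightarrow> fperm" where
  "dcomp 0 = 0"
| "dcomp (Suc k) = dcomp k + dl (Suc k)"

text \<open>\<open>dcomp k\<close> increases on all places that the next block swap touches, so
  their product is a composition. The swap itself is increasing on the first
  \<open>tsum (Suc k)\<close> places, which carries the property on.\<close>

lemma dcomp_props:
  "k \<le> n \<Longrightarrow> strict_mono_on {1..tsum k} (app (dcomp k))"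
  "Suc k \<le> n \<Longrightarrow> app (dcomp (Suc k)) = app (dcomp k) \<circ> bs (e (Suc k)) (tsum (Suc (Suc k))) (e k)"
proof -
  have step: "app (dcomp (Suc k)) = app (dcomp k) \<circ> bs (e (Suc k)) (tsum (Suc (Suc k))) (e k)"
    if "Suc k \<le> n" "strict_mono_on {1..tsum k} (app (dcomp k))" for k
  proof -
    have "dcomp (Suc k) = act (dword (Suc k)) (dcomp k)" by (simp add: act_dword[symmetric] plus_act)
    moreover have "app (act (dword (Suc k)) (dcomp k)) = app (dcomp k) \<circ> word_perm (dword (Suc k))"
    proof (rule act_increasing[OF _ _ that(2)])
      show "set (dword (Suc k)) \<subseteq> {1..<tsum k}" using letters_dword[of "Suc k"] that(1) by fastforce
    qed (simp add: dword_def word_perm_rectword perm_length_bs)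
    ultimately show ?thesis by (simp add: dword_def word_perm_rectword)
  qed
  have mono: "k \<le> n \<Longrightarrow> strict_mono_on {1..tsum k} (app (dcomp k))" for k
  proof (induction k)
    case 0 show ?case by (simp add: zero_fperm.rep_eq strict_mono_on_def)
  next
    case (Suc k)
    hence IH: "strict_mono_on {1..tsum k} (app (dcomp k))" by simp
    have t: "tsum k = e k + (e (Suc k) + tsum (Suc (Suc k)))" "tsum (Suc k) = e (Suc k) + tsum (Suc (Suc k))"
      using tsum_pred[of "Suc k"] tsum_Suc[of "Suc k"] Suc.prems by auto
    show ?case unfolding step[OF Suc.prems IH]
      by (rule strict_mono_onI, unfold comp_apply, rule strict_mono_onD[OF IH]) (auto simp: bs_def t)
  qed
  show "k \<le> n \<Longrightarrow> strict_mono_on {1..tsum k} (app (dcomp k))" by (rule mono)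
  show "Suc k \<le> n \<Longrightarrow> app (dcomp (Suc k)) = app (dcomp k) \<circ> bs (e (Suc k)) (tsum (Suc (Suc k))) (e k)"
    using step mono by simp
qed

lemma dcomp_high: "k \<le> l \<Longrightarrow> l \<le> n \<Longrightarrow> tsum k < q \<Longrightarrow> app (dcomp l) q = app (dcomp k) q"
proof (induction l rule: dec_induct)
  case (step l)
  have "bs (e (Suc l)) (tsum (Suc (Suc l))) (e l) q = q"
    using tsum_antimono[of k l] step tsum_pred[of "Suc l"] by (auto simp: bs_def)
  thus ?case using step dcomp_props(2)[of l] by simp
qed simp

lemma inv_dcomp_high:
  assumes "k \<le> n" "tsum k < q"
  shows "inv (app (dcomp n)) (app (dcomp k) q) = q"
  using dcomp_high[OF assms(1) order_refl assms(2)] by (metis app_inv(2))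

lemma inv_dcomp_low:
  assumes "k \<le> n" "q \<le> tsum k"
  shows "inv (app (dcomp n)) (app (dcomp k) q) \<le> tsum k"
proof (rule ccontr)
  let ?p = "inv (app (dcomp n)) (app (dcomp k) q)"
  assume p: "\<not> ?p \<le> tsum k"
  hence "app (dcomp k) ?p = app (dcomp n) ?p" using dcomp_high[of k n ?p] assms(1) by simp
  also have "\<dots> = app (dcomp k) q" by simp
  finally show False using p assms(2) by (simp add: app_eq_iff)
qed

text \<open>For \<open>k < n\<close> these are the places on which \<open>rword (Suc k)\<close>
  acts. The next swap leaves the first \<open>e (Suc k)\<close> of them to the induction and sends
  the others beyond \<open>tsum (Suc k)\<close>, where by \<open>inv_dcomp_high\<close> they stay in
  order.\<close>

lemma inv_dcomp_increasing:
  "k \<le> n \<Longrightarrow> x < y \<Longrightarrow> y \<le> e k + (if k < n then e (Suc k) else 0) \<Longrightarrow>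
    inv (app (dcomp n)) (app (dcomp k) x) < inv (app (dcomp n)) (app (dcomp k) y)"
proof (induction "n - k" arbitrary: k x y)
  case 0
  hence "k = n" by simp
  thus ?case using 0 by simp
next
  case (Suc m)
  hence k: "Suc k \<le> n" by simp
  define b where "b = bs (e (Suc k)) (e k) (tsum (Suc (Suc k)))"
  have b: "app (dcomp k) q = app (dcomp (Suc k)) (b q)" for q
    using dcomp_props(2)[OF k] by (simp add: b_def bs_inverse)
  have y: "y \<le> e k + e (Suc k)" using Suc.prems k by simp
  have t: "tsum (Suc k) = e (Suc k) + tsum (Suc (Suc k))" using tsum_Suc[of "Suc k"] k by simp
  show ?case
  proof (cases "y \<le> e (Suc k)")
    case True
    hence "b x = x" "b y = y" using Suc.prems by (auto simp: b_def bs_def)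
    thus ?thesis unfolding b using Suc.hyps(1)[of "Suc k" x y] Suc.hyps(2) Suc.prems True k by simp
  next
    case False
    hence by': "b y = y + tsum (Suc (Suc k))" using y by (simp add: b_def bs_def)
    hence iy: "inv (app (dcomp n)) (app (dcomp (Suc k)) (b y)) = b y"
      using inv_dcomp_high[of "Suc k" "b y"] k False t by simp
    show ?thesis
    proof (cases "x \<le> e (Suc k)")
      case True
      hence "b x = x" by (simp add: b_def bs_def)
      thus ?thesis unfolding b iy using inv_dcomp_low[of "Suc k" x] k True by' False t by simp
    next
      case x: False
      hence bx: "b x = x + tsum (Suc (Suc k))" using y Suc.prems by (simp add: b_def bs_def)
      hence "inv (app (dcomp n)) (app (dcomp (Suc k)) (b x)) = b x"
        using inv_dcomp_high[of "Suc k" "b x"] k x t by simp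
      thus ?thesis unfolding b iy using bx by' Suc.prems by simp
    qed
  qed
qed

text \<open>For \<open>i < j\<close> one of the two swapped blocks is empty. The factors with
  \<open>i \<ge> j\<close> remain, and by \<open>bs_compose\<close> they build up the block swap of
  step \<open>j\<close>.\<close>

lemma zel_flat:
  assumes flat: "\<And>i j. i < j \<Longrightarrow> j \<le> n \<Longrightarrow> r i j = min (r i (j - 1)) (r (i + 1) j)"
  shows "zel n r = app (dcomp n)"
proof -
  have W_id: "W_perm r i j = id" if "1 \<le> j" "j \<le> n" "i < j" "i < n" for i j
  proof -
    have "rho (Suc i) j = r i j" "rho (Suc (Suc i)) j = r (i + 1) j" "rho (Suc i) (j - 1) = r i (j - 1)"
      using that by (cases "j = Suc i"; auto simp: rho_def rk_def)+
    hence "rho (Suc (Suc i)) j - rho (Suc i) j = 0 \<or> rho (Suc i) (j - 1) - rho (Suc i) j = 0"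
      using flat[of i j] that by (auto simp: min_def)
    thus ?thesis using that by (auto simp: W_perm_bs)
  qed
  have low: "wcol j m = id" if "1 \<le> j" "j \<le> n" "m \<le> j" "m \<le> n" for j m
    using that by (induction m) (auto simp: wcol_Suc W_id)
  have wcol: "j \<le> m \<Longrightarrow> m \<le> n \<Longrightarrow> wcol j m = bs (e j) (sum e {Suc j..m}) (e (j - 1))" if "1 \<le> j" "j \<le> n" for j m
  proof (induction m rule: dec_induct)
    case base
    show ?case using low[of j j] that by simp
  next
    case (step m)
    have "W_perm r m j = bs (e j + sum e {Suc j..m}) (e (Suc m)) (e (j - 1))"
    proof -
      have "rho (Suc m) j = e j + sum e {Suc j..m}" "rho (Suc (Suc m)) j = e j + sum e {Suc j..m} + e (Suc m)"
        using that step by (auto simp: rho_def rk_def sum.atLeast_Suc_atMost)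
      moreover have "rho (Suc m) (j - 1) = e (j - 1) + (e j + sum e {Suc j..m})"
        using that step sum.atLeast_Suc_atMost[of "j - 1" m e] sum.atLeast_Suc_atMost[of j m e]
        by (auto simp: rho_def rk_def)
      ultimately show ?thesis using that step by (simp add: W_perm_bs)
    qed
    thus ?case using step by (simp add: wcol_Suc bs_compose)
  qed
  have "k \<le> n \<Longrightarrow> zpart k = app (dcomp k)" for k
  proof (induction k)
    case (Suc k)
    thus ?case using wcol[of "Suc k" n] dcomp_props(2)[of k] by (simp add: zpart_Suc tsum_def)
  qed (simp add: zero_fperm.rep_eq)
  thus ?thesis by (simp add: zel_zpart)
qed

end


section \<open>Block rearrangements of the variables\<close>

lemma run_wts_row:
  "run [Suc (length pre)..<Suc (length pre + length xs)] (pre @ y # xs @ post) = pre @ xs @ y # post \<and>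
   (\<forall>(i, t) \<in> set (wts [Suc (length pre)..<Suc (length pre + length xs)] (pre @ y # xs @ post)).
      \<exists>x\<in>set xs. t = fst y * snd x)"
proof (induction xs arbitrary: pre)
  case (Cons x xs)
  let ?c = "length pre"
  have w: "[Suc ?c..<Suc (?c + length (x # xs))] =
    Suc ?c # [Suc (length (pre @ [x]))..<Suc (length (pre @ [x]) + length xs)]"
    by (simp add: upt_conv_Cons)
  have "swapl (Suc ?c) (pre @ y # (x # xs) @ post) = (pre @ [x]) @ y # xs @ post"
    using swapl_append[of pre y x "xs @ post"] by simp
  moreover have "(pre @ y # (x # xs) @ post) ! ?c = y" "(pre @ y # (x # xs) @ post) ! Suc ?c = x"
    by (simp_all add: nth_append)
  ultimately show ?case using Cons.IH[of "pre @ [x]"] unfolding w by auto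
qed simp

lemma run_wts_rectword:
  "run (rectword (length pre) (length xs) (length ys)) (pre @ ys @ xs @ post) = pre @ xs @ ys @ post \<and>
   (\<forall>(i, t) \<in> set (wts (rectword (length pre) (length xs) (length ys)) (pre @ ys @ xs @ post)).
      \<exists>y\<in>set ys. \<exists>x\<in>set xs. t = fst y * snd x)"
proof (induction ys arbitrary: post rule: rev_induct)
  case (snoc y ys)
  from run_wts_row[of "pre @ ys" xs y post] snoc[of "y # post"]
  show ?case by (auto simp: run_append wts_append add.assoc)
qed simp

lemma run_local:
  "set is \<subseteq> {1..<length xs} \<Longrightarrow> run is (xs @ ys) = run is xs @ ys \<and> wts is (xs @ ys) = wts is xs"
proof (induction "is" arbitrary: xs)
  case (Cons i "is")
  have "swapl i (xs @ ys) = swapl i xs @ ys"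
    using Cons.prems by (auto simp: swapl_def nth_append list_update_append)
  thus ?case using Cons.IH[of "swapl i xs"] Cons.prems by (auto simp: nth_append)
qed simp

lemma run_rev_exists:
  fixes pre xs post :: "('r::comm_ring_1 \<times> 'r) list"
  shows "\<exists>is. set is \<subseteq> {length pre<..<length pre + length xs} \<and> run is (pre @ xs @ post) = pre @ rev xs @ post"
proof (induction xs arbitrary: post)
  case Nil
  show ?case by (intro exI[of _ "[]"]) simp
next
  case (Cons x xs)
  obtain "is" where "is": "set is \<subseteq> {length pre<..<length pre + length xs}"
    "run is (pre @ xs @ x # post) = pre @ rev xs @ x # post" using Cons by blast
  let ?row = "[Suc (length pre)..<Suc (length pre + length xs)]"
  have "run (?row @ is) (pre @ (x # xs) @ post) = pre @ rev (x # xs) @ post"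
    using run_wts_row[of pre xs x post] "is"(2) by (simp add: run_append)
  moreover have "set (?row @ is) \<subseteq> {length pre<..<length pre + length (x # xs)}" using "is"(1) by auto
  ultimately show ?case by blast
qed

text \<open>Since \<open>hh i 1 = 1\<close>, entries equal to 1 keep the runs of \<open>xs\<close>
  at full length without adding factors. This explains the trailing ones in the statement.\<close>

lemma phi_append_ones:
  fixes xs ys :: "('r::comm_ring_1 \<times> 'r) list"
  shows "prodh (phi c (xs @ ys)) = prodh (phi c (xs @ replicate (length ys) (1, 1))) * prodh (phi (c + length xs) ys)"
proof (induction xs arbitrary: c)
  case Nil
  have acol: "prodh (acol c k (1::'r)) = 1" for c k by (induction k arbitrary: c) auto
  have "prodh (phi c (replicate k (1::'r, 1))) = 1" for c k
    by (induction k arbitrary: c) (auto simp: acol)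
  thus ?case by simp
next
  case (Cons x xs)
  show ?case using Cons[of "Suc c"] by (simp add: mult.assoc)
qed

text \<open>\<open>d\<close> carries neighbours to neighbours in the same order, so both products
  multiply at an ascent and the ordinary conjugation rule applies.\<close>

lemma gen_conj:
  assumes "app d i = j" "app d (Suc i) = Suc j"
  shows "gen j + d = d + gen i"
proof -
  have inv: "inv (app d) j = i" "inv (app d) (Suc j) = Suc i" using assms by (metis app_inv(2))+
  have "lsw j d = rsw i d"
  proof -
    have "adj j (app d x) = app d (adj i x)" for x
      using assms app_eq_iff[of d x i] app_eq_iff[of d x "Suc i"] by (auto simp: adj_apply)
    thus ?thesis by (simp add: app_inject[symmetric] app_lsw app_rsw fun_eq_iff)
  qed
  thus ?thesis using assms inv by (simp add: gen_plus plus_gen lmul_eq rmul_eq ldesc_def rdesc_def)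
qed

lemma hh_conj: "gen j + d = d + gen i \<Longrightarrow> hh j t * single d 1 = single d 1 * hh i t"
  by (simp add: hh_def distrib_left distrib_right mult_single)

lemma prodh_conj:
  assumes "\<And>i. i \<in> fst ` set ws \<Longrightarrow> \<forall>t. hh (f i) t * Z = Z * hh i t"
  shows "prodh (map (\<lambda>(i, t). (f i, t)) ws) * Z = Z * prodh ws"
  using assms
proof (induction ws)
  case (Cons p ws)
  obtain i t where p: "p = (i, t)" by fastforce
  have IH: "prodh (map (\<lambda>(i, t). (f i, t)) ws) * Z = Z * prodh ws" using Cons by simp
  have h: "hh (f i) t * Z = Z * hh i t" using Cons.prems[of i] by (simp add: p)
  have "prodh (map (\<lambda>(i, t). (f i, t)) (p # ws)) * Z = hh (f i) t * (prodh (map (\<lambda>(i, t). (f i, t)) ws) * Z)"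
    by (simp add: p mult.assoc)
  also have "\<dots> = (hh (f i) t * Z) * prodh ws" unfolding IH by (simp only: mult.assoc)
  also have "\<dots> = Z * prodh (p # ws)" unfolding h by (simp add: p mult.assoc)
  finally show ?case .
qed simp

lemma gen_far_act:
  "\<forall>j\<in>set xs. Suc j < i \<Longrightarrow> gen i + act xs 0 = act xs 0 + gen i"
proof (induction xs)
  case (Cons j xs)
  have c: "gen i + gen j = gen j + gen i" using Cons.prems gen_commute[of j i] by simp
  have IH: "gen i + act xs 0 = act xs 0 + gen i" using Cons by simp
  have "gen i + act (j # xs) 0 = gen i + gen j + act xs 0" by (simp only: act_Cons_plus add.assoc)
  also have "\<dots> = gen j + (gen i + act xs 0)" unfolding c by (simp only: add.assoc)
  also have "\<dots> = act (j # xs) 0 + gen i" unfolding IH by (simp only: act_Cons_plus add.assoc)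
  finally show ?case .
qed simp

text \<open>The blocks are abstract because the argument is applied to the reversed blocks too, in
  \<open>lookup_star_zp\<close>, and to two families of ranks with the same dimension
  vector.\<close>

locale ranks_vars = ranks +
  fixes B :: "nat \<Rightarrow> ('r::comm_ring_1 \<times> 'r) list"
  assumes length_B [simp]: "\<And>i. length (B i) = r i i"
    and unit_B: "\<And>i x. x \<in> set (B i) \<Longrightarrow> unit_pair x"
begin

text \<open>The arrangement after \<open>j\<close> steps: blocks \<open>j..n\<close> still in order,
  followed by the blocks already moved, in reverse.\<close>

definition LL :: "nat \<Rightarrow> ('r \<times> 'r) list" where
  "LL j = concat (map B [j..<Suc n]) @ concat (map B (rev [0..<j]))"

lemma length_concat_B: "length (concat (map B [j..<Suc n])) = tsum j"
  by (simp add: length_concat comp_def tsum_def interv_sum_list_conv_sum_set_nat atLeastLessThanSuc_atLeastAtMost)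

lemma length_concat_B_head: "length (concat (map B (rev [0..<j]))) = hsum j"
  by (simp add: length_concat comp_def hsum_def rev_map[symmetric] interv_sum_list_conv_sum_set_nat atLeast0LessThan)

lemma length_LL: "j \<le> Suc n \<Longrightarrow> length (LL j) = N"
  using hsum_tsum[of j] unfolding LL_def length_append length_concat_B length_concat_B_head by simp

lemma unit_LL: "\<forall>x\<in>set (LL j). unit_pair x"
  by (auto simp: LL_def intro: unit_B)

lemma LL_step:
  assumes "1 \<le> j" "j \<le> n"
  defines "X1 \<equiv> concat (map B [Suc j..<Suc n])" and "X2 \<equiv> concat (map B (rev [0..<j - 1]))"
  shows "LL (j - 1) = B (j - 1) @ B j @ X1 @ X2"
    and "run (rword j) (LL (j - 1)) = B j @ B (j - 1) @ X1 @ X2"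
    and "run (wd j) (LL (j - 1)) = LL j"
    and "wts (rword j) (LL (j - 1)) = wts (rword j) (B (j - 1) @ B j)"
    and "\<forall>(i, t) \<in> set (wts (dword j) (run (rword j) (LL (j - 1)))). \<exists>y\<in>set (B (j - 1)). \<exists>x\<in>set X1. t = fst y * snd x"
proof -
  have "[j - 1..<Suc n] = (j - 1) # j # [Suc j..<Suc n]"
    using assms by (simp add: upt_conv_Cons)
  thus 1: "LL (j - 1) = B (j - 1) @ B j @ X1 @ X2" by (simp add: LL_def X1_def X2_def)
  have "run (rectword 0 (e j) (e (j - 1))) ([] @ B (j - 1) @ B j @ X1 @ X2) = [] @ B j @ B (j - 1) @ X1 @ X2"
    using run_wts_rectword[of "[]" "B j" "B (j - 1)" "X1 @ X2"] by simp
  thus 2: "run (rword j) (LL (j - 1)) = B j @ B (j - 1) @ X1 @ X2" unfolding 1 rword_def by simp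
  have X1: "length X1 = tsum (Suc j)" unfolding X1_def by (rule length_concat_B)
  note rect = run_wts_rectword[of "B j" X1 "B (j - 1)" X2, unfolded X1 length_B, folded dword_def]
  have j: "[j..<Suc n] = j # [Suc j..<Suc n]" using assms by (simp add: upt_conv_Cons)
  have rj: "rev [0..<j] = (j - 1) # rev [0..<j - 1]" using assms by (cases j) (auto simp: upt_Suc)
  have "LL j = B j @ X1 @ B (j - 1) @ X2" unfolding LL_def X1_def X2_def j rj by simp
  thus "run (wd j) (LL (j - 1)) = LL j" using rect 2 by (simp add: wd_def run_append)
  have "set (rword j) \<subseteq> {1..<length (B (j - 1) @ B j)}" using letters_rword[of j] by (simp add: add.commute)
  from run_local[OF this, of "X1 @ X2"]
  show "wts (rword j) (LL (j - 1)) = wts (rword j) (B (j - 1) @ B j)" unfolding 1 by simp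
  show "\<forall>(i, t) \<in> set (wts (dword j) (run (rword j) (LL (j - 1)))). \<exists>y\<in>set (B (j - 1)). \<exists>x\<in>set X1. t = fst y * snd x"
    unfolding 2 using rect by simp
qed

lemma run_wds: "k \<le> n \<Longrightarrow> run (wds 1 (Suc k)) (LL 0) = LL k"
proof (induction k)
  case (Suc k)
  thus ?case using LL_step(3)[of "Suc k"] wds_Suc[of 1 "Suc k"] by (simp add: run_append)
qed simp

lemma LL_0: "LL 0 = concat (map B [0..<Suc n])"
  by (simp add: LL_def)

lemma LL_n: "LL n = concat (map B (rev [0..<Suc n]))"
  by (simp add: LL_def upt_Suc)

lemma set_wds: "set (wds 1 (Suc n)) \<subseteq> {1..<N}"
  using letters_wds[of 1 "Suc n"] tsum_0 by simp

lemma prodh_wds: "prodh (wts (wds 1 (Suc n)) (LL 0)) = prodh (phi_inv 0 (LL 0)) * prodh (phi 0 (LL n))"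
  using prodh_wts[of "wds 1 (Suc n)" "LL 0"] set_wds unit_LL[of 0] length_LL[of 0] run_wds[of n] by simp

definition RR :: "nat \<Rightarrow> fperm \<Rightarrow>\<^sub>0 'r" where
  "RR j = prodh (wts (rword j) (B (j - 1) @ B j))"

primrec Qpart :: "nat \<Rightarrow> fperm \<Rightarrow>\<^sub>0 'r" where
  "Qpart 0 = 1"
| "Qpart (Suc k) = Qpart k * (RR (Suc k) * single (dl (Suc k)) 1)"

definition cross :: "nat \<Rightarrow> 'r" where
  "cross j = prod_list (map (\<lambda>(i, t). t - 1) (wts (dword j) (run (rword j) (LL (j - 1)))))"

lemma supp_RR: "RR j \<in> supp (rword j)"
  unfolding RR_def using supp_prodh[of "wts (rword j) (B (j - 1) @ B j)"] by simp

lemma supp_Qpart: "Qpart k \<in> supp (wds 1 (Suc k))"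
proof (induction k)
  case (Suc k)
  have "single (dl (Suc k)) 1 \<in> supp (dword (Suc k))"
    using supp_single_act[of "dword (Suc k)"] by (simp add: act_dword)
  hence "Qpart k * (RR (Suc k) * single (dl (Suc k)) 1) \<in> supp (wds 1 (Suc k) @ rword (Suc k) @ dword (Suc k))"
    by (intro supp_mult Suc supp_RR)
  thus ?case using wds_Suc[of 1 "Suc k"] by (simp add: wd_def)
qed (simp add: supp_1)

lemma forced_crossings:
  assumes z: "app z = zel n r"
  shows "lookup (prodh (wts (wds 1 (Suc n)) (LL 0))) z = (\<Prod>j\<in>{1..n}. cross j) * lookup (Qpart n) z"
proof -
  define S where "S k = prodh (wts (wds (Suc k) (Suc n)) (LL k))" for k
  have "k \<le> n \<Longrightarrow> lookup (Qpart 0 * S 0) z = (\<Prod>j\<in>{1..k}. cross j) * lookup (Qpart k * S k) z" for k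
  proof (induction k)
    case (Suc k)
    let ?j = "Suc k" and ?ws = "wts (dword (Suc k)) (run (rword (Suc k)) (LL k))"
    have w: "wds ?j (Suc n) = rword ?j @ dword ?j @ wds (Suc ?j) (Suc n)"
      using wds_Cons[of ?j "Suc n"] Suc.prems by (simp add: wd_def)
    have Sk: "S k = RR ?j * (prodh ?ws * S ?j)"
      using LL_step(3,4)[of ?j] Suc.prems
      by (simp add: S_def w wts_append RR_def mult.assoc run_append wd_def)
    have "lookup ((Qpart k * RR ?j) * (prodh ?ws * S ?j)) z =
      prod_list (map (\<lambda>(i, t). t - 1) ?ws) * lookup ((Qpart k * RR ?j) * (single (act (map fst ?ws) 0) 1 * S ?j)) z"
    proof (rule lookup_forced_crossings)
      show "Qpart k * RR ?j \<in> supp (wds 1 ?j @ rword ?j)" by (intro supp_mult supp_Qpart supp_RR)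
      show "S ?j \<in> supp (wds (Suc ?j) (Suc n))"
        unfolding S_def using supp_prodh[of "wts (wds (Suc ?j) (Suc n)) (LL ?j)"] by simp
      fix us i vs and Z :: "fperm \<Rightarrow>\<^sub>0 'r"
      assume "map fst ?ws = us @ i # vs" "Z \<in> supp ((wds 1 ?j @ rword ?j) @ us @ vs @ wds (Suc ?j) (Suc n))"
      thus "lookup Z z = 0" using lookup_missing_crossing[of ?j us i vs Z z] Suc.prems z by simp
    qed
    moreover have "{1..?j} = insert ?j {1..k}" by auto
    ultimately show ?case using Suc
      by (simp add: Sk mult.assoc act_dword cross_def mult.left_commute)
  qed simp
  from this[of n] show ?thesis by (simp add: S_def)
qed

text \<open>The final permutation keeps the order of the places that each \<open>RR\<close> touches,
  so \<open>lookup_drop_prodh\<close> removes all of them and only the block swaps remain.\<close>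

lemma lookup_Qpart_flat:
  assumes "\<And>i j. i < j \<Longrightarrow> j \<le> n \<Longrightarrow> r i j = min (r i (j - 1)) (r (i + 1) j)" "app z = zel n r"
  shows "lookup (Qpart n) z = 1"
proof -
  have z: "z = dcomp n" using zel_flat[OF assms(1)] assms(2) by (simp add: app_inject[symmetric])
  have "k \<le> n \<Longrightarrow> lookup (Qpart k * Y) z = lookup (single (dcomp k) 1 * Y) z" for k Y
  proof (induction k arbitrary: Y)
    case (Suc k)
    have "lookup (Qpart (Suc k) * Y) z = lookup (single (dcomp k) 1 * (RR (Suc k) * (single (dl (Suc k)) 1 * Y))) z"
      using Suc.IH[of "RR (Suc k) * (single (dl (Suc k)) 1 * Y)"] Suc.prems
      by (simp only: Qpart.simps mult.assoc Suc_leD)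
    also have "\<dots> = lookup (single (dcomp k) 1 * (single (dl (Suc k)) 1 * Y)) z"
      unfolding RR_def
    proof (rule lookup_drop_prodh)
      fix i assume "i \<in> fst ` set (wts (rword (Suc k)) (B (Suc k - 1) @ B (Suc k)))"
      hence i: "1 \<le> i" "i < e (Suc k) + e k" using letters_rword[of "Suc k"] by auto
      have "Suc i \<le> tsum k" using i tsum_pred[of "Suc k"] Suc.prems by simp
      have "strict_mono_on {1..tsum k} (app (dcomp k))" using dcomp_props(1) Suc.prems by simp
      hence "app (dcomp k) i < app (dcomp k) (Suc i)"
        by (rule strict_mono_onD) (use i \<open>Suc i \<le> tsum k\<close> in simp_all)
      thus "app (dcomp k) i < app (dcomp k) (Suc i) \<and>
          inv (app z) (app (dcomp k) i) < inv (app z) (app (dcomp k) (Suc i))"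
        unfolding z using inv_dcomp_increasing[of k i "Suc i"] Suc.prems i by simp
    qed
    also have "\<dots> = lookup (single (dcomp (Suc k)) 1 * Y) z"
      by (simp only: mult.assoc[symmetric] mult_single dcomp.simps mult_1_left)
    finally show ?case .
  qed simp
  from this[of n 1] show ?thesis unfolding z by simp
qed

subsection \<open>Absence of descents inside the blocks\<close>

text \<open>Letters inside value blocks, harmless as left factors; \<open>pletters\<close> are those
  inside position blocks, harmless on the right. They are also the swaps within the blocks of
  \<open>LL 0\<close> and \<open>LL n\<close>, which start at the numbers \<open>hsum\<close> and
  \<open>tsum\<close>.\<close>

definition vletters :: "nat set" where
  "vletters = {i. \<exists>a\<le>n. hsum a < i \<and> i < hsum (Suc a)}"

definition pletters :: "nat set" where
  "pletters = {i. \<exists>k\<le>n. tsum (Suc k) < i \<and> i < tsum k}"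

lemma no_ldesc:
  assumes "app z = zel n r" "i \<in> vletters"
  shows "\<not> ldesc i z"
proof -
  obtain a where "a \<le> n" "hsum a < i" "i < hsum (Suc a)" using assms(2) unfolding vletters_def by blast
  hence "inv (zel n r) i < inv (zel n r) (Suc i)"
    using inv_zel_increasing_on_block[of a i "Suc i"] by simp
  thus ?thesis by (simp add: ldesc_def assms(1))
qed

lemma no_rdesc:
  assumes "app z = zel n r" "i \<in> pletters"
  shows "\<not> rdesc i z"
proof -
  obtain k where k: "k \<le> n" "tsum (Suc k) < i" "i < tsum k" using assms(2) by (auto simp: pletters_def)
  have "zel n r (tsum (Suc k) + (i - tsum (Suc k))) < zel n r (tsum (Suc k) + Suc (i - tsum (Suc k)))"
    by (rule zel_increasing_on_block) (use k tsum_Suc[of k] in auto)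
  thus ?thesis using k by (simp add: rdesc_def assms(1))
qed

lemma lookup_strip:
  assumes "app z = zel n r" "fst ` set us \<subseteq> vletters" "fst ` set vs \<subseteq> pletters"
  shows "lookup (prodh us * Z * prodh vs) z = lookup Z z"
proof -
  have "lookup (prodh us * Z * prodh vs) z = lookup (prodh us * Z) z"
    by (rule prodh_no_rdesc, rule no_rdesc[OF assms(1)], rule subsetD[OF assms(3)])
  also have "\<dots> = lookup Z z"
    by (rule prodh_no_ldesc, rule no_ldesc[OF assms(1)], rule subsetD[OF assms(2)])
  finally show ?thesis .
qed

subsection \<open>From rectangles to the factors of the KMS-factorizations\<close>

definition FF :: "nat \<Rightarrow> fperm \<Rightarrow>\<^sub>0 'r" where
  "FF i = prodh (phi_inv 0 (B (i - 1) @ replicate (e i) (1, 1))) * prodh (phi 0 (B i @ replicate (e (i - 1)) (1, 1)))"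

primrec Ppart :: "nat \<Rightarrow> fperm \<Rightarrow>\<^sub>0 'r" where
  "Ppart 0 = 1"
| "Ppart (Suc k) = Ppart k * (FF (Suc k) * single (dl (Suc k)) 1)"

text \<open>Replacing the trailing ones by actual variables costs one factor, by
  \<open>phi_append_ones\<close>. Done in both lists, it leaves the two orders of one concatenation,
  whose quotient is the rectangle.\<close>

lemma FF_eq: "FF i = prodh (phi (e (i - 1)) (B i)) * (RR i * prodh (phi_inv (e i) (B (i - 1))))"
proof -
  let ?x = "B (i - 1)" and ?y = "B i"
  have ux: "\<forall>u\<in>set ?x. unit_pair u" and uy: "\<forall>u\<in>set ?y. unit_pair u" by (auto intro: unit_B)
  have u1: "\<forall>u\<in>set (?x @ replicate (e i) (1, 1)). unit_pair u" using ux by (auto simp: unit_pair_def)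
  have uxy: "\<forall>u\<in>set (?x @ ?y). unit_pair u" using ux uy by auto
  have "prodh (phi 0 (?y @ ?x)) = prodh (phi 0 (?y @ replicate (e (i - 1)) (1, 1))) * prodh (phi (e i) ?x)"
    using phi_append_ones[of 0 ?y ?x] by simp
  hence 1: "prodh (phi 0 (?y @ replicate (e (i - 1)) (1, 1))) = prodh (phi 0 (?y @ ?x)) * prodh (phi_inv (e i) ?x)"
    by (simp add: mult.assoc phi_inv_phi[OF ux] del: One_nat_def)
  have "prodh (phi 0 (?x @ ?y)) = prodh (phi 0 (?x @ replicate (e i) (1, 1))) * prodh (phi (e (i - 1)) ?y)"
    using phi_append_ones[of 0 ?x ?y] by simp
  hence "prodh (phi_inv 0 (?x @ replicate (e i) (1, 1))) * prodh (phi 0 (?x @ ?y)) = prodh (phi (e (i - 1)) ?y)"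
    by (simp add: mult.assoc[symmetric] phi_inv_phi[OF u1] del: One_nat_def)
  hence 2: "prodh (phi_inv 0 (?x @ replicate (e i) (1, 1))) = prodh (phi (e (i - 1)) ?y) * prodh (phi_inv 0 (?x @ ?y))"
  proof -
    assume a: "prodh (phi_inv 0 (?x @ replicate (e i) (1, 1))) * prodh (phi 0 (?x @ ?y)) = prodh (phi (e (i - 1)) ?y)"
    have "prodh (phi_inv 0 (?x @ replicate (e i) (1, 1))) =
      prodh (phi_inv 0 (?x @ replicate (e i) (1, 1))) * (prodh (phi 0 (?x @ ?y)) * prodh (phi_inv 0 (?x @ ?y)))"
      unfolding phi_inv_phi(2)[OF uxy] by (rule mult_1_right[symmetric])
    thus ?thesis unfolding mult.assoc[symmetric] a .
  qed
  have "run (rword i) (?x @ ?y) = ?y @ ?x"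
    using run_wts_rectword[of "[]" ?y ?x "[]"] by (simp add: rword_def)
  moreover have "set (rword i) \<subseteq> {1..<length (?x @ ?y)}" using letters_rword[of i] by (simp add: add.commute)
  ultimately have 3: "prodh (phi_inv 0 (?x @ ?y)) * prodh (phi 0 (?y @ ?x)) = RR i"
    using prodh_wts[of "rword i" "?x @ ?y"] uxy by (simp add: RR_def)
  have "FF i = prodh (phi (e (i - 1)) ?y) * ((prodh (phi_inv 0 (?x @ ?y)) * prodh (phi 0 (?y @ ?x))) * prodh (phi_inv (e i) ?x))"
    unfolding FF_def 1 2 by (simp only: mult.assoc)
  thus ?thesis unfolding 3 .
qed

text \<open>Moving left through a block swap raises the letter by a block size, above the reach of
  the rectangle next to it. The shifts add up to \<open>hsum k\<close>.\<close>

lemma Qpart_conj: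
  "k \<le> n \<Longrightarrow> e k < i \<Longrightarrow> i < tsum k \<Longrightarrow> hh (hsum k + i) t * Qpart k = Qpart k * hh i t"
proof (induction k arbitrary: i)
  case (Suc k)
  have t: "tsum (Suc k) = e (Suc k) + tsum (Suc (Suc k))" "tsum k = e k + tsum (Suc k)"
    using tsum_Suc[of "Suc k"] tsum_Suc[of k] Suc.prems by auto
  have E: "hh (i + e k) t * single (dl (Suc k)) 1 = single (dl (Suc k)) 1 * hh i t"
  proof (rule hh_conj, rule gen_conj)
    show "app (dl (Suc k)) i = i + e k" "app (dl (Suc k)) (Suc i) = Suc (i + e k)"
      using Suc.prems t by (simp_all add: app_dl bs_def)
  qed
  have R: "RR (Suc k) * hh (i + e k) t = hh (i + e k) t * RR (Suc k)"
    unfolding RR_def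
  proof (rule prodh_commute)
    fix l s assume "(l, s) \<in> set (wts (rword (Suc k)) (B (Suc k - 1) @ B (Suc k)))"
    hence "l \<in> fst ` set (wts (rword (Suc k)) (B (Suc k - 1) @ B (Suc k)))" by (rule image_eqI[rotated]) simp
    hence "l < e (Suc k) + e k" using letters_rword[of "Suc k"] by auto
    thus "hh l s * hh (i + e k) t = hh (i + e k) t * hh l s" using Suc.prems by (intro hh_commute') auto
  qed
  have IH: "hh (hsum k + (i + e k)) t * Qpart k = Qpart k * hh (i + e k) t"
    using Suc.IH[of "i + e k"] Suc.prems t by simp
  have "hsum (Suc k) + i = hsum k + (i + e k)" by simp
  hence "hh (hsum (Suc k) + i) t * Qpart (Suc k) =
      (hh (hsum k + (i + e k)) t * Qpart k) * (RR (Suc k) * single (dl (Suc k)) 1)"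
    by (simp only: Qpart.simps mult.assoc)
  also have "\<dots> = Qpart k * ((RR (Suc k) * hh (i + e k) t) * single (dl (Suc k)) 1)"
    unfolding IH R by (simp only: mult.assoc)
  also have "\<dots> = Qpart (Suc k) * hh i t"
    by (simp only: E Qpart.simps mult.assoc)
  finally show ?case .
qed simp

text \<open>The left surplus factor of \<open>FF (Suc k)\<close> travels through
  \<open>Qpart k\<close> to the far left and lands inside a value block. The right surplus factor
  passes the adjoining block swap and lands inside a position block, beyond the letters of all later
  steps.\<close>

lemma Ppart_eq:
  "k \<le> n \<Longrightarrow> \<exists>us vs. fst ` set us \<subseteq> vletters \<and> fst ` set vs \<subseteq> {i \<in> pletters. tsum k < i} \<and>
    Ppart k = prodh us * Qpart k * prodh vs"
proof (induction k)
  case 0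
  show ?case by (intro exI[of _ "[]"]) simp
next
  case (Suc k)
  then obtain us vs where IH: "fst ` set us \<subseteq> vletters" "fst ` set vs \<subseteq> {i \<in> pletters. tsum k < i}"
    "Ppart k = prodh us * Qpart k * prodh vs" by auto
  have t: "tsum (Suc k) = e (Suc k) + tsum (Suc (Suc k))" "tsum k = e k + tsum (Suc k)"
    using tsum_Suc[of "Suc k"] tsum_Suc[of k] Suc.prems by auto
  define U where "U = phi (e k) (B (Suc k))"
  define V where "V = phi_inv (e (Suc k)) (B k)"
  let ?R = "RR (Suc k)" and ?E = "single (dl (Suc k)) (1::'r)"
  have lU: "fst ` set U \<subseteq> {e k<..<e k + e (Suc k)}" unfolding U_def using letters_phi[of "e k" "B (Suc k)"] by simp
  have lV: "fst ` set V \<subseteq> {e (Suc k)<..<e (Suc k) + e k}"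
    unfolding V_def using letters_phi_inv[of "e (Suc k)" "B k"] by simp
  define U' where "U' = map (\<lambda>(i, t). (hsum k + i, t)) U"
  define V' where "V' = map (\<lambda>(i, t). (i + tsum (Suc (Suc k)), t)) V"
  have U': "prodh U' * Qpart k = Qpart k * prodh U"
    unfolding U'_def
  proof (rule prodh_conj)
    fix i assume "i \<in> fst ` set U"
    hence "e k < i" "i < e k + e (Suc k)" using lU by auto
    thus "\<forall>t. hh (hsum k + i) t * Qpart k = Qpart k * hh i t" using Qpart_conj[of k i] Suc.prems t by simp
  qed
  have V': "prodh V * ?E = ?E * prodh V'"
  proof -
    have "prodh (map (\<lambda>(i, t). (i - tsum (Suc (Suc k)), t)) V') * ?E = ?E * prodh V'"
    proof (rule prodh_conj)
      fix i assume "i \<in> fst ` set V'"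
      then obtain i' where "i' \<in> fst ` set V" "i = i' + tsum (Suc (Suc k))" by (force simp: V'_def)
      hence i: "e (Suc k) + tsum (Suc (Suc k)) < i" "i < e (Suc k) + e k + tsum (Suc (Suc k))" using lV by auto
      have "gen (i - tsum (Suc (Suc k))) + dl (Suc k) = dl (Suc k) + gen i"
        by (rule gen_conj) (use i in \<open>auto simp: app_dl bs_def\<close>)
      thus "\<forall>t. hh (i - tsum (Suc (Suc k))) t * ?E = ?E * hh i t" using hh_conj by blast
    qed
    moreover have "map (\<lambda>(i, t). (i - tsum (Suc (Suc k)), t)) V' = V"
      unfolding V'_def map_map by (rule map_idI) auto
    ultimately show ?thesis by simp
  qed
  \<comment> \<open>The factors collected on the right have letters beyond \<open>tsum k\<close>,
    those still to be passed have letters below it.\<close>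
  have far: "prodh vs * Z = Z * prodh vs" if "\<And>i t. tsum k < i \<Longrightarrow> hh i t * Z = Z * hh i t" for Z
    by (rule prodh_commute, rule that) (use IH(2) in force)
  have far_prodh: "hh i t * prodh ws = prodh ws * hh i t" if "tsum k < i" "fst ` set ws \<subseteq> {..<tsum k}" for i t ws
  proof (rule prodh_commute[symmetric])
    fix l s assume "(l, s) \<in> set ws"
    hence "l < tsum k" using that(2) by force
    thus "hh l s * hh i t = hh i t * hh l s" using that(1) by (intro hh_commute') auto
  qed
  have cU: "prodh vs * prodh U = prodh U * prodh vs"
    by (rule far, rule far_prodh) (use lU t in force)+
  have cV: "prodh vs * prodh V = prodh V * prodh vs"
    by (rule far, rule far_prodh) (use lV t in force)+
  have cR: "prodh vs * ?R = ?R * prodh vs"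
    unfolding RR_def by (rule far, rule far_prodh) (use letters_rword[of "Suc k"] t in \<open>auto dest!: subsetD\<close>)
  have cE: "prodh vs * ?E = ?E * prodh vs"
  proof (rule far, rule hh_conj)
    fix i assume i: "tsum k < i"
    have "gen i + act (dword (Suc k)) 0 = act (dword (Suc k)) 0 + gen i"
      by (rule gen_far_act) (use i letters_dword[of "Suc k"] Suc.prems in force)
    thus "gen i + dl (Suc k) = dl (Suc k) + gen i" by (simp add: act_dword)
  qed
  have "Ppart (Suc k) = prodh us * (Qpart k * ((prodh vs * prodh U) * (?R * (prodh V * ?E))))"
    by (simp add: IH(3) FF_eq U_def V_def mult.assoc)
  also have "\<dots> = prodh us * ((Qpart k * prodh U) * ((prodh vs * ?R) * (prodh V * ?E)))"
    unfolding cU by (simp only: mult.assoc)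
  also have "\<dots> = prodh us * (prodh U' * (Qpart k * (?R * ((prodh vs * prodh V) * ?E))))"
    unfolding cR U'[symmetric] by (simp only: mult.assoc)
  also have "\<dots> = prodh us * (prodh U' * (Qpart k * (?R * (prodh V * (prodh vs * ?E)))))"
    unfolding cV by (simp only: mult.assoc)
  also have "\<dots> = prodh us * (prodh U' * (Qpart k * (?R * ((prodh V * ?E) * prodh vs))))"
    unfolding cE by (simp only: mult.assoc)
  also have "\<dots> = prodh (us @ U') * Qpart (Suc k) * prodh (V' @ vs)"
    unfolding V' by (simp add: mult.assoc)
  finally have "Ppart (Suc k) = prodh (us @ U') * Qpart (Suc k) * prodh (V' @ vs)" .
  moreover have "fst ` set U' \<subseteq> vletters"
  proof
    fix x assume "x \<in> fst ` set U'"
    then obtain i where "i \<in> fst ` set U" "x = hsum k + i" by (force simp: U'_def)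
    hence "hsum (Suc k) < x" "x < hsum (Suc (Suc k))" using lU by auto
    thus "x \<in> vletters" using Suc.prems by (auto simp: vletters_def simp del: hsum_Suc)
  qed
  moreover have "fst ` set V' \<subseteq> {i \<in> pletters. tsum (Suc k) < i}"
  proof
    fix x assume "x \<in> fst ` set V'"
    then obtain i where "i \<in> fst ` set V" "x = i + tsum (Suc (Suc k))" by (force simp: V'_def)
    hence "tsum (Suc k) < x" "x < tsum k" using lV t by auto
    thus "x \<in> {i \<in> pletters. tsum (Suc k) < i}" using Suc.prems unfolding pletters_def by (auto intro!: exI[of _ k])
  qed
  moreover have "fst ` set vs \<subseteq> {i \<in> pletters. tsum (Suc k) < i}" using IH(2) t by auto
  ultimately show ?case using IH(1) by (intro exI[of _ "us @ U'"] exI[of _ "V' @ vs"]) (simp add: image_Un)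
qed

lemma lookup_Ppart:
  assumes "app z = zel n r"
  shows "lookup (Ppart n) z = lookup (Qpart n) z"
proof -
  obtain us vs where "fst ` set us \<subseteq> vletters" "fst ` set vs \<subseteq> {i \<in> pletters. tsum n < i}"
    "Ppart n = prodh us * Qpart n * prodh vs" using Ppart_eq[of n] by auto
  thus ?thesis using lookup_strip[OF assms, of us vs "Qpart n"] by auto
qed

subsection \<open>Reversal of the blocks\<close>

lemma reverse_LL_0:
  obtains "is" where "set is \<subseteq> vletters" "run is (LL 0) = concat (map (\<lambda>i. rev (B i)) [0..<Suc n])"
proof -
  \<comment> \<open>The arbitrary tail \<open>post\<close> lets the next block be treated as part of
    it in the induction.\<close>
  have "k \<le> Suc n \<Longrightarrow> \<exists>is. set is \<subseteq> vletters \<and>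
    (\<forall>post. run is (concat (map B [0..<k]) @ post) = concat (map (\<lambda>i. rev (B i)) [0..<k]) @ post)" for k
  proof (induction k)
    case 0
    show ?case by (intro exI[of _ "[]"]) simp
  next
    case (Suc k)
    then obtain "is" where "is": "set is \<subseteq> vletters"
      "\<And>post. run is (concat (map B [0..<k]) @ post) = concat (map (\<lambda>i. rev (B i)) [0..<k]) @ post" by auto
    let ?pre = "concat (map (\<lambda>i. rev (B i)) [0..<k])"
    have len: "length ?pre = hsum k"
      by (simp add: length_concat comp_def hsum_def interv_sum_list_conv_sum_set_nat atLeast0LessThan)
    obtain js where js: "set js \<subseteq> {hsum k<..<hsum k + e k}"
      "run js (?pre @ B k @ []) = ?pre @ rev (B k) @ []"
      using run_rev_exists[of ?pre "B k" "[]"] unfolding len length_B by blast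
    have "set js \<subseteq> {1..<length (?pre @ B k)}" using js(1) len by fastforce
    hence "run js ((?pre @ B k) @ post) = (?pre @ rev (B k)) @ post" for post
      using run_local[of js "?pre @ B k" post] js(2) by simp
    hence "run (is @ js) (concat (map B [0..<Suc k]) @ post) = concat (map (\<lambda>i. rev (B i)) [0..<Suc k]) @ post" for post
      using "is"(2)[of "B k @ post"] by (simp add: run_append upt_Suc)
    moreover have "set js \<subseteq> vletters" using js(1) Suc.prems by (force simp: vletters_def)
    ultimately show ?case using "is"(1) by (intro exI[of _ "is @ js"]) simp
  qed
  from this[of "Suc n"] obtain "is" where "set is \<subseteq> vletters"
    "\<forall>post. run is (concat (map B [0..<Suc n]) @ post) = concat (map (\<lambda>i. rev (B i)) [0..<Suc n]) @ post" by auto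
  thus ?thesis using that[of "is"] unfolding LL_0 by (metis append_Nil2)
qed

lemma reverse_LL_n:
  obtains "is" where "set is \<subseteq> pletters" "run is (LL n) = concat (map (\<lambda>i. rev (B i)) (rev [0..<Suc n]))"
proof -
  have "m \<le> Suc n \<Longrightarrow> \<exists>is. set is \<subseteq> pletters \<and>
    (\<forall>post. run is (concat (map B (rev [Suc n - m..<Suc n])) @ post) =
      concat (map (\<lambda>i. rev (B i)) (rev [Suc n - m..<Suc n])) @ post)" for m
  proof (induction m)
    case 0
    show ?case by (intro exI[of _ "[]"]) simp
  next
    case (Suc m)
    then obtain "is" where "is": "set is \<subseteq> pletters"
      "\<And>post. run is (concat (map B (rev [Suc n - m..<Suc n])) @ post) =
        concat (map (\<lambda>i. rev (B i)) (rev [Suc n - m..<Suc n])) @ post" by auto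
    define k where "k = Suc n - Suc m"
    have k: "Suc n - m = Suc k" "k \<le> n" using Suc.prems by (auto simp: k_def)
    let ?pre = "concat (map (\<lambda>i. rev (B i)) (rev [Suc k..<Suc n]))"
    have len: "length ?pre = tsum (Suc k)"
      by (simp add: length_concat comp_def tsum_def rev_map[symmetric] interv_sum_list_conv_sum_set_nat
          atLeastLessThanSuc_atLeastAtMost)
    obtain js where js: "set js \<subseteq> {tsum (Suc k)<..<tsum (Suc k) + e k}"
      "run js (?pre @ B k @ []) = ?pre @ rev (B k) @ []"
      using run_rev_exists[of ?pre "B k" "[]"] unfolding len length_B by blast
    have "set js \<subseteq> {1..<length (?pre @ B k)}" using js(1) len by fastforce
    hence "run js ((?pre @ B k) @ post) = (?pre @ rev (B k)) @ post" for post
      using run_local[of js "?pre @ B k" post] js(2) by simp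
    moreover have "[k..<Suc n] = k # [Suc k..<Suc n]" using k by (simp add: upt_conv_Cons)
    ultimately have "run (is @ js) (concat (map B (rev [k..<Suc n])) @ post) =
        concat (map (\<lambda>i. rev (B i)) (rev [k..<Suc n])) @ post" for post
      using "is"(2)[of "B k @ post"] by (simp add: run_append k(1))
    moreover have "set js \<subseteq> pletters" using js(1) k tsum_Suc[of k] by (force simp: pletters_def)
    ultimately show ?case using "is"(1) unfolding k_def by (intro exI[of _ "is @ js"]) simp
  qed
  from this[of "Suc n"] obtain "is" where "set is \<subseteq> pletters"
    "\<forall>post. run is (concat (map B (rev [0..<Suc n])) @ post) = concat (map (\<lambda>i. rev (B i)) (rev [0..<Suc n])) @ post"
    by auto
  thus ?thesis using that[of "is"] unfolding LL_n by (metis append_Nil2)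
qed

end


section \<open>The ratio formula\<close>

context ranks_vars
begin

definition zp :: fperm where
  "zp = Abs_fperm (zel n r)"

lemma app_zp: "app zp = zel n r"
  unfolding zp_def by (rule app_Abs[OF zel_permutes])

lemma vletters_range: "vletters \<subseteq> {1..<N}"
proof
  fix i assume "i \<in> vletters"
  then obtain a where a: "a \<le> n" "hsum a < i" "i < hsum (Suc a)" by (auto simp: vletters_def)
  moreover have "hsum (Suc a) \<le> N" using hsum_tsum[of "Suc a"] a(1) by simp
  ultimately show "i \<in> {1..<N}" by auto
qed

lemma pletters_range: "pletters \<subseteq> {1..<N}"
proof
  fix i assume "i \<in> pletters"
  then obtain k where k: "k \<le> n" "tsum (Suc k) < i" "i < tsum k" by (auto simp: pletters_def)
  moreover have "tsum k \<le> N" using tsum_antimono[of 0 k] tsum_0 by simp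
  ultimately show "i \<in> {1..<N}" by auto
qed

text \<open>Mirroring exchanges \<open>LL 0\<close> and \<open>LL n\<close> up to a reversal inside
  every block, which is the same situation for the blocks \<open>rev (B i)\<close>. Reversing them
  back costs swaps inside value blocks on the left and inside position blocks on the right, which
  \<open>lookup_strip\<close> removes.\<close>

lemma lookup_star_zp:
  "lookup (prodh (phi_inv 0 (LL 0)) * prodh (phi 0 (LL n))) (star N zp) =
    (\<Prod>j\<in>{1..n}. cross j) * lookup (Qpart n) zp"
proof -
  interpret rv: ranks_vars n r "\<lambda>i. rev (B i)"
    by unfold_locales (auto intro: unit_B)
  let ?W = "wds 1 (Suc n)"
  have rev: "rev (LL n) = rv.LL 0" "rev (LL 0) = rv.LL n" "rev (rv.LL n) = LL 0" "rev (rv.LL 0) = LL n"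
    unfolding LL_0 LL_n rv.LL_0 rv.LL_n by (simp_all add: rev_concat rev_map comp_def)
  have len: "length (rv.LL 0) = N" by (rule rv.length_LL) simp
  have "lookup (prodh (wts ?W (rv.LL 0))) zp =
    lookup (prodh (phi_inv 0 (rev (run ?W (rv.LL 0)))) * prodh (phi 0 (rev (rv.LL 0)))) (star N zp)"
    using lookup_wts_star[of ?W "rv.LL 0" zp] rv.unit_LL set_wds zel_permutes by (simp add: len app_zp)
  hence 1: "lookup (prodh (phi_inv 0 (LL 0)) * prodh (phi 0 (LL n))) (star N zp) = lookup (prodh (wts ?W (rv.LL 0))) zp"
    using rv.run_wds[of n] by (simp add: rev)
  obtain us where us: "set us \<subseteq> vletters" "run us (rv.LL 0) = LL 0"
    using rv.reverse_LL_0 unfolding LL_0 by auto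
  obtain vs where vs: "set vs \<subseteq> pletters" "run vs (LL n) = rv.LL n"
    using reverse_LL_n unfolding rv.LL_n by auto
  have "set us \<subseteq> {1..<length (rv.LL 0)}" unfolding len using us(1) vletters_range by (rule subset_trans)
  from prodh_wts[OF this rv.unit_LL]
  have "prodh (wts us (rv.LL 0)) = prodh (phi_inv 0 (rv.LL 0)) * prodh (phi 0 (LL 0))" by (simp only: us(2))
  hence 2: "prodh (phi_inv 0 (rv.LL 0)) = prodh (wts us (rv.LL 0)) * prodh (phi_inv 0 (LL 0))"
    by (simp add: mult.assoc phi_inv_phi(2)[OF unit_LL])
  have "length (LL n) = N" by (rule length_LL) simp
  hence "set vs \<subseteq> {1..<length (LL n)}" using subset_trans[OF vs(1) pletters_range] by simp
  from phi_run[OF this unit_LL]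
  have 3: "prodh (phi 0 (rv.LL n)) = prodh (phi 0 (LL n)) * prodh (wts vs (LL n))" by (simp only: vs(2))
  have "prodh (wts ?W (rv.LL 0)) = prodh (wts us (rv.LL 0)) * prodh (wts ?W (LL 0)) * prodh (wts vs (LL n))"
    unfolding rv.prodh_wds prodh_wds 2 3 by (simp only: mult.assoc)
  hence "lookup (prodh (wts ?W (rv.LL 0))) zp = lookup (prodh (wts ?W (LL 0))) zp"
    using lookup_strip[OF app_zp, of "wts us (rv.LL 0)" "wts vs (LL n)"] us vs by simp
  thus ?thesis using 1 forced_crossings[OF app_zp] by simp
qed

lemma zel_hat_star: "zel_hat n r = app (star N zp)"
  by (simp add: zel_hat_def star.rep_eq app_zp)

lemma zel_hat_permutes: "zel_hat n r permutes {1..<Suc N}"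
  unfolding zel_hat_def by (intro permutes_compose longest_permutes permutes_inv zel_permutes)

lemma sign_zel_hat: "(-1) ^ perm_length (zel_hat n r) = ((-1) ^ crossings :: 's::comm_ring_1)"
proof -
  have p: "permutation (longest N)" "permutation (zel n r)" "permutation (inv (zel n r))"
    by (rule permutes_imp_permutation[OF _ longest_permutes], simp)
      (rule permutes_imp_permutation[OF _ zel_permutes], simp,
       rule permutes_imp_permutation[OF _ permutes_inv[OF zel_permutes]], simp)
  have "sign (zel_hat n r) = (sign (longest N) * sign (longest N)) * sign (zel n r)"
    unfolding zel_hat_def
    by (simp only: sign_compose[OF permutation_compose[OF p(1,3)] p(1)] sign_compose[OF p(1,3)] sign_inverse[OF p(2)] mult_ac)
  also have "sign (longest N) * sign (longest N) = 1" by (simp add: sign_def)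
  finally have "(-1 :: int) ^ perm_length (zel_hat n r) = (-1) ^ crossings"
    using sign_perm_length[OF zel_hat_permutes] sign_zel by simp
  \<comment> \<open>\<open>sign\<close> is an integer; its parity information carries over to any
    ring.\<close>
  hence "even (perm_length (zel_hat n r)) \<longleftrightarrow> even crossings"
    by (cases "even (perm_length (zel_hat n r))"; cases "even crossings") simp_all
  thus ?thesis by (cases "even crossings") simp_all
qed

lemma gcoeff_zel_hat:
  "gcoeff (LL n) (LL 0) (zel_hat n r) = (-1) ^ crossings * ((\<Prod>j\<in>{1..n}. cross j) * lookup (Qpart n) zp)"
  unfolding gcoeff_def sign_zel_hat lookup_star_zp[symmetric] by (simp add: zel_hat_star app_inverse)

subsection \<open>Summation over the KMS-factorizations\<close>

definition SS :: "nat \<Rightarrow> (nat \<Rightarrow> nat) set" where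
  "SS i = {u. u permutes {1..e (i - 1) + e i}}"

lemma finite_SS: "finite (SS i)"
  unfolding SS_def by (rule finite_permutations) simp

lemma SS_permutes: "u \<in> SS i \<Longrightarrow> u permutes {1..<Suc (e (i - 1) + e i)}"
  by (simp add: SS_def atLeastLessThanSuc_atLeastAtMost)

text \<open>Both factors involve only letters below \<open>e (i - 1) + e i\<close>, so
  \<open>FF i\<close> is a sum over exactly the range allowed for the factor number
  \<open>i\<close>.\<close>

lemma keys_FF: "keys (FF i) \<subseteq> Abs_fperm ` SS i"
proof
  fix y assume y: "y \<in> keys (FF i)"
  let ?ws = "phi_inv 0 (B (i - 1) @ replicate (e i) (1, 1)) @ phi 0 (B i @ replicate (e (i - 1)) (1, 1))"
  have mem: "y \<in> subwords_act (map fst ?ws) 0"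
    using y keys_supp[OF supp_prodh[of ?ws]] unfolding FF_def prodh_simps(3)[symmetric] by (rule subsetD[rotated])
  have set: "set (map fst ?ws) \<subseteq> {1..<Suc (e (i - 1) + e i) - 1}"
  proof -
    have "fst ` set (phi_inv 0 (B (i - 1) @ replicate (e i) (1, 1))) \<subseteq> {0<..<e (i - 1) + e i}"
      by (rule subset_trans[OF letters_phi_inv]) (simp add: add.commute)
    moreover have "fst ` set (phi 0 (B i @ replicate (e (i - 1)) (1, 1))) \<subseteq> {0<..<e (i - 1) + e i}"
      by (rule subset_trans[OF letters_phi]) (simp add: add.commute)
    moreover have "{0<..<e (i - 1) + e i} \<subseteq> {1..<Suc (e (i - 1) + e i) - 1}" by auto
    ultimately show ?thesis unfolding map_append set_append set_map by blast
  qed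
  have "app 0 permutes {1..<Suc (e (i - 1) + e i)}" unfolding zero_fperm.rep_eq by (rule permutes_id)
  hence "app y permutes {1..<Suc (e (i - 1) + e i)}" by (rule subwords_act_permutes[OF set _ mem])
  hence "app y \<in> SS i" by (simp add: SS_def atLeastLessThanSuc_atLeastAtMost)
  thus "y \<in> Abs_fperm ` SS i" by (rule image_eqI[rotated]) (simp add: app_inverse)
qed

lemma inj_on_Abs_SS: "inj_on Abs_fperm (SS i)"
proof (rule inj_onI)
  fix u v assume "u \<in> SS i" "v \<in> SS i" "Abs_fperm u = Abs_fperm v"
  thus "u = v" using app_Abs[OF SS_permutes] by metis
qed

lemma FF_sum: "FF i = (\<Sum>u\<in>SS i. single (Abs_fperm u) (lookup (FF i) (Abs_fperm u)))"
proof -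
  have "FF i = (\<Sum>y\<in>Abs_fperm ` SS i. single y (lookup (FF i) y))"
  proof (rule poly_mapping_eqI)
    fix k
    show "lookup (FF i) k = lookup (\<Sum>y\<in>Abs_fperm ` SS i. single y (lookup (FF i) y)) k"
      using keys_FF[of i] finite_SS[of i]
      by (auto simp: lookup_sum lookup_single when_def sum.delta in_keys_iff)
  qed
  also have "\<dots> = (\<Sum>u\<in>SS i. single (Abs_fperm u) (lookup (FF i) (Abs_fperm u)))"
    by (simp add: sum.reindex[OF inj_on_Abs_SS])
  finally show ?thesis .
qed

primrec dseq :: "(nat \<Rightarrow> nat \<Rightarrow> nat) \<Rightarrow> nat \<Rightarrow> fperm" where
  "dseq w 0 = 0"
| "dseq w (Suc k) = dseq w k + (Abs_fperm (w (Suc k)) + dl (Suc k))"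

lemma dseq_upd: "k < j \<Longrightarrow> dseq (w(j := u)) k = dseq w k"
  by (induction k) auto

lemma Ppart_sum:
  "Ppart k = (\<Sum>w\<in>Pi\<^sub>E {1..k} SS. single (dseq w k) (\<Prod>i\<in>{1..k}. lookup (FF i) (Abs_fperm (w i))))"
proof (induction k)
  case (Suc k)
  let ?c = "\<lambda>w. \<Prod>i\<in>{1..k}. lookup (FF i) (Abs_fperm (w i))"
  have ins: "{1..Suc k} = insert (Suc k) {1..k}" by auto
  have "(\<Sum>w\<in>Pi\<^sub>E {1..Suc k} SS. single (dseq w (Suc k)) (\<Prod>i\<in>{1..Suc k}. lookup (FF i) (Abs_fperm (w i)))) =
    (\<Sum>(u, w)\<in>SS (Suc k) \<times> Pi\<^sub>E {1..k} SS. single (dseq (w(Suc k := u)) (Suc k))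
      (\<Prod>i\<in>{1..Suc k}. lookup (FF i) (Abs_fperm ((w(Suc k := u)) i))))"
    unfolding ins PiE_insert_eq
    by (subst sum.reindex[OF inj_combinator]) (auto intro!: sum.cong)
  also have "\<dots> = (\<Sum>(u, w)\<in>SS (Suc k) \<times> Pi\<^sub>E {1..k} SS.
      single (dseq w k + (Abs_fperm u + dl (Suc k))) (?c w * lookup (FF (Suc k)) (Abs_fperm u)))"
  proof (intro sum.cong refl, clarify)
    fix u w
    have "(\<Prod>i\<in>{1..k}. lookup (FF i) (Abs_fperm ((w(Suc k := u)) i))) = ?c w" by (rule prod.cong) auto
    thus "single (dseq (w(Suc k := u)) (Suc k)) (\<Prod>i\<in>{1..Suc k}. lookup (FF i) (Abs_fperm ((w(Suc k := u)) i))) =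
      single (dseq w k + (Abs_fperm u + dl (Suc k))) (?c w * lookup (FF (Suc k)) (Abs_fperm u))"
      by (simp add: ins dseq_upd mult.commute)
  qed
  also have "\<dots> = (\<Sum>u\<in>SS (Suc k). \<Sum>w\<in>Pi\<^sub>E {1..k} SS.
      single (dseq w k) (?c w) * (single (Abs_fperm u) (lookup (FF (Suc k)) (Abs_fperm u)) * single (dl (Suc k)) 1))"
    by (subst sum.cartesian_product[symmetric]) (simp add: mult_single)
  also have "\<dots> = (\<Sum>w\<in>Pi\<^sub>E {1..k} SS. single (dseq w k) (?c w)) *
      ((\<Sum>u\<in>SS (Suc k). single (Abs_fperm u) (lookup (FF (Suc k)) (Abs_fperm u))) * single (dl (Suc k)) 1)"
    by (simp only: sum_distrib_left sum_distrib_right)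
  also have "\<dots> = Ppart (Suc k)" by (simp add: Suc FF_sum[symmetric])
  finally show ?case by simp
qed simp

lemma dl_n: "dl n = 0"
  by (simp add: dl_def zero_fperm_def)

lemma hecke_prod_dseq:
  assumes w: "w \<in> Pi\<^sub>E {1..n} SS"
  shows "hecke_prod (w 1 # concat (map (\<lambda>j. [delta_perm n r j, w (j + 1)]) [1..<n])) = app (dseq w n)"
proof -
  let ?us = "\<lambda>k. w 1 # concat (map (\<lambda>j. [delta_perm n r j, w (j + 1)]) [1..<k])"
  have "\<forall>u\<in>set (?us n). u permutes {1..<Suc N}"
  proof
    have 1: "w i permutes {1..<Suc N}" if "1 \<le> i" "i \<le> n" for i
    proof (rule permutes_subset)
      show "w i permutes {1..<Suc (e (i - 1) + e i)}" using w that by (intro SS_permutes) (auto simp: PiE_iff)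
      have "e (i - 1) + e i \<le> N" using tsum_pred[of i] that tsum_antimono[of 0 "i - 1"] tsum_0 by simp
      thus "{1..<Suc (e (i - 1) + e i)} \<subseteq> {1..<Suc N}" by auto
    qed
    have 2: "delta_perm n r j permutes {1..<Suc N}" if "1 \<le> j" "j < n" for j
      unfolding delta_perm_bs[OF that]
      by (rule bs_permutes) (use tsum_pred[of j] that tsum_antimono[of 0 "j - 1"] tsum_0 in simp)
    fix u assume "u \<in> set (?us n)"
    thus "u permutes {1..<Suc N}" using 1 2 n by auto
  qed
  hence "hecke_prod (?us n) = app (sum_list (map Abs_fperm (?us n)))" by (rule hecke_prod_eq)
  \<comment> \<open>The list for \<open>k\<close> stops before \<open>delta_k\<close>, hence the
    extra \<open>dl k\<close>, which disappears for \<open>k = n\<close>.\<close>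
  moreover have "1 \<le> k \<Longrightarrow> k \<le> n \<Longrightarrow> sum_list (map Abs_fperm (?us k)) + dl k = dseq w k" for k
  proof (induction k rule: dec_induct)
    case (step k)
    have "sum_list (map Abs_fperm (?us (Suc k))) =
      sum_list (map Abs_fperm (?us k)) + (Abs_fperm (delta_perm n r k) + Abs_fperm (w (Suc k)))"
      using step by (simp add: upt_Suc add.assoc)
    moreover have "Abs_fperm (delta_perm n r k) = dl k" using step by (simp add: delta_perm_bs dl_def)
    ultimately show ?case using step by (simp add: add.assoc[symmetric])
  qed simp
  from this[of n] have "sum_list (map Abs_fperm (?us n)) = dseq w n" using n by (simp add: dl_n)
  ultimately show ?thesis by simp
qed

lemma kms_factorizations_eq: "kms_factorizations n r = {w \<in> Pi\<^sub>E {1..n} SS. dseq w n = zp}"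
proof -
  have "kms_factorizations n r = {w \<in> Pi\<^sub>E {1..n} SS. app (dseq w n) = zel n r}"
    unfolding kms_factorizations_def SS_def[symmetric] using hecke_prod_dseq by auto
  thus ?thesis by (simp add: app_zp[symmetric] app_inject)
qed

lemma lookup_Qpart_kms:
  "lookup (Qpart n) zp = (\<Sum>w\<in>kms_factorizations n r. \<Prod>i\<in>{1..n}. lookup (FF i) (Abs_fperm (w i)))"
proof -
  have fin: "finite (Pi\<^sub>E {1..n} SS)" by (intro finite_PiE finite_SS) simp
  have "lookup (Qpart n) zp = lookup (Ppart n) zp" using lookup_Ppart[OF app_zp] by simp
  also have "\<dots> = (\<Sum>w\<in>Pi\<^sub>E {1..n} SS. if dseq w n = zp then \<Prod>i\<in>{1..n}. lookup (FF i) (Abs_fperm (w i)) else 0)"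
    by (simp add: Ppart_sum lookup_sum lookup_single when_def del: One_nat_def)
  finally show ?thesis unfolding kms_factorizations_eq sum.inter_filter[OF fin] .
qed

end

section \<open>The maximal ranks of a given dimension vector\<close>

lemma max_rank_diag [simp]: "max_rank r i i = r i i"
  by (simp add: max_rank_def)

lemma max_rank_insert:
  "i \<le> j \<Longrightarrow> max_rank r i (Suc j) = min (max_rank r i j) (r (Suc j) (Suc j))"
  "Suc i \<le> j \<Longrightarrow> max_rank r i j = min (r i i) (max_rank r (Suc i) j)"
proof -
  assume "i \<le> j"
  hence "{i..Suc j} = insert (Suc j) {i..j}" by auto
  thus "max_rank r i (Suc j) = min (max_rank r i j) (r (Suc j) (Suc j))"
    using \<open>i \<le> j\<close> by (simp add: max_rank_def min.commute)
next
  assume "Suc i \<le> j"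
  hence "{i..j} = insert i {Suc i..j}" by auto
  thus "max_rank r i j = min (r i i) (max_rank r (Suc i) j)"
    using \<open>Suc i \<le> j\<close> by (simp add: max_rank_def)
qed

lemma max_rank_flat:
  assumes "i < j"
  shows "max_rank r i j = min (max_rank r i (j - 1)) (max_rank r (i + 1) j)"
proof -
  obtain k where j: "j = Suc k" "i \<le> k" using assms by (cases j) auto
  show ?thesis
  proof (cases "i = k")
    case True
    thus ?thesis using max_rank_insert(2)[of i j r] j by simp
  next
    case False
    thus ?thesis using max_rank_insert(1)[of i k r] max_rank_insert(2)[of i k r] max_rank_insert(1)[of "Suc i" k r] j
      by simp
  qed
qed

lemma rank_conditions_max_rank: "rank_conditions n (max_rank r)"
  unfolding rank_conditions_def
proof (intro conjI allI impI)
  fix i j assume "i < j \<and> j \<le> n"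
  thus "max_rank r i j \<le> min (max_rank r i (j - 1)) (max_rank r (i + 1) j)" using max_rank_flat[of i j r] by simp
next
  fix i j assume ij: "0 < i \<and> i \<le> j \<and> j < n"
  then obtain k where i: "i = Suc k" by (cases i) auto
  show "max_rank r (i - 1) j + max_rank r i (j + 1) \<le> max_rank r i j + max_rank r (i - 1) (j + 1)"
  proof -
    have 1: "max_rank r k j = min (r k k) (max_rank r i j)" using max_rank_insert(2)[of k j r] ij i by simp
    have 2: "max_rank r i (Suc j) = min (max_rank r i j) (r (Suc j) (Suc j))" using max_rank_insert(1) ij by blast
    have 3: "max_rank r k (Suc j) = min (max_rank r k j) (r (Suc j) (Suc j))"
      by (rule max_rank_insert(1)) (use ij i in simp)
    have "min a m + min m c \<le> m + min (min a m) c" for a m c :: nat by linarith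
    thus ?thesis unfolding i diff_Suc_1 Suc_eq_plus1[symmetric] 3 1 2[unfolded i] .
  qed
qed

lemma expected_codim_max_rank: "expected_codim n (max_rank r) = 0"
  unfolding expected_codim_def
proof (rule sum.neutral, clarify)
  fix i j :: nat assume "i < j"
  thus "(int (max_rank r i (j - 1)) - int (max_rank r i j)) * (int (max_rank r (i + 1) j) - int (max_rank r i j)) = 0"
    using max_rank_flat[of i j r] by (auto simp: min_def)
qed

section \<open>The indeterminates as nonzero, pairwise distinct elements\<close>

lemma single_1_inject: "single x (1 :: 'b::zero_neq_one) = single y 1 \<longleftrightarrow> x = y"
proof
  assume *: "single x (1 :: 'b) = single y 1"
  have "keys (single x (1 :: 'b)) = keys (single y (1 :: 'b))" by (simp only: *)
  thus "x = y" by simp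
qed simp

lemma X_neq_0: "X i j \<noteq> 0"
proof
  let ?x = "single (single (prod_encode (i, j)) (1::nat)) (1::int)"
  assume "X i j = 0"
  hence "?x = 0" by (simp add: X_def Zero_fract_def eq_fract)
  hence "keys ?x = {}" by (simp only: keys_zero)
  thus False by simp
qed

lemma X_inject: "X i j = X i' j' \<longleftrightarrow> i = i' \<and> j = j'"
proof
  assume "X i j = X i' j'"
  hence "single (single (prod_encode (i, j)) (1::nat)) (1::int) = single (single (prod_encode (i', j')) 1) 1"
    unfolding X_def by (simp only: eq_fract(1)[OF one_neq_zero one_neq_zero] mult_1_right)
  hence "prod_encode (i, j) = prod_encode (i', j')" unfolding single_1_inject .
  thus "i = i' \<and> j = j'" by (simp add: prod_encode_eq)
qed simp

theorem theorem6p3: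
  fixes n :: nat and r :: "nat \<Rightarrow> nat \<Rightarrow> nat"
  assumes "1 \<le> n"
    and "rank_conditions n r"
  shows "grothendieck (zel_hat n (max_rank r)) (all_vars_breve n r) (all_vars n r) \<noteq> 0 \<and>
    grothendieck (zel_hat n r) (all_vars_breve n r) (all_vars n r) /
      grothendieck (zel_hat n (max_rank r)) (all_vars_breve n r) (all_vars n r) =
    (\<Sum>w \<in> kms_factorizations n r.
       (-1) powi ((\<Sum>i=1..n. int (perm_length (w i))) - expected_codim n r) *
       (\<Prod>i=1..n. grothendieck_block r i (w i)))"
proof -
  define B where "B i = map fpair (block r i)" for i
  have block: "length (block r i) = r i i" "0 \<notin> set (block r i)" for i
    using X_neq_0 by (auto simp: block_def)
  interpret R: ranks_vars n r B
    using assms block by unfold_locales (auto simp: B_def intro!: unit_fpair)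
  interpret E: ranks_vars n "max_rank r" B
    using assms(1) rank_conditions_max_rank block by unfold_locales (auto simp: B_def intro!: unit_fpair)
  have as: "R.LL n = map fpair (all_vars_breve n r)" "R.LL 0 = map fpair (all_vars n r)"
    unfolding R.LL_n R.LL_0 all_vars_def all_vars_breve_def B_def by (simp_all add: map_concat comp_def)
  have N: "total_dim n (max_rank r) = total_dim n r" by (simp add: total_dim_def)
  have len: "length (all_vars_breve n r) = total_dim n r" "length (all_vars n r) = total_dim n r"
    using R.length_LL[of n] R.length_LL[of 0] by (simp_all add: as)
  have nz: "0 \<notin> set (all_vars_breve n r)" "0 \<notin> set (all_vars n r)"
    using block(2) by (auto simp: all_vars_breve_def all_vars_def)
  define C where "C = (\<Prod>j\<in>{1..n}. R.cross j)"
  \<comment> \<open>The forced crossings depend on the ranks only through the dimension vector,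
    which \<open>max_rank\<close> preserves.\<close>
  have cross: "E.cross j = R.cross j" for j
    unfolding E.cross_def R.cross_def E.dword_def R.dword_def E.rword_def R.rword_def E.tsum_def R.tsum_def
      max_rank_diag by (rule refl)
  \<comment> \<open>A forced crossing swaps an entry of block \<open>j - 1\<close> with one of a
    block beyond \<open>j\<close>; its parameter is a quotient of two distinct indeterminates and
    hence not 1.\<close>
  have "R.cross j \<noteq> 0" if j: "j \<in> {1..n}" for j
  proof
    assume "R.cross j = 0"
    then obtain i t where it: "(i, t) \<in> set (wts (R.dword j) (run (R.rword j) (R.LL (j - 1))))" "t = 1"
      unfolding R.cross_def prod_list_zero_iff by auto
    obtain y x where yx: "y \<in> set (B (j - 1))" "x \<in> set (concat (map B [Suc j..<Suc n]))" "t = fst y * snd x"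
      using R.LL_step(5)[of j] j it(1) by fastforce
    obtain s where y: "y = fpair (X (j - 1) s)" using yx(1) by (auto simp: B_def block_def)
    obtain l u where x: "x = fpair (X l u)" "Suc j \<le> l" using yx(2) by (auto simp: B_def block_def)
    have "X (j - 1) s = X l u" using it(2) X_neq_0[of l u] unfolding yx(3) y x(1) by (simp add: field_simps)
    thus False using x(2) by (auto simp: X_inject)
  qed
  hence C: "C \<noteq> 0" by (simp add: C_def)
  have num: "grothendieck (zel_hat n r) (all_vars_breve n r) (all_vars n r) =
      (-1) ^ R.crossings * (C * lookup (R.Qpart n) R.zp)"
    using grothendieck_eq_gcoeff[of "all_vars n r" "all_vars_breve n r" "zel_hat n r"] len nz R.zel_hat_permutes
      R.gcoeff_zel_hat by (simp add: as C_def)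
  have "lookup (E.Qpart n) E.zp = 1"
    by (rule E.lookup_Qpart_flat[OF max_rank_flat E.app_zp])
  hence den: "grothendieck (zel_hat n (max_rank r)) (all_vars_breve n r) (all_vars n r) = (-1) ^ E.crossings * C"
    using grothendieck_eq_gcoeff[of "all_vars n r" "all_vars_breve n r" "zel_hat n (max_rank r)"] len nz
      E.zel_hat_permutes E.gcoeff_zel_hat by (simp add: as C_def cross N)
  \<comment> \<open>The contributions of the dimension vector cancel, and the codimension of the
    maximal ranks is zero.\<close>
  have cr: "int R.crossings - int E.crossings = expected_codim n r"
    using R.crossings_eq E.crossings_eq by (simp add: expected_codim_max_rank)
  have sgn: "(-1) ^ R.crossings / (-1) ^ E.crossings = ((-1) powi expected_codim n r :: ratfun)"
    unfolding cr[symmetric] by (simp add: power_int_diff)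
  have blk: "grothendieck_block r i w = (-1) ^ perm_length w * lookup (R.FF i) (Abs_fperm w)"
    if "w permutes {1..r (i - 1) (i - 1) + r i i}" for i w
  proof -
    have "grothendieck_block r i w = gcoeff (map fpair (block r i @ replicate (r (i - 1) (i - 1)) 1))
        (map fpair (block r (i - 1) @ replicate (r i i) 1)) w"
      unfolding grothendieck_block_def
      by (rule grothendieck_eq_gcoeff)
        (use that block in \<open>auto simp: atLeastLessThanSuc_atLeastAtMost add.commute\<close>)
    thus ?thesis by (simp add: gcoeff_def R.FF_def B_def)
  qed
  have trm: "(-1) powi ((\<Sum>i=1..n. int (perm_length (w i))) - expected_codim n r) *
      (\<Prod>i=1..n. grothendieck_block r i (w i)) =
      (-1) powi expected_codim n r * (\<Prod>i\<in>{1..n}. lookup (R.FF i) (Abs_fperm (w i)))"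
    if w: "w \<in> kms_factorizations n r" for w
  proof -
    let ?L = "\<Sum>i=1..n. perm_length (w i)" and ?c = "\<lambda>i. lookup (R.FF i) (Abs_fperm (w i))"
    have "(\<Prod>i=1..n. grothendieck_block r i (w i)) = (\<Prod>i=1..n. (-1) ^ perm_length (w i) * ?c i)"
      using w by (intro prod.cong blk) (auto simp: kms_factorizations_def PiE_iff)
    also have "\<dots> = (-1) ^ ?L * (\<Prod>i=1..n. ?c i)" by (simp add: prod.distrib power_sum)
    finally have p: "(\<Prod>i=1..n. grothendieck_block r i (w i)) = (-1) ^ ?L * (\<Prod>i=1..n. ?c i)" .
    \<comment> \<open>The signs inside the \<open>gcoeff\<close> values cancel those of the summand,
      so the remaining sign is the same for all factorizations.\<close>
    have "(-1 :: ratfun) powi ((\<Sum>i=1..n. int (perm_length (w i))) - d) * (-1) ^ ?L = (-1) powi d" for d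
    proof -
      have "(\<Sum>i=1..n. int (perm_length (w i))) = int ?L" by simp
      hence "(-1 :: ratfun) powi ((\<Sum>i=1..n. int (perm_length (w i))) - d) * (-1) ^ ?L = (-1) powi (int ?L - d) * (-1) powi (int ?L)"
        by (simp only: power_int_of_nat)
      also have "\<dots> = (-1) powi (- d) * ((-1) powi int ?L * (-1) powi int ?L)"
        by (simp add: power_int_diff power_int_minus field_simps)
      also have "(-1 :: ratfun) powi int ?L * (-1) powi int ?L = 1"
        by (simp add: power_mult_distrib[symmetric])
      finally show ?thesis by (simp add: power_int_minus_one_minus)
    qed
    thus ?thesis unfolding p by (simp only: mult.assoc[symmetric])
  qed
  have "grothendieck (zel_hat n r) (all_vars_breve n r) (all_vars n r) /
      grothendieck (zel_hat n (max_rank r)) (all_vars_breve n r) (all_vars n r) =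
      ((-1) ^ R.crossings / (-1) ^ E.crossings) * lookup (R.Qpart n) R.zp"
    unfolding num den using C by simp
  also have "\<dots> = (\<Sum>w \<in> kms_factorizations n r. (-1) powi expected_codim n r * (\<Prod>i\<in>{1..n}. lookup (R.FF i) (Abs_fperm (w i))))"
    unfolding sgn R.lookup_Qpart_kms by (rule sum_distrib_left)
  also have "\<dots> = (\<Sum>w \<in> kms_factorizations n r.
       (-1) powi ((\<Sum>i=1..n. int (perm_length (w i))) - expected_codim n r) *
       (\<Prod>i=1..n. grothendieck_block r i (w i)))"
    by (intro sum.cong refl trm[symmetric])
  finally show ?thesis unfolding den using C by simp
qed

end
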